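(* For every $1<p<\infty$, every $k\in\{1,2,3\}$ and every $f\in L^p(\mathscr N)$, $$\|S_d^{(k)}(f)\|_{L^p(\mathscr N)}\simeq\|f\|_{L^p(\mathscr N)},$$ where $$S_d^{(k)}(f)(\mathbf g)=\Big(\sum_{\mathbf j\in\mathbb Z^3}\big|\Delta_{\mathbf j}^{(k)}f(\mathbf g)\big|^2\Big)^{1/2},$$ and the implicit constants depend only on $p$ and the dimensions $n_1,n_2,n_3$.
   Context: Fix integers $n_1,n_2,n_3\ge1$ and an integer $\kappa\ge10$. $\mathscr N$ is identified as a measure space with $\mathbb C^{n_1}\times\mathbb C^{n_2}\times\mathbb C^{n_3}\times\mathbb R^2$ with Lebesgue measure; points are $(\mathbf z_1,\mathbf z_2,\mathbf z_3,t_1,t_2)$. For $j\in\mathbb Z$ and $\mu\in\{1,2,3\}$: $\mathscr D_{j}^{(\mu)}$ is the set of standard half-open dyadic cubes of side length $2^{j}$ in $\mathbb C^{n_\mu}\cong\mathbb R^{2n_\mu}$; $\mathscr I_{j}^{(\mu)}$ is the set of standard half-open dyadic intervals of length $2^{2j+\kappa}$ in $\mathbb R$; $\mathscr Q_{j}^{(\mu)}=\{I\times J: I\in\mathscr D_{j}^{(\mu)},J\in\mathscr I_{j}^{(\mu)}\}$ are the parabolic dyadic blocks of scale $j$ in $\mathbb C^{n_\mu}\times\mathbb R$. For $\mathbf j=(j_1,j_2,j_3)\in\mathbb Z^3$: $\mathfrak Q_{\mathbf j}^{(1)}$ is the family of sets $\{(\mathbf z_1,t_1)\in Q_1,(\mathbf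 z_2,t_2)\in Q_2,\mathbf z_3\in I_3\}$ with $Q_1\in\mathscr Q_{j_1}^{(1)},Q_2\in\mathscr Q_{j_2}^{(2)},I_3\in\mathscr D_{j_3}^{(3)}$; $\mathfrak Q_{\mathbf j}^{(2)}$ is the family of sets $\{(\mathbf z_1,t_1)\in Q_1,\mathbf z_2\in I_2,(\mathbf z_3,t_2)\in Q_3\}$ with $Q_1\in\mathscr Q_{j_1}^{(1)},I_2\in\mathscr D_{j_2}^{(2)},Q_3\in\mathscr Q_{j_3}^{(3)}$. Let $\Theta(\mathbf z,t_1,t_2)=(\mathbf z,t_1-t_2,t_2)$ and $U_3f=f\circ\Theta$, $U_3^*f=f\circ\Theta^{-1}$. For $k=1,2$, $E_{\mathbf j}^{(k)}f(\mathbf g)$ is the average of $f$ over the unique element of $\mathfrak Q_{\mathbf j}^{(k)}$ containing $\mathbf g$, and the standard tri-parameter martingale difference (the product over the three parameters of one-parameter differences between scale $j_\mu-1$ and scale $j_\mu$) is $$\Delta_{\mathbf j}^{(k)}=\sum_{\eta\in\{0,1\}^3}(-1)^{3-(\eta_1+\eta_2+\eta_3)}E_{\mathbf j-\eta}^{(k)}.$$ For $k=3$, $\Delta_{\mathbf j}^{(3)}=U_3\Delta_{\mathbf j}^{(2)}U_3^*$. $A\simeq B$ means $c\,B\le A\le C\,B$ for constants $0<c\le C<\infty$. *)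

theory Defs
  imports "HOL-Analysis.Analysis"
begin

text \<open>The group as a measure space: points are \<open>(z1, z2, z3, t1, t2)\<close>, and the measure is
  \<^term>\<open>lebesgue\<close> on this Euclidean space.\<close>

type_synonym ('n1, 'n2, 'n3) nspace =
  "(complex ^ 'n1) \<times> (complex ^ 'n2) \<times> (complex ^ 'n3) \<times> real \<times> real"

text \<open>For \<open>complex ^ 'n\<close> the basis vectors are \<open>axis i 1\<close> and \<open>axis i \<i>\<close>, so inner products
  with them are the real and imaginary parts of the components; for \<^typ>\<open>real\<close> the members are the
  dyadic intervals of length \<open>2\<^sup>j\<close>.\<close>

definition dyadic_cubes :: "int \<Rightarrow> 'a::euclidean_space set set" where
  "dyadic_cubes j =
    {{x. \<forall>b\<in>Basis. of_int (m b) * 2 powi j \<le> x \<bullet> b \<and> x \<bullet> b < (of_int (m b) + 1) * 2 powi j}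
     | m :: 'a \<Rightarrow> int. True}"

definition parabolic_blocks :: "int \<Rightarrow> int \<Rightarrow> ((complex ^ 'n::finite) \<times> real) set set" where
  "parabolic_blocks \<kappa> j = {I \<times> J | I J. I \<in> dyadic_cubes j \<and> J \<in> dyadic_cubes (2 * j + \<kappa>)}"

definition blocks1 :: "int \<Rightarrow> int \<times> int \<times> int \<Rightarrow> ('n1::finite, 'n2::finite, 'n3::finite) nspace set set"
  where "blocks1 \<kappa> = (\<lambda>(j1, j2, j3).
    {{(z1, z2, z3, t1, t2). (z1, t1) \<in> Q1 \<and> (z2, t2) \<in> Q2 \<and> z3 \<in> I3} | Q1 Q2 I3.
      Q1 \<in> parabolic_blocks \<kappa> j1 \<and> Q2 \<in> parabolic_blocks \<kappa> j2 \<and> I3 \<in> dyadic_cubes j3})"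

definition blocks2 :: "int \<Rightarrow> int \<times> int \<times> int \<Rightarrow> ('n1::finite, 'n2::finite, 'n3::finite) nspace set set"
  where "blocks2 \<kappa> = (\<lambda>(j1, j2, j3).
    {{(z1, z2, z3, t1, t2). (z1, t1) \<in> Q1 \<and> z2 \<in> I2 \<and> (z3, t2) \<in> Q3} | Q1 I2 Q3.
      Q1 \<in> parabolic_blocks \<kappa> j1 \<and> I2 \<in> dyadic_cubes j2 \<and> Q3 \<in> parabolic_blocks \<kappa> j3})"

text \<open>In the next two definitions \<open>\<Q>\<close> assigns to each scale \<open>j\<close> a partition of the space.\<close>

definition block_avg ::
  "(int \<times> int \<times> int \<Rightarrow> 'a::euclidean_space set set) \<Rightarrow> int \<times> int \<times> int \<Rightarrow> ('a \<Rightarrow> complex) \<Rightarrow> 'a \<Rightarrow> complex"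
  where "block_avg \<Q> j f g =
    (let Q = (THE Q. Q \<in> \<Q> j \<and> g \<in> Q) in (LINT x:Q|lebesgue. f x) /\<^sub>R measure lebesgue Q)"

definition block_diff ::
  "(int \<times> int \<times> int \<Rightarrow> 'a::euclidean_space set set) \<Rightarrow> int \<times> int \<times> int \<Rightarrow> ('a \<Rightarrow> complex) \<Rightarrow> 'a \<Rightarrow> complex"
  where "block_diff \<Q> = (\<lambda>(j1, j2, j3) f g.
    \<Sum>(e1, e2, e3) \<in> {0, 1} \<times> {0, 1} \<times> {0, 1}.
      (- 1) ^ (3 - (e1 + e2 + e3)) * block_avg \<Q> (j1 - int e1, j2 - int e2, j3 - int e3) f g)"

definition Theta :: "('n1::finite, 'n2::finite, 'n3::finite) nspace \<Rightarrow> ('n1, 'n2, 'n3) nspace" where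
  "Theta = (\<lambda>(z1, z2, z3, t1, t2). (z1, z2, z3, t1 - t2, t2))"

definition U3 :: "(('n1::finite, 'n2::finite, 'n3::finite) nspace \<Rightarrow> complex) \<Rightarrow> ('n1, 'n2, 'n3) nspace \<Rightarrow> complex"
  where "U3 f = f \<circ> Theta"

definition U3_star :: "(('n1::finite, 'n2::finite, 'n3::finite) nspace \<Rightarrow> complex) \<Rightarrow> ('n1, 'n2, 'n3) nspace \<Rightarrow> complex"
  where "U3_star f = f \<circ> inv Theta"

text \<open>Only \<open>k \<in> {1, 2, 3}\<close> is meaningful.\<close>

definition mart_diff ::
  "int \<Rightarrow> nat \<Rightarrow> int \<times> int \<times> int \<Rightarrow>
    (('n1::finite, 'n2::finite, 'n3::finite) nspace \<Rightarrow> complex) \<Rightarrow> ('n1, 'n2, 'n3) nspace \<Rightarrow> complex"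
  where "mart_diff \<kappa> k j f =
    (if k = 1 then block_diff (blocks1 \<kappa>) j f
     else if k = 2 then block_diff (blocks2 \<kappa>) j f
     else U3 (block_diff (blocks2 \<kappa>) j (U3_star f)))"

text \<open>Real powers on \<^typ>\<open>ennreal\<close>, for exponents \<open>a > 0\<close>.\<close>

definition enn_powr :: "ennreal \<Rightarrow> real \<Rightarrow> ennreal" where
  "enn_powr x a = (if x = \<infinity> then \<infinity> else ennreal (enn2real x powr a))"

text \<open>The square function may be infinite at some points, hence norms are taken of
  \<^typ>\<open>ennreal\<close>-valued functions; for complex \<open>f\<close> they are applied to \<open>norm \<circ> f\<close>.\<close>

definition square_fun ::
  "int \<Rightarrow> nat \<Rightarrow> (('n1::finite, 'n2::finite, 'n3::finite) nspace \<Rightarrow> complex) \<Rightarrow> ('n1, 'n2, 'n3) nspace \<Rightarrow> ennreal"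
  where "square_fun \<kappa> k f g =
    enn_powr (\<Sum>\<^sub>\<infinity>j. ennreal ((cmod (mart_diff \<kappa> k j f g))\<^sup>2)) (1 / 2)"

definition Lp_norm :: "real \<Rightarrow> ('a::euclidean_space \<Rightarrow> ennreal) \<Rightarrow> ennreal" where
  "Lp_norm p F = enn_powr (\<integral>\<^sup>+ x. enn_powr (F x) p \<partial>lebesgue) (1 / p)"

definition Lp_space :: "real \<Rightarrow> ('a::euclidean_space \<Rightarrow> complex) set" where
  "Lp_space p = {f \<in> borel_measurable lebesgue. Lp_norm p (\<lambda>x. ennreal (cmod (f x))) < \<infinity>}"

end

theory Submission
  imports Defs
begin

text \<open>The blocks of both families are the cells of a grid that prescribes a dyadic side length in
  every coordinate, and the average over such a cell is a conditional expectation. Two cells of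
  different shapes are independent inside a cell of the coarser shape that contains both, so
  averages compose by \<open>E\<^sub>s E\<^sub>s\<^sub>' = E\<^sub>m\<^sub>a\<^sub>x\<close> (\<open>avg_avg\<close>). This identity replaces the product structure of
  the space: it says at once that scales are nested and that different parameters commute.

  In one parameter, the operator that multiplies the martingale differences by signs is bounded
  on \<open>L\<^sup>p\<close> with a constant depending only on \<open>p\<close>. This is Burkholder's theorem, and his method is
  used: a function of two variables that is convex in each of them separately and lies below
  \<open>C \<bar>u + v\<bar>\<^sup>p - c \<bar>u - v\<bar>\<^sup>p\<close> can only grow, on average, along the martingale and its transform, and it
  starts nonnegative (\<open>burkholder_zigzag_support\<close>, \<open>burkholder_upper\<close>,
  \<open>martingale_transform_bound\<close>). The proof works for all \<open>1 < p < \<infinity>\<close> at once, without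
  interpolation or duality.

  For a finite box of scales, one sign change in each parameter turns the sum of the differences
  \<open>\<Delta>\<^sub>j f\<close> into \<open>\<Sum> \<epsilon> \<epsilon>' \<epsilon>'' \<Delta>\<^sub>j f\<close>, and the same three sign changes turn it back. Hence both sums have
  comparable norms for every choice of signs. Averaging over the signs and applying
  Khintchine's inequality pointwise, for chaos of order three (\<open>khintchine3\<close>), compares the plain
  sum with the square function of the box (\<open>box_square_equivalence\<close>).

  The plain sum telescopes to eight averages of \<open>f\<close>. These are contractions, which gives the upper
  bound after monotone convergence in the box. For the lower bound, the averages with a coarse
  scale tend to zero pointwise, since \<open>\<bar>E f\<bar>\<^sup>p\<close> is at most the integral of \<open>\<bar>f\<bar>\<^sup>p\<close> divided by the
  volume of the block (\<open>avg_tendsto_0\<close>), and the remaining averages at fine scale tend to \<open>f\<close>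
  locally in \<open>L\<^sup>1\<close> (\<open>avg_tendsto_L1\<close>); Fatou's lemma carries the bound to the limit.

  No constant depends on the grid, hence none depends on \<open>\<kappa>\<close>. Complex functions are treated
  through their real and imaginary parts, and the third family is the second one composed with
  a shear, which preserves Lebesgue measure.\<close>

section \<open>The Burkholder function\<close>

text \<open>Put \<open>x = (u + v) / 2\<close> and \<open>y = (u - v) / 2\<close>; then \<open>max \<bar>u\<bar> \<bar>v\<bar> = \<bar>x\<bar> + \<bar>y\<bar>\<close>. For \<open>p \<ge> 2\<close> the function
  is \<open>2 ((p - 1) \<bar>x\<bar> - \<bar>y\<bar>) (\<bar>x\<bar> + \<bar>y\<bar>)\<^sup>p\<^sup>-\<^sup>1\<close>, a negative multiple of Burkholder's function; for \<open>p < 2\<close>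
  the factor \<open>p - 1\<close> moves to \<open>\<bar>y\<bar>\<close>. The coordinates \<open>u, v\<close> are preferred because a step of a
  transform with sign \<open>1\<close> or \<open>-1\<close> moves only one of them.\<close>
definition burkholder :: "real \<Rightarrow> real \<Rightarrow> real \<Rightarrow> real" where
  "burkholder p u v = \<bar>p - 2\<bar> * max \<bar>u\<bar> \<bar>v\<bar> powr p + p * (u * v) * max \<bar>u\<bar> \<bar>v\<bar> powr (p - 2)"

lemma burkholder_commute: "burkholder p u v = burkholder p v u"
  by (simp add: burkholder_def max.commute mult.commute)

lemma burkholder_scale:
  assumes "a \<noteq> 0"
  shows "burkholder p (a * u) (a * v) = \<bar>a\<bar> powr p * burkholder p u v"
proof -
  have m: "max \<bar>a * u\<bar> \<bar>a * v\<bar> = \<bar>a\<bar> * max \<bar>u\<bar> \<bar>v\<bar>"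
    by (simp add: abs_mult max_mult_distrib_left)
  have "\<bar>a\<bar> powr p = a\<^sup>2 * \<bar>a\<bar> powr (p - 2)"
    using assms by (simp add: powr_diff)
  then show ?thesis
    by (simp add: burkholder_def m powr_mult algebra_simps power2_eq_square)
qed

text \<open>These are the branches of \<open>u \<mapsto> burkholder p u 1\<close> outside \<open>[-1, 1]\<close>, for \<open>\<sigma> u = w \<ge> 1\<close>. Such a
  branch is convex because its second derivative is \<open>p (p - 1) w\<^sup>p\<^sup>-\<^sup>3 (q w + \<sigma> (p - 2))\<close>, and at \<open>w = 1\<close>
  its slope in \<open>w\<close> is at least that of the linear branch on \<open>[-1, 1]\<close>. The bound on the slope is
  what allows the branches to be glued.\<close>
lemma powr_combination_tangent:
  fixes p q \<sigma> :: real
  assumes p: "1 < p" and q: "q = \<bar>p - 2\<bar>" and \<sigma>: "\<sigma> \<in> {1, -1}" and x: "1 \<le> x"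
  defines "\<psi> \<equiv> \<lambda>w. q * w powr p + \<sigma> * p * w powr (p - 1)"
  obtains g where "g \<ge> \<sigma> * p" "\<And>y. 1 \<le> y \<Longrightarrow> \<psi> y \<ge> \<psi> x + g * (y - x)"
proof -
  define d where "d = (\<lambda>w. q * (p * w powr (p - 1)) + \<sigma> * p * ((p - 1) * w powr (p - 2)))"
  define dd where "dd = (\<lambda>w. q * (p * ((p - 1) * w powr (p - 2))) + \<sigma> * p * ((p - 1) * ((p - 2) * w powr (p - 3))))"
  have D: "(\<psi> has_real_derivative d w) (at w)" if "w \<ge> 1" for w
    unfolding \<psi>_def d_def using that by (auto intro!: derivative_eq_intros)
  have DD: "(d has_real_derivative dd w) (at w)" if "w \<ge> 1" for w
    unfolding d_def dd_def using that by (auto intro!: derivative_eq_intros)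
  have dd0: "dd w \<ge> 0" if "w \<ge> 1" for w
  proof -
    have "w powr (p - 2) = w * w powr (p - 3)"
      using that by (simp add: powr_mult_base)
    then have e: "dd w = p * (p - 1) * w powr (p - 3) * (q * w + \<sigma> * (p - 2))"
      by (simp add: dd_def algebra_simps)
    have "q * 1 \<le> q * w" using that q by (intro mult_left_mono) auto
    moreover have "q + \<sigma> * (p - 2) \<ge> 0" using \<sigma> q by auto
    ultimately show ?thesis unfolding e using p by (intro mult_nonneg_nonneg) auto
  qed
  have mono: "d 1 \<le> d x"
    using x by (rule DERIV_nonneg_imp_nondecreasing) (use DD dd0 in blast)
  have "\<psi> y - \<psi> x \<ge> d x * (y - x)" if "1 \<le> y" for y
    using f''_imp_f'[where C="{1..}" and f=\<psi> and f'=d and f''=dd] D DD dd0 x that by auto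
  moreover have "d 1 \<ge> \<sigma> * p"
  proof -
    have "d 1 = p * (q + \<sigma> * (p - 1))" by (simp add: d_def algebra_simps)
    moreover have "q + \<sigma> * (p - 1) \<ge> \<sigma>" using \<sigma> q by auto
    ultimately show ?thesis using p by (simp add: mult.commute)
  qed
  ultimately show thesis using that[of "d x"] mono by (auto simp: algebra_simps)
qed

lemma burkholder_one:
  "\<bar>u\<bar> \<le> 1 \<Longrightarrow> burkholder p u 1 = \<bar>p - 2\<bar> + p * u"
  "\<sigma> \<in> {1, -1} \<Longrightarrow> \<sigma> * u \<ge> 1 \<Longrightarrow>
     burkholder p u 1 = \<bar>p - 2\<bar> * (\<sigma> * u) powr p + \<sigma> * p * (\<sigma> * u) powr (p - 1)"
proof -
  show "\<bar>u\<bar> \<le> 1 \<Longrightarrow> burkholder p u 1 = \<bar>p - 2\<bar> + p * u"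
    by (simp add: burkholder_def max_def)
  assume s: "\<sigma> \<in> {1, -1}" and u: "\<sigma> * u \<ge> 1"
  have "max \<bar>u\<bar> \<bar>1\<bar> = \<sigma> * u" using s u by auto
  moreover have "(\<sigma> * u) powr (p - 1) = (\<sigma> * u) * (\<sigma> * u) powr (p - 2)"
    using u by (simp add: powr_mult_base)
  moreover have "\<sigma> * \<sigma> = 1" using s by auto
  ultimately show "burkholder p u 1 = \<bar>p - 2\<bar> * (\<sigma> * u) powr p + \<sigma> * p * (\<sigma> * u) powr (p - 1)"
    using s by (auto simp add: burkholder_def algebra_simps)
qed

text \<open>The outer branches start on the line that carries the middle branch, and in the outward
  direction they leave it with at least its slope.\<close>
lemma burkholder_one_ge_line:
  assumes "1 < p"
  shows "burkholder p u 1 \<ge> \<bar>p - 2\<bar> + p * u"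
proof (cases "\<bar>u\<bar> \<le> 1")
  case False
  define \<sigma> :: real where "\<sigma> = (if u \<ge> 0 then 1 else -1)"
  have s: "\<sigma> \<in> {1, -1}" "1 \<le> \<sigma> * u" "\<sigma> * \<sigma> = 1" using False by (auto simp: \<sigma>_def)
  obtain g where g1: "g \<ge> \<sigma> * p" and g2: "\<And>y. 1 \<le> y \<Longrightarrow>
      \<bar>p - 2\<bar> * y powr p + \<sigma> * p * y powr (p - 1) \<ge>
      \<bar>p - 2\<bar> * 1 powr p + \<sigma> * p * 1 powr (p - 1) + g * (y - 1)"
    using powr_combination_tangent[OF assms refl s(1) order_refl] by blast
  have g: "g \<ge> \<sigma> * p" "burkholder p u 1 \<ge> \<bar>p - 2\<bar> + \<sigma> * p + g * (\<sigma> * u - 1)"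
    using g1 g2[OF s(2)] burkholder_one(2)[OF s(1,2), of p] by auto
  have "g * (\<sigma> * u - 1) \<ge> (\<sigma> * p) * (\<sigma> * u - 1)"
    using g(1) s(2) by (intro mult_right_mono) auto
  moreover have "(\<sigma> * p) * (\<sigma> * u - 1) = p * u - \<sigma> * p"
    using s(3) by (simp add: algebra_simps)
  ultimately show ?thesis using g(2) by linarith
qed (simp add: burkholder_one(1))

text \<open>On \<open>[-1, 1]\<close> the line of the middle branch supports. A tangent of an outer branch passes
  below the junction, and its outward slope is at least that of the line; beyond the junction it
  thus stays below the line, hence below the function.\<close>
lemma burkholder_one_support:
  assumes p: "1 < p"
  shows "\<exists>g. \<forall>y. burkholder p y 1 \<ge> burkholder p x 1 + g * (y - x)"
proof (cases "\<bar>x\<bar> \<le> 1")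
  case True
  then have "burkholder p y 1 \<ge> burkholder p x 1 + p * (y - x)" for y
    using burkholder_one_ge_line[OF p, of y] by (simp add: burkholder_one(1) algebra_simps)
  then show ?thesis by blast
next
  case False
  define \<sigma> :: real where "\<sigma> = (if x \<ge> 0 then 1 else -1)"
  have s: "\<sigma> \<in> {1, -1}" "1 \<le> \<sigma> * x" "\<sigma> * \<sigma> = 1" using False by (auto simp: \<sigma>_def)
  define \<psi> where "\<psi> = (\<lambda>w. \<bar>p - 2\<bar> * w powr p + \<sigma> * p * w powr (p - 1))"
  obtain g where g: "g \<ge> \<sigma> * p" "\<And>w. 1 \<le> w \<Longrightarrow> \<psi> w \<ge> \<psi> (\<sigma> * x) + g * (w - \<sigma> * x)"
    using powr_combination_tangent[OF p refl s(1,2)] unfolding \<psi>_def by blast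
  have B: "burkholder p w 1 = \<psi> (\<sigma> * w)" if "1 \<le> \<sigma> * w" for w
    unfolding \<psi>_def by (rule burkholder_one(2)[OF s(1) that])
  have "burkholder p y 1 \<ge> burkholder p x 1 + (\<sigma> * g) * (y - x)" for y
  proof (cases "1 \<le> \<sigma> * y")
    case True
    then show ?thesis using g(2)[OF True] s(2) by (simp add: B algebra_simps)
  next
    case False
    have "\<psi> (\<sigma> * x) + g * (1 - \<sigma> * x) \<le> \<bar>p - 2\<bar> + \<sigma> * p"
      using g(2)[of 1] by (simp add: \<psi>_def)
    moreover have "g * (\<sigma> * y - 1) \<le> \<sigma> * p * (\<sigma> * y - 1)"
      using g(1) False by (intro mult_right_mono_neg) auto
    moreover have "\<sigma> * p * (\<sigma> * y - 1) = p * y - \<sigma> * p"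
      using s(3) by (simp add: algebra_simps)
    moreover have "burkholder p y 1 \<ge> \<bar>p - 2\<bar> + p * y" by (rule burkholder_one_ge_line[OF p])
    ultimately have "burkholder p y 1 \<ge> \<psi> (\<sigma> * x) + g * (1 - \<sigma> * x) + g * (\<sigma> * y - 1)" by linarith
    then show ?thesis using s(2) by (simp add: B algebra_simps)
  qed
  then show ?thesis by blast
qed

text \<open>By scaling to \<open>x = 1\<close> this is Bernoulli's inequality. It is the case \<open>v = 0\<close> of the convexity of
  the Burkholder function, and it also gives Jensen's inequality for averages.\<close>
lemma abs_powr_support:
  fixes p x :: real
  assumes p: "1 < p"
  shows "\<exists>g. \<forall>y. \<bar>y\<bar> powr p \<ge> \<bar>x\<bar> powr p + g * (y - x)"
proof (cases "x = 0")
  case True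
  then show ?thesis by (intro exI[of _ 0]) auto
next
  case False
  have *: "\<bar>t\<bar> powr p \<ge> 1 + p * (t - 1)" for t :: real
  proof (cases "t > 0")
    case True
    have "t powr p - 1 powr p \<ge> (p * 1 powr (p - 1)) * (t - 1)"
      by (rule f''_imp_f'[where C="{0<..}" and f="\<lambda>x. x powr p" and f'="\<lambda>x. p * x powr (p - 1)"
            and f''="\<lambda>x. p * ((p - 1) * x powr (p - 2))"])
        (use True p in \<open>auto intro!: derivative_eq_intros\<close>)
    then show ?thesis using True by simp
  next
    case False
    then have "p * t \<le> 0" using p by (simp add: mult_nonneg_nonpos)
    then have "1 + p * (t - 1) \<le> 0" using p by (simp add: algebra_simps)
    then show ?thesis by (smt (verit) powr_ge_zero)
  qed
  have "\<bar>y\<bar> powr p \<ge> \<bar>x\<bar> powr p + (p * \<bar>x\<bar> powr p / x) * (y - x)" for y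
  proof -
    have "\<bar>y\<bar> powr p = \<bar>x\<bar> powr p * \<bar>y / x\<bar> powr p"
      using False by (simp add: powr_divide abs_divide)
    also have "\<dots> \<ge> \<bar>x\<bar> powr p * (1 + p * (y / x - 1))"
      by (intro mult_left_mono *) auto
    finally show ?thesis using False by (simp add: field_simps)
  qed
  then show ?thesis by blast
qed

lemma burkholder_support:
  assumes p: "1 < p"
  shows "\<exists>g. \<forall>u'. burkholder p u' v \<ge> burkholder p u v + g * (u' - u)"
proof (cases "v = 0")
  case True
  obtain g where g: "\<And>y. \<bar>y\<bar> powr p \<ge> \<bar>u\<bar> powr p + g * (y - u)"
    using abs_powr_support[OF p] by blast
  have "burkholder p y v \<ge> burkholder p u v + (\<bar>p - 2\<bar> * g) * (y - u)" for y
    using mult_left_mono[OF g[of y], of "\<bar>p - 2\<bar>"] by (simp add: True burkholder_def algebra_simps)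
  then show ?thesis by blast
next
  case False
  obtain g where g: "\<And>y. burkholder p y 1 \<ge> burkholder p (u / v) 1 + g * (y - u / v)"
    using burkholder_one_support[OF p] by blast
  have *: "burkholder p w v = \<bar>v\<bar> powr p * burkholder p (w / v) 1" for w
    using burkholder_scale[OF False, of p "w / v" 1] False by simp
  have "burkholder p y v \<ge> burkholder p u v + (\<bar>v\<bar> powr p * g / v) * (y - u)" for y
    using mult_left_mono[OF g[of "y / v"], of "\<bar>v\<bar> powr p"] False
    unfolding *[of y] *[of u] by (simp add: field_simps)
  then show ?thesis by blast
qed

text \<open>When \<open>x\<close> moves by \<open>h\<close> and \<open>y\<close> by \<open>h\<close> or \<open>-h\<close>, only one of \<open>x + y\<close> and \<open>x - y\<close> changes. Separate
  convexity is therefore all that a martingale transform needs.\<close>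
lemma burkholder_zigzag_support:
  assumes p: "1 < p" and e: "\<epsilon> \<in> {1, -1}"
  shows "\<exists>g. \<forall>h. burkholder p (x + h + (y + \<epsilon> * h)) (x + h - (y + \<epsilon> * h))
    \<ge> burkholder p (x + y) (x - y) + g * h"
  using e
proof (elim insertE)
  assume e: "\<epsilon> = 1"
  obtain g where g: "\<And>u'. burkholder p u' (x - y) \<ge> burkholder p (x + y) (x - y) + g * (u' - (x + y))"
    using burkholder_support[OF p] by blast
  show ?thesis
    using g[of "x + y + 2 * h" for h] by (intro exI[of _ "2 * g"]) (simp add: e algebra_simps)
next
  assume e: "\<epsilon> = -1"
  obtain g where g: "\<And>u'. burkholder p u' (x + y) \<ge> burkholder p (x - y) (x + y) + g * (u' - (x - y))"
    using burkholder_support[OF p] by blast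
  show ?thesis
    using g[of "x - y + 2 * h" for h] unfolding burkholder_commute[of p _ "x + y"]
    by (intro exI[of _ "2 * g"]) (simp add: e algebra_simps)
qed simp

text \<open>By homogeneity the variable of larger modulus may be taken to be \<open>1\<close>. If the other one is \<open>r\<close>, the
  value is \<open>p (1 + r) - \<delta>\<close> with \<open>\<delta> = p - \<bar>p - 2\<bar>\<close>, and \<open>\<delta> > 0\<close> exactly because \<open>p > 1\<close>. Near \<open>r = -1\<close> the
  value is at most \<open>- \<delta> / 2\<close>, and elsewhere a multiple of \<open>(1 + r)\<^sup>p\<close> dominates.\<close>
lemma burkholder_upper:
  assumes p: "1 < p"
  shows "\<exists>c C. 0 < c \<and> 0 \<le> C \<and> (\<forall>x y. burkholder p (x + y) (x - y) \<le> C * \<bar>x\<bar> powr p - c * \<bar>y\<bar> powr p)"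
proof -
  define q where "q = \<bar>p - 2\<bar>"
  define \<delta> where "\<delta> = p - q"
  define c where "c = \<delta> / 2 / 2 powr p"
  \<comment> \<open>\<open>(1 + r)\<^sup>1\<^sup>-\<^sup>p\<close> is largest at the left end \<open>\<delta> / (2 p)\<close> of the range in which \<open>C\<close> is used.\<close>
  define C where "C = p * (\<delta> / (2 * p)) powr (1 - p)"
  have d: "0 < \<delta>" using p by (auto simp: \<delta>_def q_def)
  have cC: "0 < c" "0 \<le> C" using d p by (auto simp: c_def C_def)
  have one: "q + p * r \<le> C * \<bar>1 + r\<bar> powr p - c * \<bar>1 - r\<bar> powr p" if "\<bar>r\<bar> \<le> 1" for r
  proof -
    have "c * \<bar>1 - r\<bar> powr p \<le> c * 2 powr p"
      using that cC p by (intro mult_left_mono powr_mono2) auto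
    then have 1: "c * \<bar>1 - r\<bar> powr p \<le> \<delta> / 2" by (simp add: c_def)
    have 2: "q + p * r = p * (1 + r) - \<delta>" by (simp add: \<delta>_def algebra_simps)
    show ?thesis
    proof (cases "p * (1 + r) \<le> \<delta> / 2")
      case True
      have "C * \<bar>1 + r\<bar> powr p \<ge> 0" using cC by auto
      then show ?thesis using True 1 2 by linarith
    next
      case False
      have s: "\<delta> / (2 * p) \<le> 1 + r" "0 < 1 + r"
        using False p d zero_less_mult_pos[of p "1 + r"] by (auto simp: field_simps)
      have "(1 + r) powr (1 - p) \<le> (\<delta> / (2 * p)) powr (1 - p)"
        using s p d by (intro powr_mono2') auto
      then have "p * (1 + r) powr (1 - p) * (1 + r) powr p \<le> C * (1 + r) powr p"
        unfolding C_def using p by (intro mult_right_mono mult_left_mono) auto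
      moreover have "(1 + r) powr (1 - p) * (1 + r) powr p = 1 + r"
        using s by (simp flip: powr_add)
      ultimately have "p * (1 + r) \<le> C * \<bar>1 + r\<bar> powr p"
        using s by (simp add: mult.assoc)
      then show ?thesis using 1 2 d by linarith
    qed
  qed
  have two: "burkholder p u v \<le> C * \<bar>u + v\<bar> powr p - c * \<bar>u - v\<bar> powr p" if "\<bar>v\<bar> \<le> \<bar>u\<bar>" for u v
  proof (cases "u = 0")
    case False
    define r where "r = v / u"
    have r: "\<bar>r\<bar> \<le> 1" "v = u * r" using that False by (auto simp: r_def)
    have "burkholder p u v = \<bar>u\<bar> powr p * (q + p * r)"
      using burkholder_scale[OF False, of p 1 r] r burkholder_one(1)[of r p] burkholder_commute[of p 1 r] by (simp add: q_def)
    also have "\<dots> \<le> \<bar>u\<bar> powr p * (C * \<bar>1 + r\<bar> powr p - c * \<bar>1 - r\<bar> powr p)"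
      by (intro mult_left_mono one r) auto
    also have "\<dots> = C * \<bar>u * (1 + r)\<bar> powr p - c * \<bar>u * (1 - r)\<bar> powr p"
      unfolding abs_mult powr_mult by (simp add: algebra_simps)
    finally show ?thesis by (simp add: r algebra_simps)
  qed (use that p in \<open>simp add: burkholder_def\<close>)
  have "burkholder p (x + y) (x - y) \<le> C * \<bar>2 * x\<bar> powr p - c * \<bar>2 * y\<bar> powr p" for x y
  proof (cases "\<bar>x - y\<bar> \<le> \<bar>x + y\<bar>")
    case True
    then show ?thesis using two[OF True] by simp
  next
    case False
    then have "\<bar>x + y\<bar> \<le> \<bar>x - y\<bar>" by simp
    from two[OF this] show ?thesis using burkholder_commute by (simp add: abs_minus_commute algebra_simps)
  qed
  then have "burkholder p (x + y) (x - y) \<le> (C * 2 powr p) * \<bar>x\<bar> powr p - (c * 2 powr p) * \<bar>y\<bar> powr p" for x y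
    by (simp add: abs_mult powr_mult mult.assoc)
  then show ?thesis using cC by (intro exI[of _ "c * 2 powr p"] exI[of _ "C * 2 powr p"]) auto
qed

section \<open>Moments of Rademacher chaos\<close>

text \<open>A choice of signs is encoded by the set on which the sign is \<open>-1\<close>, so that the mean over all
  choices is a mean over a power set.\<close>
definition sgn_of :: "'a set \<Rightarrow> 'a \<Rightarrow> real" where
  "sgn_of S a = (if a \<in> S then -1 else 1)"

definition rad_avg :: "'a set \<Rightarrow> ('a set \<Rightarrow> real) \<Rightarrow> real" where
  "rad_avg A \<phi> = (\<Sum>S\<in>Pow A. \<phi> S) / 2 ^ card A"

lemma rad_avg_empty: "rad_avg {} \<phi> = \<phi> {}"
  by (simp add: rad_avg_def)

lemma rad_avg_insert:
  assumes "finite A" "a \<notin> A"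
  shows "rad_avg (insert a A) \<phi> = rad_avg A (\<lambda>S. (\<phi> S + \<phi> (insert a S)) / 2)"
proof -
  have inj: "inj_on (insert a) (Pow A)" using assms(2) by (auto simp: inj_on_def)
  have "(\<Sum>S\<in>Pow (insert a A). \<phi> S) = (\<Sum>S\<in>Pow A. \<phi> S) + (\<Sum>S\<in>insert a ` Pow A. \<phi> S)"
    unfolding Pow_insert using assms by (intro sum.union_disjoint) auto
  also have "\<dots> = (\<Sum>S\<in>Pow A. \<phi> S + \<phi> (insert a S))"
    by (simp add: sum.reindex[OF inj] sum.distrib)
  finally show ?thesis
    using assms by (simp add: rad_avg_def sum_divide_distrib[symmetric])
qed

lemma rad_avg_mono: "(\<And>S. S \<subseteq> A \<Longrightarrow> \<phi> S \<le> \<psi> S) \<Longrightarrow> rad_avg A \<phi> \<le> rad_avg A \<psi>"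
  by (auto simp: rad_avg_def intro!: divide_right_mono sum_mono)

lemma rad_avg_cong: "(\<And>S. S \<subseteq> A \<Longrightarrow> \<phi> S = \<psi> S) \<Longrightarrow> rad_avg A \<phi> = rad_avg A \<psi>"
  by (auto simp: rad_avg_def intro!: sum.cong arg_cong2[where f="(/)"])

lemma rad_avg_const [simp]: "finite A \<Longrightarrow> rad_avg A (\<lambda>_. c) = c"
  by (simp add: rad_avg_def card_Pow)

lemma rad_avg_add: "rad_avg A (\<lambda>S. \<phi> S + \<psi> S) = rad_avg A \<phi> + rad_avg A \<psi>"
  by (simp add: rad_avg_def sum.distrib add_divide_distrib)

lemma rad_avg_cmult: "rad_avg A (\<lambda>S. c * \<phi> S) = c * rad_avg A \<phi>"
  by (simp add: rad_avg_def sum_distrib_left)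

lemma rad_avg_sum: "rad_avg A (\<lambda>S. \<Sum>l\<in>I. \<phi> l S) = (\<Sum>l\<in>I. rad_avg A (\<phi> l))"
  unfolding rad_avg_def by (subst sum.swap) (simp add: sum_divide_distrib)

text \<open>The two-point inequality behind Khintchine's: with \<open>a = \<bar>X\<bar>\<^sup>2\<close>, \<open>w = \<bar>v\<bar>\<^sup>2\<close> and \<open>t = 2 \<langle>X, v\<rangle>\<close>, the left side
  is the mean of \<open>\<bar>X + v\<bar>\<^sup>2\<^sup>l\<close> and \<open>\<bar>X - v\<bar>\<^sup>2\<^sup>l\<close>. With \<open>s = a + w\<close>, the even part \<open>P l\<close> of \<open>(s + t)\<^sup>l\<close> satisfies
  \<open>P (k + 2) = s P (k + 1) + t O (k + 1)\<close>, where the odd part \<open>O (k + 1)\<close> is of order \<open>t P k\<close>.\<close>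
lemma even_part_le_power:
  fixes a w t K :: real
  assumes aw: "0 \<le> a" "0 \<le> w" and t: "t\<^sup>2 \<le> 4 * a * w" and K: "8 * real m + 1 \<le> K"
  shows "l \<le> m \<Longrightarrow> ((a + w + t) ^ l + (a + w - t) ^ l) / 2 \<le> (a + K * w) ^ l"
proof (induction l rule: less_induct)
  case (less l)
  define s where "s = a + w"
  have K1: "1 \<le> K" using K by linarith
  have ts: "\<bar>t\<bar> \<le> s"
  proof -
    have "t\<^sup>2 \<le> s\<^sup>2"
      using t zero_le_power2[of "a - w"] by (simp add: s_def power2_eq_square algebra_simps)
    then show ?thesis using abs_le_square_iff[of t s] aw by (simp add: s_def)
  qed
  define P where "P l = ((s + t) ^ l + (s - t) ^ l) / 2" for l
  have P0: "0 \<le> P l" for l using ts by (auto simp: P_def)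
  consider "l = 0" | "l = 1" | k where "l = Suc (Suc k)"
    by (metis One_nat_def not0_implies_Suc)
  then show ?case
  proof cases
    case 1
    then show ?thesis by simp
  next
    case 2
    have "w \<le> K * w" using aw K1 by (simp add: mult_le_cancel_right1)
    then show ?thesis using 2 by (simp add: field_simps)
  next
    case 3
    have kl: "real k + 1 \<le> real m" using less.prems 3 by simp
    \<comment> \<open>The odd part is controlled by the even part of lower degree.\<close>
    have odd: "t * ((s + t) ^ Suc k - (s - t) ^ Suc k) / 2 \<le> (real k + 1) * t\<^sup>2 * (2 * P k)"
    proof -
      have "(s + t) ^ Suc k - (s - t) ^ Suc k
          = 2 * t * (\<Sum>i<Suc k. (s + t) ^ i * (s - t) ^ (k - i))"
        using power_diff_sumr2[of "s + t" "Suc k" "s - t"] by (simp add: mult.commute)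
      moreover have "(\<Sum>i<Suc k. (s + t) ^ i * (s - t) ^ (k - i)) \<le> (\<Sum>i<Suc k. 2 * P k)"
      proof (intro sum_mono)
        fix i assume i: "i \<in> {..<Suc k}"
        define M where "M = max (s + t) (s - t)"
        have "(s + t) ^ i * (s - t) ^ (k - i) \<le> M ^ i * M ^ (k - i)"
          using ts by (intro mult_mono power_mono) (auto simp: M_def)
        also have "\<dots> = M ^ k" using i by (simp flip: power_add)
        also have "\<dots> \<le> 2 * P k" using ts by (auto simp: M_def P_def max_def)
        finally show "(s + t) ^ i * (s - t) ^ (k - i) \<le> 2 * P k" .
      qed
      ultimately have "t * ((s + t) ^ Suc k - (s - t) ^ Suc k) / 2
          = t\<^sup>2 * (\<Sum>i<Suc k. (s + t) ^ i * (s - t) ^ (k - i))"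
        and S: "(\<Sum>i<Suc k. (s + t) ^ i * (s - t) ^ (k - i)) \<le> (real k + 1) * (2 * P k)"
        by (simp_all only: power2_eq_square sum_constant card_lessThan of_nat_Suc) (simp_all add: algebra_simps)
      then show ?thesis
        using mult_left_mono[OF S, of "t\<^sup>2"] by (simp del: sum.lessThan_Suc add: algebra_simps)
    qed
    define Q where "Q = a + K * w"
    have Q0: "0 \<le> Q" using aw K1 by (simp add: Q_def)
    have IH: "P k \<le> Q ^ k" "P (Suc k) \<le> Q ^ Suc k"
      using less.IH[of k] less.IH[of "Suc k"] less.prems 3 by (simp_all add: P_def Q_def s_def)
    have "P l = s * P (Suc k) + t * ((s + t) ^ Suc k - (s - t) ^ Suc k) / 2"
      by (simp add: P_def 3 algebra_simps add_divide_distrib diff_divide_distrib)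
    also have "\<dots> \<le> s * P (Suc k) + (real k + 1) * t\<^sup>2 * (2 * P k)"
      using odd by simp
    also have "\<dots> \<le> s * Q ^ Suc k + (real k + 1) * (4 * a * w) * (2 * Q ^ k)"
      using aw t P0 Q0 by (intro add_mono mult_mono IH mult_nonneg_nonneg) (auto simp: s_def)
    also have "\<dots> = Q ^ k * ((a + w) * Q + 8 * (real k + 1) * (a * w))"
      by (simp add: s_def algebra_simps)
    also have "\<dots> \<le> Q ^ k * Q\<^sup>2"
    proof (intro mult_left_mono)
      \<comment> \<open>The coefficient of \<open>a w\<close> needs \<open>1 + K + 8 (k + 1) \<le> 2 K\<close>, and \<open>k + 2 \<le> m\<close>.\<close>
      have "(8 * (real k + 1) + 1) * (a * w) \<le> K * (a * w)"
        using K kl aw by (intro mult_right_mono) auto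
      moreover have "K * 1 * w\<^sup>2 \<le> K * K * w\<^sup>2"
        using K1 by (intro mult_right_mono mult_left_mono) auto
      ultimately show "(a + w) * Q + 8 * (real k + 1) * (a * w) \<le> Q\<^sup>2"
        by (simp add: Q_def power2_eq_square algebra_simps)
    qed (use Q0 in simp)
    also have "\<dots> = Q ^ l" by (simp add: 3 power2_eq_square)
    finally show ?thesis by (simp add: P_def Q_def s_def)
  qed
qed

lemma sgn_of_insert [simp]: "b \<noteq> a \<Longrightarrow> sgn_of (insert a S) b = sgn_of S b"
  by (simp add: sgn_of_def)

lemma rad_sum_insert:
  assumes "finite B" "b \<notin> B" "S \<subseteq> B"
  shows "(\<Sum>c\<in>insert b B. sgn_of S c * y c) = (\<Sum>c\<in>B. sgn_of S c * y c) + y b"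
    "(\<Sum>c\<in>insert b B. sgn_of (insert b S) c * y c) = (\<Sum>c\<in>B. sgn_of S c * y c) - y b"
proof -
  have "(\<Sum>c\<in>B. sgn_of (insert b S) c * y c) = (\<Sum>c\<in>B. sgn_of S c * y c)"
    using assms by (intro sum.cong refl arg_cong2[where f="(*)"] sgn_of_insert) auto
  moreover have "sgn_of S b = 1" "sgn_of (insert b S) b = -1"
    using assms by (auto simp: sgn_of_def)
  ultimately show "(\<Sum>c\<in>insert b B. sgn_of S c * y c) = (\<Sum>c\<in>B. sgn_of S c * y c) + y b"
    "(\<Sum>c\<in>insert b B. sgn_of (insert b S) c * y c) = (\<Sum>c\<in>B. sgn_of S c * y c) - y b"
    using assms by simp_all
qed

text \<open>Orthogonality of the signs, for vectors with components indexed by \<open>I\<close>.\<close>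
lemma rad_avg_second_moment:
  fixes y :: "'i \<Rightarrow> 'b \<Rightarrow> real"
  assumes "finite B"
  shows "rad_avg B (\<lambda>S. \<Sum>i\<in>I. (\<Sum>b\<in>B. sgn_of S b * y i b)\<^sup>2) = (\<Sum>i\<in>I. \<Sum>b\<in>B. (y i b)\<^sup>2)"
  using assms
proof (induction B)
  case (insert b B)
  have "rad_avg (insert b B) (\<lambda>S. \<Sum>i\<in>I. (\<Sum>c\<in>insert b B. sgn_of S c * y i c)\<^sup>2)
      = rad_avg B (\<lambda>S. (\<Sum>i\<in>I. (\<Sum>c\<in>B. sgn_of S c * y i c)\<^sup>2) + (\<Sum>i\<in>I. (y i b)\<^sup>2))"
    unfolding rad_avg_insert[OF insert.hyps]
  proof (intro rad_avg_cong)
    fix S assume S: "S \<subseteq> B"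
    show "((\<Sum>i\<in>I. (\<Sum>c\<in>insert b B. sgn_of S c * y i c)\<^sup>2)
        + (\<Sum>i\<in>I. (\<Sum>c\<in>insert b B. sgn_of (insert b S) c * y i c)\<^sup>2)) / 2
      = (\<Sum>i\<in>I. (\<Sum>c\<in>B. sgn_of S c * y i c)\<^sup>2) + (\<Sum>i\<in>I. (y i b)\<^sup>2)"
      unfolding rad_sum_insert[OF insert.hyps S] sum.distrib[symmetric] sum_divide_distrib
      by (intro sum.cong) (auto simp: power2_eq_square algebra_simps)
  qed
  also have "\<dots> = (\<Sum>i\<in>I. \<Sum>c\<in>B. (y i c)\<^sup>2) + (\<Sum>i\<in>I. (y i b)\<^sup>2)"
    using insert by (simp add: rad_avg_add)
  finally show ?case using insert.hyps by (simp add: sum.distrib add.commute)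
qed (simp add: rad_avg_empty)

text \<open>By the two-point inequality, the mean over one more sign replaces \<open>\<bar>X\<bar>\<^sup>2\<close> by \<open>\<bar>X\<bar>\<^sup>2 + K \<bar>y\<^sub>b\<bar>\<^sup>2\<close> inside the power.
  After binomial expansion the lower moments are covered by the induction hypothesis; this is why
  one \<open>K\<close> has to serve all exponents up to \<open>m\<close>. The vector components \<open>i\<close> make the inequality
  iterable: in a chaos, the sums over the other indices become components.\<close>
lemma rad_avg_even_moment:
  fixes y :: "'i \<Rightarrow> 'b \<Rightarrow> real"
  assumes "finite B" and K: "8 * real m + 1 \<le> K"
  shows "l \<le> m \<Longrightarrow> rad_avg B (\<lambda>S. (\<Sum>i\<in>I. (\<Sum>b\<in>B. sgn_of S b * y i b)\<^sup>2) ^ l)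
      \<le> (K * (\<Sum>i\<in>I. \<Sum>b\<in>B. (y i b)\<^sup>2)) ^ l"
  using assms(1)
proof (induction B arbitrary: l)
  case (insert b B)
  define w where "w = (\<Sum>i\<in>I. (y i b)\<^sup>2)"
  define X where "X S = (\<Sum>i\<in>I. (\<Sum>c\<in>B. sgn_of S c * y i c)\<^sup>2)" for S
  define \<sigma> where "\<sigma> = (\<Sum>i\<in>I. \<Sum>c\<in>B. (y i c)\<^sup>2)"
  have w0: "0 \<le> w" "0 \<le> K" using K by (auto simp: w_def intro!: sum_nonneg)
  have "rad_avg (insert b B) (\<lambda>S. (\<Sum>i\<in>I. (\<Sum>c\<in>insert b B. sgn_of S c * y i c)\<^sup>2) ^ l)
      \<le> rad_avg B (\<lambda>S. (X S + K * w) ^ l)"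
    unfolding rad_avg_insert[OF insert.hyps]
  proof (intro rad_avg_mono)
    fix S assume S: "S \<subseteq> B"
    define t where "t = (\<Sum>i\<in>I. 2 * ((\<Sum>c\<in>B. sgn_of S c * y i c) * y i b))"
    have "t\<^sup>2 = 4 * (\<Sum>i\<in>I. (\<Sum>c\<in>B. sgn_of S c * y i c) * y i b)\<^sup>2"
      by (simp add: t_def sum_distrib_left[symmetric] power_mult_distrib)
    also have "\<dots> \<le> 4 * (X S * w)"
      unfolding X_def w_def by (intro mult_left_mono Cauchy_Schwarz_ineq_sum) auto
    finally have t: "t\<^sup>2 \<le> 4 * X S * w" by simp
    have X0: "0 \<le> X S" by (auto simp: X_def intro!: sum_nonneg)
    have "(\<Sum>i\<in>I. (\<Sum>c\<in>insert b B. sgn_of S c * y i c)\<^sup>2) = X S + w + t"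
      "(\<Sum>i\<in>I. (\<Sum>c\<in>insert b B. sgn_of (insert b S) c * y i c)\<^sup>2) = X S + w - t"
      unfolding rad_sum_insert[OF insert.hyps S] X_def w_def t_def
        sum.distrib[symmetric] sum_subtractf[symmetric]
      by (intro sum.cong; simp add: power2_eq_square algebra_simps)+
    then show "((\<Sum>i\<in>I. (\<Sum>c\<in>insert b B. sgn_of S c * y i c)\<^sup>2) ^ l
        + (\<Sum>i\<in>I. (\<Sum>c\<in>insert b B. sgn_of (insert b S) c * y i c)\<^sup>2) ^ l) / 2 \<le> (X S + K * w) ^ l"
      using even_part_le_power[OF X0 w0(1) t K insert.prems] by simp
  qed
  also have "\<dots> = (\<Sum>k\<le>l. (real (l choose k) * (K * w) ^ (l - k)) * rad_avg B (\<lambda>S. X S ^ k))"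
    unfolding binomial_ring rad_avg_sum rad_avg_cmult[symmetric]
    by (intro sum.cong rad_avg_cong refl) (simp add: mult_ac)
  also have "\<dots> \<le> (\<Sum>k\<le>l. (real (l choose k) * (K * w) ^ (l - k)) * (K * \<sigma>) ^ k)"
    unfolding X_def \<sigma>_def using insert.prems w0
    by (intro sum_mono mult_left_mono insert.IH) auto
  also have "\<dots> = (K * \<sigma> + K * w) ^ l"
    unfolding binomial_ring by (intro sum.cong refl) (simp add: mult_ac)
  also have "K * \<sigma> + K * w = K * (\<Sum>i\<in>I. \<Sum>c\<in>insert b B. (y i c)\<^sup>2)"
    using insert.hyps by (simp add: \<sigma>_def w_def sum.distrib algebra_simps)
  finally show ?case .
qed (simp add: rad_avg_empty power_0_left)

text \<open>Let the second moment of \<open>X\<close> be \<open>\<sigma>\<^sup>2\<close>. Bounds for two higher even moments by multiples of powers of \<open>\<sigma>\<close>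
  make the \<open>p\<close>-th moment comparable to \<open>\<sigma>\<^sup>p\<close>. This follows from two pointwise inequalities, found by comparing
  \<open>\<bar>X\<bar>\<close> with \<open>\<sigma>\<close>: \<open>\<bar>X\<bar>\<^sup>p\<close> is at most \<open>\<sigma>\<^sup>p + \<sigma>\<^sup>p\<^sup>-\<^sup>2\<^sup>m X\<^sup>2\<^sup>m\<close>, and \<open>X\<^sup>2\<close> is at most
  \<open>\<sigma>\<^sup>2 / 4 + E \<sigma>\<^sup>2\<^sup>-\<^sup>p \<bar>X\<bar>\<^sup>p + X\<^sup>4 / (4 C4 \<sigma>\<^sup>2)\<close>. A normalized positive linear functional \<open>L\<close> stands for the
  expectation, so that iterated means over several families of signs are covered.\<close>
lemma moment_comparison:
  fixes p C4 C :: real and m :: nat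
  assumes p: "0 < p" "p \<le> 2 * real m" and C: "1 \<le> C4" "0 \<le> C"
  shows "\<exists>c D. 0 < c \<and> 0 < D \<and> (\<forall>(L :: ('w \<Rightarrow> real) \<Rightarrow> real) X \<sigma>.
     (\<forall>\<phi> \<psi>. (\<forall>w. \<phi> w \<le> \<psi> w) \<longrightarrow> L \<phi> \<le> L \<psi>) \<longrightarrow> (\<forall>\<phi> \<psi>. L (\<lambda>w. \<phi> w + \<psi> w) = L \<phi> + L \<psi>) \<longrightarrow>
     (\<forall>c \<phi>. L (\<lambda>w. c * \<phi> w) = c * L \<phi>) \<longrightarrow> L (\<lambda>_. 1) = 1 \<longrightarrow> 0 < \<sigma> \<longrightarrow>
     L (\<lambda>w. (X w)\<^sup>2) = \<sigma>\<^sup>2 \<longrightarrow> L (\<lambda>w. ((X w)\<^sup>2) ^ 2) \<le> C4 * (\<sigma>\<^sup>2) ^ 2 \<longrightarrow>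
     L (\<lambda>w. ((X w)\<^sup>2) ^ m) \<le> C * (\<sigma>\<^sup>2) ^ m \<longrightarrow>
     c * \<sigma> powr p \<le> L (\<lambda>w. \<bar>X w\<bar> powr p) \<and> L (\<lambda>w. \<bar>X w\<bar> powr p) \<le> D * \<sigma> powr p)"
proof -
  \<comment> \<open>\<open>E\<close> bounds \<open>r powr (2 - p)\<close> on the range \<open>1/2 \<le> r \<le> 2 sqrt C4\<close>, for either sign of \<open>2 - p\<close>.\<close>
  define E where "E = max ((1/2) powr (2 - p)) ((2 * sqrt C4) powr (2 - p))"
  have E0: "0 < E" by (auto simp: E_def less_max_iff_disj)
  show ?thesis
  proof (rule exI[of _ "1 / (2 * E)"], rule exI[of _ "1 + C"], intro conjI allI impI)
    fix L :: "('w \<Rightarrow> real) \<Rightarrow> real" and X \<sigma>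
    assume mono: "\<forall>\<phi> \<psi>. (\<forall>w. \<phi> w \<le> \<psi> w) \<longrightarrow> L \<phi> \<le> L \<psi>"
      and add: "\<forall>\<phi> \<psi>. L (\<lambda>w. \<phi> w + \<psi> w) = L \<phi> + L \<psi>"
      and cm: "\<forall>c \<phi>. L (\<lambda>w. c * \<phi> w) = c * L \<phi>" and one: "L (\<lambda>_. 1) = 1"
      and s: "0 < \<sigma>" and m2: "L (\<lambda>w. (X w)\<^sup>2) = \<sigma>\<^sup>2"
      and m4: "L (\<lambda>w. ((X w)\<^sup>2) ^ 2) \<le> C4 * (\<sigma>\<^sup>2) ^ 2"
      and mm: "L (\<lambda>w. ((X w)\<^sup>2) ^ m) \<le> C * (\<sigma>\<^sup>2) ^ m"
    have const: "L (\<lambda>_. c) = c" for c using cm[rule_format, of c "\<lambda>_. 1"] one by simp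
    have sm: "(\<sigma>\<^sup>2) ^ m = \<sigma> powr (2 * real m)" "\<bar>x\<bar> powr (2 * real m) = (x\<^sup>2) ^ m" if "x \<noteq> 0" for x
      using s that by (simp_all add: powr_powr[symmetric] powr_realpow)
    have up: "\<bar>x\<bar> powr p \<le> \<sigma> powr p + \<sigma> powr (p - 2 * real m) * (x\<^sup>2) ^ m" for x
    proof (cases "\<bar>x\<bar> \<le> \<sigma>")
      case True
      have "\<bar>x\<bar> powr p \<le> \<sigma> powr p" using True p by (intro powr_mono2) auto
      then show ?thesis by (simp add: add_increasing2)
    next
      case False
      then have x0: "x \<noteq> 0" using s by auto
      have "\<bar>x\<bar> powr p = \<bar>x\<bar> powr (p - 2 * real m) * \<bar>x\<bar> powr (2 * real m)"
        using x0 by (simp flip: powr_add)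
      also have "\<dots> \<le> \<sigma> powr (p - 2 * real m) * \<bar>x\<bar> powr (2 * real m)"
        using False s p by (intro mult_right_mono powr_mono2') auto
      finally show ?thesis using sm(2)[OF x0] by (simp add: add_increasing)
    qed
    have "L (\<lambda>w. \<bar>X w\<bar> powr p) \<le> \<sigma> powr p + \<sigma> powr (p - 2 * real m) * L (\<lambda>w. ((X w)\<^sup>2) ^ m)"
      using mono[rule_format, of "\<lambda>w. \<bar>X w\<bar> powr p", OF up[of "X w" for w]] by (simp add: add cm const)
    also have "\<dots> \<le> \<sigma> powr p + \<sigma> powr (p - 2 * real m) * (C * (\<sigma>\<^sup>2) ^ m)"
      using mm by (intro add_left_mono mult_left_mono) auto
    also have "\<dots> = (1 + C) * \<sigma> powr p"
      using sm(1)[of 1] s by (simp add: powr_add[symmetric] mult.left_commute algebra_simps)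
    finally show "L (\<lambda>w. \<bar>X w\<bar> powr p) \<le> (1 + C) * \<sigma> powr p" .
    have lo: "x\<^sup>2 \<le> \<sigma>\<^sup>2 / 4 + (E * \<sigma> powr (2 - p) * \<bar>x\<bar> powr p + 1 / (4 * C4 * \<sigma>\<^sup>2) * (x\<^sup>2) ^ 2)" for x
    proof -
      consider "\<bar>x\<bar> \<le> \<sigma> / 2" | "4 * C4 * \<sigma>\<^sup>2 \<le> x\<^sup>2" | "\<sigma> / 2 < \<bar>x\<bar>" "x\<^sup>2 < 4 * C4 * \<sigma>\<^sup>2" by linarith
      then show ?thesis
      proof cases
        case 1
        then have "\<bar>x\<bar>\<^sup>2 \<le> (\<sigma> / 2)\<^sup>2" by (intro power_mono) auto
        then have "x\<^sup>2 \<le> \<sigma>\<^sup>2 / 4" by (simp add: power_divide)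
        then show ?thesis using E0 C by (simp add: add_increasing2)
      next
        case 2
        have "x\<^sup>2 * (4 * C4 * \<sigma>\<^sup>2) \<le> x\<^sup>2 * x\<^sup>2" using 2 by (intro mult_left_mono) auto
        then have "x\<^sup>2 \<le> 1 / (4 * C4 * \<sigma>\<^sup>2) * (x\<^sup>2) ^ 2"
          using C s by (simp add: field_simps power2_eq_square)
        moreover have "0 \<le> E * \<sigma> powr (2 - p) * \<bar>x\<bar> powr p" using E0 by simp
        moreover have "0 \<le> \<sigma>\<^sup>2 / 4" by simp
        ultimately show ?thesis by linarith
      next
        case 3
        define r where "r = \<bar>x\<bar> / \<sigma>"
        have "\<bar>x\<bar>\<^sup>2 < (2 * sqrt C4 * \<sigma>)\<^sup>2" using 3 C by (simp add: power_mult_distrib)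
        then have "\<bar>x\<bar> < 2 * sqrt C4 * \<sigma>" by (rule power_less_imp_less_base) (use C s in simp)
        then have r: "1/2 \<le> r" "r \<le> 2 * sqrt C4" using 3 s by (auto simp: r_def field_simps)
        have "r powr (2 - p) \<le> E"
        proof (cases "p \<le> 2")
          case True
          then have "r powr (2 - p) \<le> (2 * sqrt C4) powr (2 - p)" using r by (intro powr_mono2) auto
          then show ?thesis by (simp add: E_def)
        next
          case False
          then have "r powr (2 - p) \<le> (1/2) powr (2 - p)" using r by (intro powr_mono2') auto
          then show ?thesis by (simp add: E_def)
        qed
        moreover have x: "\<bar>x\<bar> = r * \<sigma>" "0 < r" using s r by (auto simp: r_def)
        then have "x\<^sup>2 = r powr (2 - p) * \<sigma> powr (2 - p) * \<bar>x\<bar> powr p"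
        proof -
          have "x\<^sup>2 = (r * \<sigma>) powr 2" using x s by (simp add: powr_numeral flip: power2_abs[of x])
          also have "\<dots> = (r * \<sigma>) powr (2 - p) * (r * \<sigma>) powr p" using x s by (simp flip: powr_add)
          finally show ?thesis by (simp add: x powr_mult)
        qed
        ultimately have "x\<^sup>2 \<le> E * \<sigma> powr (2 - p) * \<bar>x\<bar> powr p"
          by (simp add: mult_right_mono)
        moreover have "0 \<le> 1 / (4 * C4 * \<sigma>\<^sup>2) * (x\<^sup>2) ^ 2" using C by auto
        moreover have "0 \<le> \<sigma>\<^sup>2 / 4" by simp
        ultimately show ?thesis by linarith
      qed
    qed
    have "\<sigma>\<^sup>2 \<le> \<sigma>\<^sup>2 / 4 + (E * \<sigma> powr (2 - p) * L (\<lambda>w. \<bar>X w\<bar> powr p) + 1 / (4 * C4 * \<sigma>\<^sup>2) * L (\<lambda>w. ((X w)\<^sup>2) ^ 2))"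
    proof -
      have "L (\<lambda>w. (X w)\<^sup>2) \<le> L (\<lambda>w. \<sigma>\<^sup>2 / 4 + (E * \<sigma> powr (2 - p) * \<bar>X w\<bar> powr p
          + 1 / (4 * C4 * \<sigma>\<^sup>2) * ((X w)\<^sup>2) ^ 2))"
        by (rule mono[rule_format]) (rule lo)
      then show ?thesis
        using add[rule_format, of "\<lambda>_. \<sigma>\<^sup>2 / 4" "\<lambda>w. E * \<sigma> powr (2 - p) * \<bar>X w\<bar> powr p
            + 1 / (4 * C4 * \<sigma>\<^sup>2) * ((X w)\<^sup>2) ^ 2"]
          add[rule_format, of "\<lambda>w. E * \<sigma> powr (2 - p) * \<bar>X w\<bar> powr p"
            "\<lambda>w. 1 / (4 * C4 * \<sigma>\<^sup>2) * ((X w)\<^sup>2) ^ 2"]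
          cm[rule_format, of "E * \<sigma> powr (2 - p)" "\<lambda>w. \<bar>X w\<bar> powr p"]
          cm[rule_format, of "1 / (4 * C4 * \<sigma>\<^sup>2)" "\<lambda>w. ((X w)\<^sup>2) ^ 2"]
          const[of "\<sigma>\<^sup>2 / 4"] m2 by linarith
    qed
    also have "\<dots> \<le> \<sigma>\<^sup>2 / 4 + (E * \<sigma> powr (2 - p) * L (\<lambda>w. \<bar>X w\<bar> powr p) + 1 / (4 * C4 * \<sigma>\<^sup>2) * (C4 * (\<sigma>\<^sup>2) ^ 2))"
      using m4 C by (intro add_left_mono mult_left_mono) auto
    also have "1 / (4 * C4 * \<sigma>\<^sup>2) * (C4 * (\<sigma>\<^sup>2) ^ 2) = \<sigma>\<^sup>2 / 4"
      using C s by (simp add: power2_eq_square)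
    finally have "\<sigma>\<^sup>2 / 2 \<le> E * \<sigma> powr (2 - p) * L (\<lambda>w. \<bar>X w\<bar> powr p)" by simp
    then have "\<sigma> powr (p - 2) * (\<sigma>\<^sup>2 / 2) \<le> \<sigma> powr (p - 2) * (E * \<sigma> powr (2 - p) * L (\<lambda>w. \<bar>X w\<bar> powr p))"
      by (intro mult_left_mono) auto
    moreover have "\<sigma> powr (p - 2) * (\<sigma>\<^sup>2 / 2) = \<sigma> powr p / 2"
      using s by (simp add: powr_diff)
    moreover have "\<sigma> powr (p - 2) * (E * \<sigma> powr (2 - p) * L (\<lambda>w. \<bar>X w\<bar> powr p)) = E * L (\<lambda>w. \<bar>X w\<bar> powr p)"
    proof -
      have "\<sigma> powr (p - 2) * \<sigma> powr (2 - p) = 1" using s by (simp flip: powr_add)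
      moreover have "\<sigma> powr (p - 2) * (E * \<sigma> powr (2 - p) * z) = (\<sigma> powr (p - 2) * \<sigma> powr (2 - p)) * (E * z)" for z
        by (simp only: mult_ac)
      ultimately show ?thesis by simp
    qed
    ultimately have "\<sigma> powr p / 2 \<le> E * L (\<lambda>w. \<bar>X w\<bar> powr p)" by (simp only:)
    then show "1 / (2 * E) * \<sigma> powr p \<le> L (\<lambda>w. \<bar>X w\<bar> powr p)"
      using E0 by (simp add: field_simps)
  qed (use E0 C in auto)
qed

lemma rad_avg_second_moment1:
  "finite B \<Longrightarrow> rad_avg B (\<lambda>S. (\<Sum>b\<in>B. sgn_of S b * y b)\<^sup>2) = (\<Sum>b\<in>B. (y b)\<^sup>2)"
  using rad_avg_second_moment[where I="{()}" and y="\<lambda>_. y"] by simp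

lemma rad_avg_even_moment1:
  "finite B \<Longrightarrow> 8 * real m + 1 \<le> K \<Longrightarrow> l \<le> m \<Longrightarrow>
    rad_avg B (\<lambda>S. ((\<Sum>b\<in>B. sgn_of S b * y b)\<^sup>2) ^ l) \<le> (K * (\<Sum>b\<in>B. (y b)\<^sup>2)) ^ l"
  using rad_avg_even_moment[where I="{()}" and y="\<lambda>_. y"] by simp

abbreviation sum_squares :: "'a set \<Rightarrow> 'b set \<Rightarrow> 'c set \<Rightarrow> ('a \<Rightarrow> 'b \<Rightarrow> 'c \<Rightarrow> real) \<Rightarrow> real" where
  "sum_squares A B C x \<equiv> (\<Sum>a\<in>A. \<Sum>b\<in>B. \<Sum>c\<in>C. (x a b c)\<^sup>2)"

definition rad_avg3 :: "'a set \<Rightarrow> 'b set \<Rightarrow> 'c set \<Rightarrow> ('a set \<times> 'b set \<times> 'c set \<Rightarrow> real) \<Rightarrow> real" where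
  "rad_avg3 A B C \<phi> = rad_avg A (\<lambda>S. rad_avg B (\<lambda>T. rad_avg C (\<lambda>U. \<phi> (S, T, U))))"

definition rad_chaos :: "'a set \<Rightarrow> 'b set \<Rightarrow> 'c set \<Rightarrow> ('a \<Rightarrow> 'b \<Rightarrow> 'c \<Rightarrow> real) \<Rightarrow> 'a set \<times> 'b set \<times> 'c set \<Rightarrow> real" where
  "rad_chaos A B C x = (\<lambda>(S, T, U). \<Sum>a\<in>A. \<Sum>b\<in>B. \<Sum>c\<in>C. sgn_of S a * sgn_of T b * sgn_of U c * x a b c)"

lemma sum_swap3:
  "(\<Sum>c\<in>C. \<Sum>b\<in>B. \<Sum>a\<in>A. f a b c) = (\<Sum>a\<in>A. \<Sum>b\<in>B. \<Sum>c\<in>C. f a b c)"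
proof -
  have "(\<Sum>c\<in>C. \<Sum>b\<in>B. \<Sum>a\<in>A. f a b c) = (\<Sum>c\<in>C. \<Sum>a\<in>A. \<Sum>b\<in>B. f a b c)"
    by (intro sum.cong refl sum.swap)
  also have "\<dots> = (\<Sum>a\<in>A. \<Sum>c\<in>C. \<Sum>b\<in>B. f a b c)" by (rule sum.swap)
  also have "\<dots> = (\<Sum>a\<in>A. \<Sum>b\<in>B. \<Sum>c\<in>C. f a b c)" by (intro sum.cong refl sum.swap)
  finally show ?thesis .
qed

lemma rad_chaos_alt:
  "rad_chaos A B C x (S, T, U) = (\<Sum>c\<in>C. sgn_of U c * (\<Sum>b\<in>B. sgn_of T b * (\<Sum>a\<in>A. sgn_of S a * x a b c)))"
proof -
  show ?thesis
    unfolding rad_chaos_def prod.case sum_swap3[symmetric, where A=A]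
    by (simp add: sum_distrib_left mult_ac)
qed

text \<open>The one-parameter inequality is applied first to the signs in \<open>C\<close>, then to those in \<open>B\<close> with components
  \<open>C\<close>, and finally to those in \<open>A\<close> with components \<open>C \<times> B\<close>.\<close>
lemma rad_chaos_even_moment:
  assumes fin: "finite A" "finite B" "finite C" and K: "8 * real m + 1 \<le> K" and l: "l \<le> m"
  shows "rad_avg3 A B C (\<lambda>w. ((rad_chaos A B C x w)\<^sup>2) ^ l)
    \<le> (K * (K * K)) ^ l * (sum_squares A B C x) ^ l"
proof -
  have K0: "0 \<le> K" using K by linarith
  have "rad_avg3 A B C (\<lambda>w. ((rad_chaos A B C x w)\<^sup>2) ^ l)
    \<le> rad_avg A (\<lambda>S. rad_avg B (\<lambda>T. K ^ l * (\<Sum>c\<in>C. (\<Sum>b\<in>B. sgn_of T b * (\<Sum>a\<in>A. sgn_of S a * x a b c))\<^sup>2) ^ l))"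
    unfolding rad_avg3_def rad_chaos_alt
    by (intro rad_avg_mono rad_avg_even_moment1[OF fin(3) K l, unfolded power_mult_distrib])
  also have "\<dots> \<le> rad_avg A (\<lambda>S. K ^ l * (K ^ l * (\<Sum>(c, b)\<in>C\<times>B. (\<Sum>a\<in>A. sgn_of S a * x a b c)\<^sup>2) ^ l))"
  proof (rule rad_avg_mono)
    fix S
    show "rad_avg B (\<lambda>T. K ^ l * (\<Sum>c\<in>C. (\<Sum>b\<in>B. sgn_of T b * (\<Sum>a\<in>A. sgn_of S a * x a b c))\<^sup>2) ^ l)
      \<le> K ^ l * (K ^ l * (\<Sum>(c, b)\<in>C\<times>B. (\<Sum>a\<in>A. sgn_of S a * x a b c)\<^sup>2) ^ l)"
      unfolding rad_avg_cmult sum.cartesian_product[symmetric] using K0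
      by (intro mult_left_mono rad_avg_even_moment[OF fin(2) K l, unfolded power_mult_distrib]) auto
  qed
  also have "\<dots> = K ^ l * K ^ l * rad_avg A (\<lambda>S. (\<Sum>i\<in>C\<times>B. (\<Sum>a\<in>A. sgn_of S a * x a (snd i) (fst i))\<^sup>2) ^ l)"
    by (simp add: rad_avg_cmult case_prod_beta mult.assoc)
  also have "\<dots> \<le> K ^ l * K ^ l * (K * (\<Sum>i\<in>C\<times>B. \<Sum>a\<in>A. (x a (snd i) (fst i))\<^sup>2)) ^ l"
    using K0 by (intro mult_left_mono rad_avg_even_moment[OF fin(1) K l]) auto
  also have "(\<Sum>i\<in>C\<times>B. \<Sum>a\<in>A. (x a (snd i) (fst i))\<^sup>2) = (\<Sum>c\<in>C. \<Sum>b\<in>B. \<Sum>a\<in>A. (x a b c)\<^sup>2)"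
    using sum.cartesian_product[of "\<lambda>c b. \<Sum>a\<in>A. (x a b c)\<^sup>2" B C] by (simp add: case_prod_beta)
  also have "\<dots> = (sum_squares A B C x)"
    by (rule sum_swap3)
  finally show ?thesis by (simp add: power_mult_distrib mult.assoc)
qed

lemma rad_chaos_second_moment:
  assumes fin: "finite A" "finite B" "finite C"
  shows "rad_avg3 A B C (\<lambda>w. (rad_chaos A B C x w)\<^sup>2) = (sum_squares A B C x)"
proof -
  have "rad_avg3 A B C (\<lambda>w. (rad_chaos A B C x w)\<^sup>2)
    = rad_avg A (\<lambda>S. rad_avg B (\<lambda>T. (\<Sum>c\<in>C. (\<Sum>b\<in>B. sgn_of T b * (\<Sum>a\<in>A. sgn_of S a * x a b c))\<^sup>2)))"
    unfolding rad_avg3_def rad_chaos_alt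
    by (simp add: rad_avg_second_moment1[OF fin(3)])
  also have "\<dots> = rad_avg A (\<lambda>S. (\<Sum>(c, b)\<in>C\<times>B. (\<Sum>a\<in>A. sgn_of S a * x a b c)\<^sup>2))"
    unfolding rad_avg_second_moment[OF fin(2)] by (simp add: sum.cartesian_product)
  also have "\<dots> = (\<Sum>i\<in>C\<times>B. \<Sum>a\<in>A. (x a (snd i) (fst i))\<^sup>2)"
    unfolding case_prod_beta by (rule rad_avg_second_moment[OF fin(1)])
  also have "\<dots> = (\<Sum>c\<in>C. \<Sum>b\<in>B. \<Sum>a\<in>A. (x a b c)\<^sup>2)"
    using sum.cartesian_product[of "\<lambda>c b. \<Sum>a\<in>A. (x a b c)\<^sup>2" B C] by (simp add: case_prod_beta)
  also have "\<dots> = (sum_squares A B C x)"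
    by (rule sum_swap3)
  finally show ?thesis .
qed

text \<open>The fourth moment and one even moment of order at least \<open>p\<close> suffice, by \<open>moment_comparison\<close>.\<close>
theorem khintchine3:
  fixes p :: real
  assumes p: "0 < p"
  shows "\<exists>c D. 0 < c \<and> 0 < D \<and> (\<forall>(A :: 'a set) (B :: 'b set) (C :: 'c set) (x :: 'a \<Rightarrow> 'b \<Rightarrow> 'c \<Rightarrow> real). finite A \<longrightarrow> finite B \<longrightarrow> finite C \<longrightarrow>
    c * (sum_squares A B C x) powr (p / 2) \<le> rad_avg3 A B C (\<lambda>w. \<bar>rad_chaos A B C x w\<bar> powr p) \<and>
    rad_avg3 A B C (\<lambda>w. \<bar>rad_chaos A B C x w\<bar> powr p) \<le> D * (sum_squares A B C x) powr (p / 2))"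
proof -
  obtain m0 :: nat where m0: "p \<le> real m0" using real_arch_simple by blast
  define m where "m = m0 + 2"
  define K where "K = 8 * real m + 1"
  define M where "M = K * (K * K)"
  have M1: "1 \<le> M ^ 2" "0 \<le> M ^ m"
  proof -
    have K1: "1 \<le> K" by (simp add: K_def)
    have "1 * (1 * 1) \<le> M" unfolding M_def by (intro mult_mono K1) (use K1 in auto)
    then show "1 \<le> M ^ 2" "0 \<le> M ^ m" by (auto intro: one_le_power)
  qed
  have pm: "p \<le> 2 * real m" using m0 p by (simp add: m_def)
  obtain c D where cD: "0 < c" "0 < D" and *: "\<And>(L :: ('a set \<times> 'b set \<times> 'c set \<Rightarrow> real) \<Rightarrow> real) X \<sigma>.
     (\<forall>\<phi> \<psi>. (\<forall>w. \<phi> w \<le> \<psi> w) \<longrightarrow> L \<phi> \<le> L \<psi>) \<Longrightarrow> (\<forall>\<phi> \<psi>. L (\<lambda>w. \<phi> w + \<psi> w) = L \<phi> + L \<psi>) \<Longrightarrow>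
     (\<forall>c \<phi>. L (\<lambda>w. c * \<phi> w) = c * L \<phi>) \<Longrightarrow> L (\<lambda>_. 1) = 1 \<Longrightarrow> 0 < \<sigma> \<Longrightarrow>
     L (\<lambda>w. (X w)\<^sup>2) = \<sigma>\<^sup>2 \<Longrightarrow> L (\<lambda>w. ((X w)\<^sup>2) ^ 2) \<le> M ^ 2 * (\<sigma>\<^sup>2) ^ 2 \<Longrightarrow>
     L (\<lambda>w. ((X w)\<^sup>2) ^ m) \<le> M ^ m * (\<sigma>\<^sup>2) ^ m \<Longrightarrow>
     c * \<sigma> powr p \<le> L (\<lambda>w. \<bar>X w\<bar> powr p) \<and> L (\<lambda>w. \<bar>X w\<bar> powr p) \<le> D * \<sigma> powr p"
    using moment_comparison[OF p pm M1] by blast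
  show ?thesis
  proof (rule exI[of _ c], rule exI[of _ D], intro conjI cD allI impI)
    fix A :: "'a set" and B :: "'b set" and C :: "'c set" and x :: "'a \<Rightarrow> 'b \<Rightarrow> 'c \<Rightarrow> real"
    assume fin: "finite A" "finite B" "finite C"
    define s where "s = (sum_squares A B C x)"
    have s0: "0 \<le> s" by (auto simp: s_def intro!: sum_nonneg)
    have "c * s powr (p/2) \<le> rad_avg3 A B C (\<lambda>w. \<bar>rad_chaos A B C x w\<bar> powr p) \<and>
      rad_avg3 A B C (\<lambda>w. \<bar>rad_chaos A B C x w\<bar> powr p) \<le> D * s powr (p/2)"
    proof (cases "s = 0")
      case True
      then have "x a b c = 0" if "a \<in> A" "b \<in> B" "c \<in> C" for a b c
        using that fin unfolding s_def by (auto simp: sum_nonneg_eq_0_iff sum_nonneg)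
      then have "rad_chaos A B C x w = 0" for w
        by (auto simp: rad_chaos_def split: prod.splits)
      then show ?thesis using True fin p by (simp add: rad_avg3_def)
    next
      case False
      then have s: "0 < sqrt s" "(sqrt s)\<^sup>2 = s" using s0 by auto
      have "c * sqrt s powr p \<le> rad_avg3 A B C (\<lambda>w. \<bar>rad_chaos A B C x w\<bar> powr p) \<and>
        rad_avg3 A B C (\<lambda>w. \<bar>rad_chaos A B C x w\<bar> powr p) \<le> D * sqrt s powr p"
      proof (rule *)
        show "rad_avg3 A B C (\<lambda>w. (rad_chaos A B C x w)\<^sup>2) = (sqrt s)\<^sup>2"
          unfolding s unfolding s_def by (rule rad_chaos_second_moment[OF fin])
        show "rad_avg3 A B C (\<lambda>w. ((rad_chaos A B C x w)\<^sup>2) ^ 2) \<le> M ^ 2 * ((sqrt s)\<^sup>2) ^ 2"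
          unfolding s M_def unfolding s_def
          by (rule rad_chaos_even_moment[OF fin, where m=m]) (auto simp: K_def m_def)
        show "rad_avg3 A B C (\<lambda>w. ((rad_chaos A B C x w)\<^sup>2) ^ m) \<le> M ^ m * ((sqrt s)\<^sup>2) ^ m"
          unfolding s M_def unfolding s_def
          by (rule rad_chaos_even_moment[OF fin, where m=m]) (auto simp: K_def)
      qed (use s fin in \<open>simp_all add: rad_avg3_def rad_avg_add rad_avg_cmult, intro allI impI rad_avg_mono, blast\<close>)
      moreover have "sqrt s powr p = s powr (p/2)"
        using s0 by (simp add: powr_half_sqrt[symmetric] powr_powr)
      ultimately show ?thesis by simp
    qed
    then show "c * (sum_squares A B C x) powr (p / 2) \<le> rad_avg3 A B C (\<lambda>w. \<bar>rad_chaos A B C x w\<bar> powr p)"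
      "rad_avg3 A B C (\<lambda>w. \<bar>rad_chaos A B C x w\<bar> powr p) \<le> D * (sum_squares A B C x) powr (p / 2)"
      unfolding s_def by blast+
  qed
qed

section \<open>Dyadic cells\<close>

text \<open>A shape \<open>s\<close> gives the binary logarithm of the side length in the direction of each basis vector.
  Indices in different directions are independent of each other, so a shape may be anisotropic.\<close>
definition cell_idx :: "('a::euclidean_space \<Rightarrow> int) \<Rightarrow> 'a \<Rightarrow> 'a \<Rightarrow> int" where
  "cell_idx s x b = \<lfloor>(x \<bullet> b) / 2 powi s b\<rfloor>"

definition cell :: "('a::euclidean_space \<Rightarrow> int) \<Rightarrow> 'a \<Rightarrow> 'a set" where
  "cell s x = {y. \<forall>b\<in>Basis. cell_idx s y b = cell_idx s x b}"

definition cell_vol :: "('a::euclidean_space \<Rightarrow> int) \<Rightarrow> real" where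
  "cell_vol s = (\<Prod>b\<in>Basis. 2 powi s b)"

definition avg :: "('a::euclidean_space \<Rightarrow> int) \<Rightarrow> ('a \<Rightarrow> real) \<Rightarrow> 'a \<Rightarrow> real" where
  "avg s f x = (LINT y:cell s x|lebesgue. f y) / cell_vol s"

lemma cell_self [simp]: "x \<in> cell s x"
  by (simp add: cell_def)

lemma mem_cell_iff: "y \<in> cell s x \<longleftrightarrow> cell s y = cell s x"
  by (auto simp: cell_def)

lemma cell_vol_pos: "0 < cell_vol s"
  by (auto simp: cell_vol_def intro!: prod_pos)

lemma cell_idx_eq_iff:
  "cell_idx s y b = m \<longleftrightarrow> of_int m * 2 powi s b \<le> y \<bullet> b \<and> y \<bullet> b < (of_int m + 1) * 2 powi s b"
proof -
  have "(0::real) < 2 powi s b" by simp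
  then show ?thesis by (simp add: cell_idx_def floor_eq_iff field_simps)
qed

lemma cell_borel [measurable]: "cell s x \<in> sets borel"
proof -
  have "cell s x = (\<Inter>b\<in>Basis. {y. of_int (cell_idx s x b) * 2 powi s b \<le> y \<bullet> b} \<inter>
      {y. y \<bullet> b < (of_int (cell_idx s x b) + 1) * 2 powi s b})"
    by (auto simp: cell_def cell_idx_eq_iff)
  also have "\<dots> \<in> sets borel"
    by (intro sets.finite_INT sets.Int) (auto simp: nonempty_Basis)
  finally show ?thesis .
qed

lemma cell_lebesgue [measurable, simp]: "cell s x \<in> sets lebesgue"
  using cell_borel by simp

lemma emeasure_cell: "emeasure lebesgue (cell s x) = ennreal (cell_vol s)"
proof -
  define l where "l = (\<Sum>b\<in>Basis. (of_int (cell_idx s x b) * 2 powi s b) *\<^sub>R b)"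
  define r where "r = (\<Sum>b\<in>Basis. ((of_int (cell_idx s x b) + 1) * 2 powi s b) *\<^sub>R b)"
  have l: "l \<bullet> b = of_int (cell_idx s x b) * 2 powi s b"
    and r: "r \<bullet> b = (of_int (cell_idx s x b) + 1) * 2 powi s b" if "b \<in> Basis" for b
    using that by (auto simp: l_def r_def inner_sum_left_Basis)
  have sub: "box l r \<subseteq> cell s x" "cell s x \<subseteq> cbox l r"
    by (auto simp: cell_def cell_idx_eq_iff mem_box l r less_imp_le)
  have lr: "l \<bullet> b \<le> r \<bullet> b" "(r - l) \<bullet> b = 2 powi s b" if "b \<in> Basis" for b
    using that by (auto simp: l r inner_diff_left algebra_simps)
  then have "emeasure lborel (box l r) = ennreal (cell_vol s)" "emeasure lborel (cbox l r) = ennreal (cell_vol s)"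
    by (simp_all add: cell_vol_def)
  then show ?thesis
    using emeasure_mono[OF sub(1), of lborel] emeasure_mono[OF sub(2), of lborel] by simp
qed

lemma measure_cell: "measure lebesgue (cell s x) = cell_vol s"
  using cell_vol_pos[of s] by (simp add: measure_def emeasure_cell less_imp_le)

text \<open>Dyadic intervals are nested since \<open>\<lfloor>t / n\<rfloor> = \<lfloor>t\<rfloor> div n\<close> for integers \<open>n > 0\<close>.\<close>
lemma cell_idx_coarser:
  assumes "s b \<le> s' b"
  shows "cell_idx s' x b = cell_idx s x b div 2 ^ nat (s' b - s b)"
proof -
  have "(2::real) powi s' b = 2 powi s b * of_int (2 ^ nat (s' b - s b))"
    using assms by (simp flip: power_int_of_nat power_int_add)
  then show ?thesis
    using floor_divide_real_eq_div[of "2 ^ nat (s' b - s b)" "x \<bullet> b / 2 powi s b"]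
    by (simp add: cell_idx_def)
qed

lemma cell_mono:
  assumes "\<And>b. b \<in> Basis \<Longrightarrow> s b \<le> s' b"
  shows "cell s x \<subseteq> cell s' x"
proof -
  have "cell_idx s' y b = cell_idx s y b div 2 ^ nat (s' b - s b)" if "b \<in> Basis" for y b
    by (rule cell_idx_coarser[of s b s', OF assms[OF that]])
  then show ?thesis by (auto simp: cell_def)
qed

lemma finite_cells: "finite (cell s ` cell s' x)"
proof -
  define I where "I = (\<lambda>b. (\<lambda>t::real. \<lfloor>t / 2 powi s b\<rfloor>) ` {of_int (cell_idx s' x b) * 2 powi s' b ..
     (of_int (cell_idx s' x b) + 1) * 2 powi s' b})"
  have fin: "finite (I b)" for b
  proof (rule finite_subset)
    show "I b \<subseteq> {\<lfloor>of_int (cell_idx s' x b) * 2 powi s' b / (2::real) powi s b\<rfloor> ..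
       \<lfloor>(of_int (cell_idx s' x b) + 1) * 2 powi s' b / (2::real) powi s b\<rfloor>}"
      by (auto simp: I_def intro!: floor_mono divide_right_mono)
  qed simp
  have "cell s ` cell s' x \<subseteq> (\<lambda>g. {y. \<forall>b\<in>Basis. cell_idx s y b = g b}) ` (Pi\<^sub>E Basis I)"
  proof
    fix Q assume "Q \<in> cell s ` cell s' x"
    then obtain y where y: "y \<in> cell s' x" "Q = cell s y" by auto
    then have "restrict (cell_idx s y) Basis \<in> Pi\<^sub>E Basis I"
      by (auto simp: cell_def I_def cell_idx_def[of s] cell_idx_eq_iff[of s'] less_imp_le)
    then show "Q \<in> (\<lambda>g. {y. \<forall>b\<in>Basis. cell_idx s y b = g b}) ` (Pi\<^sub>E Basis I)"
      by (rule rev_image_eqI) (auto simp: y cell_def)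
  qed
  moreover have "finite (Pi\<^sub>E Basis I)" by (intro finite_PiE fin) simp
  ultimately show ?thesis by (rule finite_surj[rotated])
qed

lemma countable_cells: "countable (range (cell s))"
proof -
  have "range (cell s) \<subseteq> (\<lambda>g. {y. \<forall>b\<in>Basis. cell_idx s y b = g b}) ` (Pi\<^sub>E Basis (\<lambda>_. UNIV))"
  proof
    fix Q assume "Q \<in> range (cell s)"
    then obtain y where y: "Q = cell s y" by auto
    have "restrict (cell_idx s y) Basis \<in> Pi\<^sub>E Basis (\<lambda>_. UNIV)" by auto
    then show "Q \<in> (\<lambda>g. {y. \<forall>b\<in>Basis. cell_idx s y b = g b}) ` (Pi\<^sub>E Basis (\<lambda>_. UNIV))"
      by (rule rev_image_eqI) (auto simp: y cell_def)
  qed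
  moreover have "countable (Pi\<^sub>E (Basis :: 'a set) (\<lambda>_. UNIV :: int set))" by (intro countable_PiE) auto
  ultimately show ?thesis by (meson countable_image countable_subset)
qed

definition cell_const :: "('a::euclidean_space \<Rightarrow> int) \<Rightarrow> ('a \<Rightarrow> 'b) \<Rightarrow> bool" where
  "cell_const s f \<longleftrightarrow> (\<forall>x y. cell s x = cell s y \<longrightarrow> f x = f y)"

lemma cell_constD: "cell_const s f \<Longrightarrow> y \<in> cell s x \<Longrightarrow> f y = f x"
  unfolding cell_const_def mem_cell_iff by blast

lemma cell_const_avg [simp]: "cell_const s (avg s f)"
  by (simp add: cell_const_def avg_def)

lemma cell_const_coarser:
  assumes "cell_const s' f" "\<And>b. b \<in> Basis \<Longrightarrow> s b \<le> s' b"
  shows "cell_const s f"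
  unfolding cell_const_def
proof (intro allI impI)
  fix x y assume "cell s x = cell s y"
  then have "x \<in> cell s' y" using cell_mono[of s s' y] cell_self[of x s] assms(2) by auto
  then show "f x = f y" by (rule cell_constD[OF assms(1)])
qed

lemma cell_const_comp: "cell_const s f \<Longrightarrow> cell_const s (\<lambda>x. h (f x))"
  unfolding cell_const_def by metis

lemma cell_const_comp2: "cell_const s f \<Longrightarrow> cell_const s g \<Longrightarrow> cell_const s (\<lambda>x. h (f x) (g x))"
  unfolding cell_const_def by metis

lemma cell_const_const: "cell_const s (\<lambda>_. c)"
  by (simp add: cell_const_def)

lemma cell_const_sum: "(\<And>i. i \<in> I \<Longrightarrow> cell_const s (f i)) \<Longrightarrow> cell_const s (\<lambda>x. \<Sum>i\<in>I. f i x)"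
  unfolding cell_const_def by (intro allI impI sum.cong refl) blast

lemma borel_measurable_cell_const:
  fixes f :: "'a::euclidean_space \<Rightarrow> real"
  assumes "cell_const s f"
  shows "f \<in> borel_measurable borel"
proof (rule measurable_piecewise_restrict[OF countable_cells[of s]])
  fix Q assume "Q \<in> range (cell s)"
  then obtain x where Q: "Q = cell s x" by auto
  show "f \<in> borel_measurable (restrict_space borel Q)"
    by (rule measurable_cong[THEN iffD1, of _ "\<lambda>_. f x"])
      (auto simp: Q space_restrict_space cell_constD[OF assms])
qed auto

lemma lebesgue_measurable_cell_const:
  fixes f :: "'a::euclidean_space \<Rightarrow> real"
  assumes "cell_const s f"
  shows "f \<in> borel_measurable lebesgue"
proof -
  have "f \<in> borel_measurable lborel"
    using borel_measurable_cell_const[OF assms] by simp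
  then show ?thesis by (rule measurable_completion)
qed

text \<open>Local integrability, tested on the cells of all shapes.\<close>
definition cell_integrable :: "('a::euclidean_space \<Rightarrow> real) \<Rightarrow> bool" where
  "cell_integrable f \<longleftrightarrow> (\<forall>s x. set_integrable lebesgue (cell s x) f)"

text \<open>Only finitely many cells of one shape meet a given cell of another, so the function takes
  finitely many values there.\<close>
lemma cell_const_integrable:
  assumes "cell_const s f"
  shows "cell_integrable f"
  unfolding cell_integrable_def
proof (intro allI)
  fix s' :: "'a \<Rightarrow> int" and x
  have fin: "finite (f ` cell s' x)"
  proof -
    have "f ` cell s' x \<subseteq> (\<lambda>Q. f (SOME z. z \<in> Q)) ` (cell s ` cell s' x)"
    proof
      fix v assume "v \<in> f ` cell s' x"
      then obtain y where y: "y \<in> cell s' x" "v = f y" by auto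
      have "(SOME z. z \<in> cell s y) \<in> cell s y" by (rule someI[of _ y]) simp
      then have "v = f (SOME z. z \<in> cell s y)"
        using cell_constD[OF assms] y by simp
      then show "v \<in> (\<lambda>Q. f (SOME z. z \<in> Q)) ` (cell s ` cell s' x)" using y by blast
    qed
    then show ?thesis using finite_cells finite_surj by blast
  qed
  define M where "M = Max ((\<lambda>v. \<bar>v\<bar>) ` f ` cell s' x)"
  have M: "\<bar>f y\<bar> \<le> M" if "y \<in> cell s' x" for y
    unfolding M_def using fin that by (intro Max_ge) auto
  have "set_integrable lebesgue (cell s' x) (\<lambda>_. M)"
    by (simp add: set_integrable_def emeasure_cell less_top[symmetric])
  moreover have "set_borel_measurable lebesgue (cell s' x) f"
    using lebesgue_measurable_cell_const[OF assms] by (simp add: set_borel_measurable_def)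
  ultimately show "set_integrable lebesgue (cell s' x) f"
    by (rule set_integrable_bound) (use M in \<open>auto intro!: AE_I2 intro: order_trans abs_ge_self\<close>)
qed

section \<open>Averages over cells\<close>

lemma cell_integrableD: "cell_integrable f \<Longrightarrow> set_integrable lebesgue (cell s x) f"
  by (simp add: cell_integrable_def)

lemma cell_integrable_measurable:
  assumes "cell_integrable f"
  shows "f \<in> borel_measurable lebesgue"
proof (rule measurable_piecewise_restrict[OF countable_cells[of "\<lambda>_. 0"]])
  fix Q :: "'a set" assume "Q \<in> range (cell (\<lambda>_. 0))"
  then obtain x where Q: "Q = cell (\<lambda>_. 0) x" by auto
  show "Q \<inter> space lebesgue \<in> sets lebesgue" by (simp add: Q)
  have "(\<lambda>y. indicator Q y *\<^sub>R f y) \<in> borel_measurable lebesgue"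
    using cell_integrableD[OF assms] unfolding set_integrable_def Q
    by (rule borel_measurable_integrable)
  then show "f \<in> borel_measurable (restrict_space lebesgue Q)"
    by (subst borel_measurable_restrict_space_iff) (auto simp: Q)
qed (auto intro: cell_self)

lemma cell_integrable_add: "cell_integrable f \<Longrightarrow> cell_integrable g \<Longrightarrow> cell_integrable (\<lambda>x. f x + g x)"
  and cell_integrable_diff: "cell_integrable f \<Longrightarrow> cell_integrable g \<Longrightarrow> cell_integrable (\<lambda>x. f x - g x)"
  and cell_integrable_cmult: "cell_integrable f \<Longrightarrow> cell_integrable (\<lambda>x. c * f x)"
  by (auto simp: cell_integrable_def)

lemma cell_integrable_sum:
  "finite I \<Longrightarrow> (\<And>i. i \<in> I \<Longrightarrow> cell_integrable (f i)) \<Longrightarrow> cell_integrable (\<lambda>x. \<Sum>i\<in>I. f i x)"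
  by (induction I rule: finite_induct)
    (auto intro!: cell_integrable_add cell_const_integrable[OF cell_const_const])

lemma avg_add: "cell_integrable f \<Longrightarrow> cell_integrable g \<Longrightarrow> avg s (\<lambda>x. f x + g x) x = avg s f x + avg s g x"
  and avg_diff: "cell_integrable f \<Longrightarrow> cell_integrable g \<Longrightarrow> avg s (\<lambda>x. f x - g x) x = avg s f x - avg s g x"
  and avg_cmult: "avg s (\<lambda>x. c * f x) x = c * avg s f x"
  by (simp_all add: avg_def cell_integrable_def set_integral_add(2) add_divide_distrib diff_divide_distrib)

lemma avg_cong: "(\<And>y. y \<in> cell s x \<Longrightarrow> f y = g y) \<Longrightarrow> avg s f x = avg s g x"
  unfolding avg_def by (intro arg_cong2[where f="(/)"] set_lebesgue_integral_cong) auto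

lemma avg_const [simp]: "avg s (\<lambda>_. c) x = c"
  using cell_vol_pos[of s] by (simp add: avg_def set_lebesgue_integral_def measure_cell)

lemma avg_cell_const:
  assumes "cell_const s f"
  shows "avg s f x = f x"
proof -
  have "avg s f x = avg s (\<lambda>_. f x) x" by (intro avg_cong cell_constD[OF assms])
  then show ?thesis by simp
qed

lemma avg_sum:
  "finite I \<Longrightarrow> (\<And>i. i \<in> I \<Longrightarrow> cell_integrable (f i)) \<Longrightarrow>
    avg s (\<lambda>x. \<Sum>i\<in>I. f i x) x = (\<Sum>i\<in>I. avg s (f i) x)"
  by (induction I rule: finite_induct) (auto simp: avg_add cell_integrable_sum)

lemma avg_mono_cell:
  assumes "cell_integrable f" "cell_integrable g" "\<And>y. y \<in> cell s x \<Longrightarrow> f y \<le> g y"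
  shows "avg s f x \<le> avg s g x"
  unfolding avg_def using assms cell_vol_pos[of s]
  by (intro divide_right_mono set_integral_mono cell_integrableD) (auto simp: less_imp_le)

lemma avg_mono:
  assumes "cell_integrable f" "cell_integrable g" "\<And>y. f y \<le> g y"
  shows "avg s f x \<le> avg s g x"
  using assms by (rule avg_mono_cell)

text \<open>Jensen's inequality on one cell, with the supporting line made explicit. The slope may depend
  on the cell, which is what the transform needs: there the line is taken at the values that the
  coarser martingale has on the cell.\<close>
lemma avg_support:
  fixes f H :: "'a::euclidean_space \<Rightarrow> real"
  assumes f: "cell_integrable f" and H: "cell_integrable H"
    and le: "\<And>y. y \<in> cell s x \<Longrightarrow> c + k * (f y - avg s f x) \<le> H y"
  shows "c \<le> avg s H x"
proof -
  have i: "cell_integrable (\<lambda>_ :: 'a. u)" for u :: real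
    by (rule cell_const_integrable[of "\<lambda>_. 0", OF cell_const_const])
  have fi: "cell_integrable (\<lambda>y. k * (f y - avg s f x))"
    by (intro cell_integrable_cmult cell_integrable_diff f i)
  have "avg s (\<lambda>y. c + k * (f y - avg s f x)) x = c"
    by (simp add: avg_add[OF i fi] avg_cmult avg_diff[OF f i])
  moreover have "avg s (\<lambda>y. c + k * (f y - avg s f x)) x \<le> avg s H x"
    by (intro avg_mono_cell cell_integrable_add i fi H le)
  ultimately show ?thesis by simp
qed

lemma cell_integral_split:
  fixes f :: "'a::euclidean_space \<Rightarrow> real"
  assumes "set_integrable lebesgue (cell s' x) f"
  shows "(LINT y:cell s' x|lebesgue. f y) = (\<Sum>Q\<in>cell s ` cell s' x. LINT y:Q \<inter> cell s' x|lebesgue. f y)"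
proof -
  have U: "(\<Union>Q\<in>cell s ` cell s' x. Q \<inter> cell s' x) = cell s' x" by auto
  have "(LINT y:(\<Union>Q\<in>cell s ` cell s' x. Q \<inter> cell s' x)|lebesgue. f y)
      = (\<Sum>Q\<in>cell s ` cell s' x. LINT y:Q \<inter> cell s' x|lebesgue. f y)"
  proof (rule set_integral_finite_Union)
    show "disjoint_family_on (\<lambda>Q. Q \<inter> cell s' x) (cell s ` cell s' x)"
      unfolding disjoint_family_on_def by (auto simp: mem_cell_iff)
    show "set_integrable lebesgue (Q \<inter> cell s' x) f" if "Q \<in> cell s ` cell s' x" for Q
      using that by (intro set_integrable_subset[OF assms]) auto
  qed (auto simp: finite_cells)
  then show ?thesis unfolding U .
qed

abbreviation cmax :: "('a \<Rightarrow> int) \<Rightarrow> ('a \<Rightarrow> int) \<Rightarrow> 'a \<Rightarrow> int" where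
  "cmax s s' \<equiv> \<lambda>b. max (s b) (s' b)"

lemma cell_le_cmax: "cell s x \<subseteq> cell (cmax s s') x" "cell s' x \<subseteq> cell (cmax s s') x"
  by (rule cell_mono; simp)+

text \<open>In each direction the finer of the two dyadic intervals lies in the coarser one.\<close>
lemma cell_inter_cell:
  assumes "y \<in> cell (cmax s s') x"
  obtains z where "cell s x \<inter> cell s' y = cell (\<lambda>b. min (s b) (s' b)) z" "z \<in> cell s x" "z \<in> cell s' y"
proof -
  define z where "z = (\<Sum>b\<in>Basis. (if s b \<le> s' b then x \<bullet> b else y \<bullet> b) *\<^sub>R b)"
  have zb: "z \<bullet> b = (if s b \<le> s' b then x \<bullet> b else y \<bullet> b)" if "b \<in> Basis" for b
    using that by (auto simp: z_def inner_sum_left_Basis)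
  have "cell_idx s z b = cell_idx s x b \<and> cell_idx s' z b = cell_idx s' y b" if b: "b \<in> Basis" for b
  proof (cases "s b \<le> s' b")
    case True
    have "cell_idx s' y b = cell_idx s' x b"
      using assms b True by (force simp: cell_def cell_idx_def max_def)
    then show ?thesis using zb[OF b] True by (simp add: cell_idx_def)
  next
    case False
    have "cell_idx s y b = cell_idx s x b"
      using assms b False by (force simp: cell_def cell_idx_def max_def)
    then show ?thesis using zb[OF b] False by (simp add: cell_idx_def)
  qed
  then have z: "z \<in> cell s x" "z \<in> cell s' y" by (auto simp: cell_def)
  then have "cell s x \<inter> cell s' y = cell s z \<inter> cell s' z"
    by (simp add: mem_cell_iff)
  also have "\<dots> = cell (\<lambda>b. min (s b) (s' b)) z"
  proof
    show "cell (\<lambda>b. min (s b) (s' b)) z \<subseteq> cell s z \<inter> cell s' z"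
      using cell_mono[of "\<lambda>b. min (s b) (s' b)" s z] cell_mono[of "\<lambda>b. min (s b) (s' b)" s' z] by auto
    show "cell s z \<inter> cell s' z \<subseteq> cell (\<lambda>b. min (s b) (s' b)) z"
      by (auto simp: cell_def cell_idx_def min_def)
  qed
  finally show thesis using that z by blast
qed

lemma cell_vol_min_max: "cell_vol (\<lambda>b. min (s b) (s' b)) * cell_vol (cmax s s') = cell_vol s * cell_vol s'"
  unfolding cell_vol_def prod.distrib[symmetric] by (intro prod.cong) (auto simp: min_def max_def)

text \<open>Inside a cell of shape \<open>cmax s s'\<close>, every cell of shape \<open>s\<close> meets every cell of shape \<open>s'\<close>, and all
  the intersections have the same volume. Averaging \<open>avg s' f\<close> over the former thus gives equal
  weight to all the latter. For \<open>s \<le> s'\<close> this is the tower property, and for shapes that differ in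
  complementary directions it says that the averages commute.\<close>
theorem avg_avg:
  assumes f: "cell_integrable f"
  shows "avg s (avg s' f) x = avg (cmax s s') f x"
proof -
  let ?m = "\<lambda>b. min (s b) (s' b)" and ?M = "cmax s s'"
  let ?C = "cell s' ` cell s x"
  have C: "cell s' ` cell ?M x = ?C"
  proof
    show "?C \<subseteq> cell s' ` cell ?M x" using cell_le_cmax by blast
    show "cell s' ` cell ?M x \<subseteq> ?C"
    proof
      fix Q assume "Q \<in> cell s' ` cell ?M x"
      then obtain y where y: "y \<in> cell ?M x" "Q = cell s' y" by auto
      obtain z where "z \<in> cell s x" "z \<in> cell s' y" using cell_inter_cell[OF y(1)] by blast
      then show "Q \<in> ?C" using y by (auto simp: mem_cell_iff)
    qed
  qed
  have "(LINT y:cell s x|lebesgue. avg s' f y) = (\<Sum>Q\<in>?C. LINT y:Q \<inter> cell s x|lebesgue. avg s' f y)"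
    by (intro cell_integral_split cell_integrableD cell_const_integrable[OF cell_const_avg])
  also have "\<dots> = (\<Sum>Q\<in>?C. cell_vol ?m / cell_vol s' * (LINT y:Q \<inter> cell ?M x|lebesgue. f y))"
  proof (intro sum.cong refl)
    fix Q assume "Q \<in> ?C"
    then obtain y where y: "y \<in> cell s x" "Q = cell s' y" by auto
    then have yM: "y \<in> cell ?M x" using cell_le_cmax by blast
    obtain z where z: "cell s x \<inter> cell s' y = cell ?m z" using cell_inter_cell[OF yM] by blast
    have QM: "Q \<inter> cell ?M x = cell s' y"
      using cell_le_cmax(2)[of s' y s] yM y by (auto simp: mem_cell_iff)
    have Qs: "Q \<inter> cell s x = cell ?m z" using z y by blast
    have "(LINT w:Q \<inter> cell s x|lebesgue. avg s' f w) = (LINT w:cell ?m z|lebesgue. avg s' f y)"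
      unfolding Qs
    proof (intro set_lebesgue_integral_cong allI impI)
      fix w assume "w \<in> cell ?m z"
      then have "w \<in> cell s' y" using z by blast
      then show "avg s' f w = avg s' f y" by (rule cell_constD[OF cell_const_avg])
    qed simp
    also have "\<dots> = cell_vol ?m * avg s' f y"
      by (simp add: set_lebesgue_integral_def measure_cell)
    finally show "(LINT w:Q \<inter> cell s x|lebesgue. avg s' f w)
        = cell_vol ?m / cell_vol s' * (LINT w:Q \<inter> cell ?M x|lebesgue. f w)"
      unfolding QM by (simp add: avg_def)
  qed
  also have "\<dots> = cell_vol ?m / cell_vol s' * (LINT y:cell ?M x|lebesgue. f y)"
    unfolding sum_distrib_left[symmetric] C[symmetric]
    by (simp add: cell_integral_split[OF cell_integrableD[OF f], of _ _ s'])
  finally have "avg s (avg s' f) x = cell_vol ?m / (cell_vol s * cell_vol s') * (LINT y:cell ?M x|lebesgue. f y)"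
    by (simp add: avg_def mult.commute)
  also have "cell_vol ?m / (cell_vol s * cell_vol s') = 1 / cell_vol ?M"
    unfolding cell_vol_min_max[of s s', symmetric] using cell_vol_pos[of ?m] by simp
  finally show ?thesis by (simp add: avg_def)
qed

lemma avg_shape_cong:
  fixes s s' :: "'a::euclidean_space \<Rightarrow> int"
  assumes "\<And>b. b \<in> Basis \<Longrightarrow> s b = s' b"
  shows "avg s = avg s'"
proof -
  have "cell s x = cell s' x" for x using assms by (simp add: cell_def cell_idx_def)
  moreover have "cell_vol s = cell_vol s'" using assms by (simp add: cell_vol_def)
  ultimately show ?thesis by (simp add: avg_def fun_eq_iff)
qed

lemma avg_avg_coarser:
  fixes s s' :: "'a::euclidean_space \<Rightarrow> int"
  assumes f: "cell_integrable f" and le: "\<And>b. b \<in> Basis \<Longrightarrow> s b \<le> s' b"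
  shows "avg s' (avg s f) x = avg s' f x" "avg s (avg s' f) x = avg s' f x"
proof -
  have "avg (cmax s' s) = avg s'" "avg (cmax s s') = avg s'"
    by (rule avg_shape_cong; use le in \<open>simp add: max_absorb1 max_absorb2\<close>)+
  then show "avg s' (avg s f) x = avg s' f x" "avg s (avg s' f) x = avg s' f x"
    by (simp_all add: avg_avg[OF f])
qed

lemma nn_integral_cells:
  assumes F[measurable]: "F \<in> borel_measurable lebesgue"
  shows "(\<integral>\<^sup>+x. F x \<partial>lebesgue) = (\<integral>\<^sup>+Q. (\<integral>\<^sup>+x\<in>Q. F x \<partial>lebesgue) \<partial>count_space (range (cell s)))"
proof -
  have "F x = (\<integral>\<^sup>+Q. F x * indicator Q x \<partial>count_space (range (cell s)))" for x
    by (subst nn_integral_count_space'[of "{cell s x}"]) (auto simp: mem_cell_iff split: split_indicator)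
  then have "(\<integral>\<^sup>+x. F x \<partial>lebesgue) = (\<integral>\<^sup>+x. (\<integral>\<^sup>+Q. F x * indicator Q x \<partial>count_space (range (cell s))) \<partial>lebesgue)"
    by simp
  also have "\<dots> = (\<integral>\<^sup>+Q. (\<integral>\<^sup>+x\<in>Q. F x \<partial>lebesgue) \<partial>count_space (range (cell s)))"
    by (intro nn_integral_count_space_nn_integral countable_cells) (auto intro!: borel_measurable_times borel_measurable_indicator)
  finally show ?thesis .
qed

lemma set_nn_integral_cell:
  assumes "cell_integrable H" "\<And>y. 0 \<le> H y"
  shows "(\<integral>\<^sup>+y\<in>cell s x. ennreal (H y) \<partial>lebesgue) = ennreal (cell_vol s * avg s H x)"
proof -
  have "(\<integral>\<^sup>+y\<in>cell s x. ennreal (H y) \<partial>lebesgue) = (\<integral>\<^sup>+y. ennreal (indicator (cell s x) y *\<^sub>R H y) \<partial>lebesgue)"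
    by (intro nn_integral_cong) (auto split: split_indicator)
  also have "\<dots> = ennreal (\<integral>y. indicator (cell s x) y *\<^sub>R H y \<partial>lebesgue)"
    using cell_integrableD[OF assms(1), of s x] assms(2)
    by (intro nn_integral_eq_integral) (auto simp: set_integrable_def)
  finally show ?thesis
    using cell_vol_pos[of s] by (simp add: avg_def set_lebesgue_integral_def)
qed

text \<open>Passes from an inequality on each cell to one for integrals over the whole space, which
  may be infinite.\<close>
lemma nn_integral_le_if_avg_le:
  assumes H: "cell_integrable H" "\<And>y. 0 \<le> H y" and G: "cell_integrable G" "\<And>y. 0 \<le> G y"
    and le: "\<And>x. avg s H x \<le> avg s G x"
  shows "(\<integral>\<^sup>+x. ennreal (H x) \<partial>lebesgue) \<le> (\<integral>\<^sup>+x. ennreal (G x) \<partial>lebesgue)"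
proof -
  have [measurable]: "H \<in> borel_measurable lebesgue" "G \<in> borel_measurable lebesgue"
    using cell_integrable_measurable H G by auto
  have "(\<integral>\<^sup>+x. ennreal (H x) \<partial>lebesgue) = (\<integral>\<^sup>+Q. (\<integral>\<^sup>+x\<in>Q. ennreal (H x) \<partial>lebesgue) \<partial>count_space (range (cell s)))"
    by (rule nn_integral_cells) simp
  also have "\<dots> \<le> (\<integral>\<^sup>+Q. (\<integral>\<^sup>+x\<in>Q. ennreal (G x) \<partial>lebesgue) \<partial>count_space (range (cell s)))"
    using le cell_vol_pos[of s]
    by (rule_tac nn_integral_mono) (auto simp: set_nn_integral_cell H G intro!: ennreal_leI)
  also have "\<dots> = (\<integral>\<^sup>+x. ennreal (G x) \<partial>lebesgue)"
    by (rule nn_integral_cells[symmetric]) simp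
  finally show ?thesis .
qed

lemma abs_avg_powr_le:
  assumes p: "1 < p" and f: "cell_integrable f" and fp: "cell_integrable (\<lambda>x. \<bar>f x\<bar> powr p)"
  shows "\<bar>avg s f x\<bar> powr p \<le> avg s (\<lambda>x. \<bar>f x\<bar> powr p) x"
proof -
  obtain g where "\<And>y. \<bar>y\<bar> powr p \<ge> \<bar>avg s f x\<bar> powr p + g * (y - avg s f x)"
    using abs_powr_support[OF p] by blast
  then show ?thesis by (intro avg_support[OF f fp])
qed

section \<open>Martingale transforms\<close>

text \<open>The martingale \<open>X\<close> runs from fine to coarse, since \<open>\<sigma>\<close> becomes coarser with the index, and \<open>T N\<close>
  transforms its first \<open>N\<close> steps. The induction on \<open>N\<close> needs an arbitrary starting value \<open>Y\<close> at the
  coarse end: the coarsest step is added to \<open>Y\<close>, where it is constant on the cells of the previous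
  level, and is then removed by Jensen's inequality along a zigzag direction.\<close>
lemma martingale_transform_burkholder:
  fixes \<sigma> :: "nat \<Rightarrow> 'a::euclidean_space \<Rightarrow> int" and G :: "'a \<Rightarrow> real"
  assumes p: "1 < p" and mono: "\<And>i b. b \<in> Basis \<Longrightarrow> \<sigma> i b \<le> \<sigma> (Suc i) b"
    and eps: "\<And>i. \<epsilon> i \<in> {1, -1}" and G: "cell_const (\<sigma> 0) G"
  defines "X \<equiv> \<lambda>i. avg (\<sigma> i) G"
  defines "T \<equiv> \<lambda>N x. \<Sum>i<N. \<epsilon> i * (X i x - X (Suc i) x)"
  defines "B \<equiv> \<lambda>x y. burkholder p (x + y) (x - y)"
  shows "cell_const (\<sigma> N) Y \<Longrightarrow> B (X N z) (Y z) \<le> avg (\<sigma> N) (\<lambda>x. B (G x) (Y x + T N x)) z"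
proof (induction N arbitrary: Y z)
  case 0
  have "cell_const (\<sigma> 0) (\<lambda>x. B (G x) (Y x))"
    by (rule cell_const_comp2[OF G 0])
  then show ?case
    by (simp add: T_def X_def avg_cell_const[OF G] avg_cell_const)
next
  case (Suc N)
  have le: "\<sigma> i b \<le> \<sigma> j b" if "i \<le> j" "b \<in> Basis" for i j b
    by (rule lift_Suc_mono_le[of "\<lambda>i. \<sigma> i b", OF mono[OF that(2)] that(1)])
  have X: "cell_const (\<sigma> i) (X i)" for i by (simp add: X_def)
  have X0: "cell_const (\<sigma> 0) (X i)" for i
    by (rule cell_const_coarser[OF X[of i]]) (simp add: le)
  have Gi: "cell_integrable G" by (rule cell_const_integrable[OF G])
  have Y0: "cell_const (\<sigma> 0) Y" by (rule cell_const_coarser[OF Suc.prems]) (simp add: le)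
  \<comment> \<open>The first \<open>N\<close> steps start from \<open>Y'\<close>, which already contains the coarsest step.\<close>
  define Y' where "Y' = (\<lambda>x. Y x + \<epsilon> N * (X N x - X (Suc N) x))"
  have XN: "cell_const (\<sigma> N) (X (Suc N))" "cell_const (\<sigma> N) Y"
    by (rule cell_const_coarser[of "\<sigma> (Suc N)"]; use X Suc.prems mono in simp)+
  have Y'N: "cell_const (\<sigma> N) Y'"
    unfolding Y'_def
    by (rule cell_const_comp2[OF XN(2)], rule cell_const_comp2[OF X XN(1), of "\<lambda>u v. \<epsilon> N * (u - v)"])
  have T0: "cell_const (\<sigma> 0) (T N)" for N
    unfolding T_def by (intro cell_const_sum cell_const_comp2[OF X0 X0, of "\<lambda>u v. _ * (u - v)"])
  define H where "H = (\<lambda>x. B (G x) (Y x + T (Suc N) x))"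
  have H0: "cell_const (\<sigma> 0) H"
    unfolding H_def by (rule cell_const_comp2[OF G cell_const_comp2[OF Y0 T0]])
  have Hi: "cell_integrable H" by (rule cell_const_integrable[OF H0])
  have BNi: "cell_integrable (\<lambda>x. B (X N x) (Y' x))"
    by (rule cell_const_integrable[OF cell_const_comp2[OF X Y'N]])
  have IH: "B (X N x) (Y' x) \<le> avg (\<sigma> N) H x" for x
  proof -
    have "H = (\<lambda>x. B (G x) (Y' x + T N x))"
      by (simp add: H_def Y'_def T_def fun_eq_iff algebra_simps)
    then show ?thesis using Suc.IH[OF Y'N] by simp
  qed
  have XX: "avg (\<sigma> (Suc N)) (X N) z = X (Suc N) z"
    unfolding X_def by (rule avg_avg_coarser(1)[OF Gi mono])
  obtain g where g: "\<And>h. B (X (Suc N) z + h) (Y z + \<epsilon> N * h) \<ge> B (X (Suc N) z) (Y z) + g * h"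
    using burkholder_zigzag_support[OF p eps[of N], of "X (Suc N) z" "Y z"] unfolding B_def by blast
  have "B (X (Suc N) z) (Y z) \<le> avg (\<sigma> (Suc N)) (\<lambda>x. B (X N x) (Y' x)) z"
  proof (rule avg_support[OF cell_const_integrable[OF X[of N]] BNi])
    fix w assume w: "w \<in> cell (\<sigma> (Suc N)) z"
    have "X (Suc N) w = X (Suc N) z" "Y w = Y z"
      by (rule cell_constD[OF X w], rule cell_constD[OF Suc.prems w])
    then show "B (X (Suc N) z) (Y z) + g * (X N w - avg (\<sigma> (Suc N)) (X N) z) \<le> B (X N w) (Y' w)"
      using g[of "X N w - X (Suc N) z"] by (simp add: XX Y'_def)
  qed
  also have "\<dots> \<le> avg (\<sigma> (Suc N)) (avg (\<sigma> N) H) z"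
    by (intro avg_mono BNi IH cell_const_integrable[OF cell_const_avg])
  also have "\<dots> = avg (\<sigma> (Suc N)) H z"
    by (rule avg_avg_coarser(1)[OF Hi mono])
  finally show ?case by (simp add: H_def)
qed

text \<open>For \<open>Y = 0\<close> the Burkholder function is nonnegative at the coarse end, because it is evaluated at
  \<open>u = v\<close>. Hence the average over a coarse cell of its values at the fine end is nonnegative, and the
  upper bound for the function turns this into the claim.\<close>
theorem martingale_transform_bound:
  fixes p :: real
  assumes p: "1 < p"
  shows "\<exists>K. 0 < K \<and> (\<forall>(\<sigma> :: nat \<Rightarrow> 'a::euclidean_space \<Rightarrow> int) \<epsilon> G N.
    (\<forall>i. \<forall>b\<in>Basis. \<sigma> i b \<le> \<sigma> (Suc i) b) \<longrightarrow> (\<forall>i. \<epsilon> i \<in> {1, -1}) \<longrightarrow> cell_const (\<sigma> 0) G \<longrightarrow>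
    (\<integral>\<^sup>+x. ennreal (\<bar>\<Sum>i<N. \<epsilon> i * (avg (\<sigma> i) G x - avg (\<sigma> (Suc i)) G x)\<bar> powr p) \<partial>lebesgue)
      \<le> (\<integral>\<^sup>+x. ennreal (K * \<bar>G x\<bar> powr p) \<partial>lebesgue))"
proof -
  obtain c C where c: "0 < c" "0 \<le> C"
    and up: "\<And>x y. burkholder p (x + y) (x - y) \<le> C * \<bar>x\<bar> powr p - c * \<bar>y\<bar> powr p"
    using burkholder_upper[OF p] by blast
  show ?thesis
  proof (rule exI[of _ "(C + 1) / c"], intro conjI allI impI)
    show "0 < (C + 1) / c" using c by simp
    fix \<sigma> :: "nat \<Rightarrow> 'a \<Rightarrow> int" and \<epsilon> :: "nat \<Rightarrow> real" and G :: "'a \<Rightarrow> real" and N :: nat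
    assume mono: "\<forall>i. \<forall>b\<in>Basis. \<sigma> i b \<le> \<sigma> (Suc i) b" and eps: "\<forall>i. \<epsilon> i \<in> {1, -1}"
      and G: "cell_const (\<sigma> 0) G"
    define T where "T = (\<lambda>x. \<Sum>i<N. \<epsilon> i * (avg (\<sigma> i) G x - avg (\<sigma> (Suc i)) G x))"
    have le: "\<sigma> 0 b \<le> \<sigma> j b" if "b \<in> Basis" for j b
      by (rule lift_Suc_mono_le[of "\<lambda>i. \<sigma> i b"]) (use mono that in auto)
    have X0: "cell_const (\<sigma> 0) (avg (\<sigma> i) G)" for i
      by (rule cell_const_coarser[OF cell_const_avg le])
    have T: "cell_const (\<sigma> 0) T"
      unfolding T_def by (intro cell_const_sum cell_const_comp2[OF X0 X0, of "\<lambda>u v. _ * (u - v)"])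
    have i: "cell_integrable (\<lambda>x. \<bar>T x\<bar> powr p)" "cell_integrable (\<lambda>x. \<bar>G x\<bar> powr p)"
      "cell_integrable (\<lambda>x. burkholder p (G x + T x) (G x - T x))"
      by (rule cell_const_integrable, rule cell_const_comp T G cell_const_comp2[OF G T])+
    show "(\<integral>\<^sup>+x. ennreal (\<bar>\<Sum>i<N. \<epsilon> i * (avg (\<sigma> i) G x - avg (\<sigma> (Suc i)) G x)\<bar> powr p) \<partial>lebesgue)
      \<le> (\<integral>\<^sup>+x. ennreal ((C + 1) / c * \<bar>G x\<bar> powr p) \<partial>lebesgue)"
      unfolding T_def[symmetric, THEN fun_cong, simplified]
    proof (rule nn_integral_le_if_avg_le[where s = "\<sigma> N"])
      fix z
      have "0 \<le> burkholder p (avg (\<sigma> N) G z + 0) (avg (\<sigma> N) G z - 0)"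
        using p by (simp add: burkholder_def)
      also have "\<dots> \<le> avg (\<sigma> N) (\<lambda>x. burkholder p (G x + (0 + T x)) (G x - (0 + T x))) z"
        unfolding T_def using mono eps
        by (intro martingale_transform_burkholder[where \<sigma>=\<sigma> and Y="\<lambda>_. 0" and p=p] p G cell_const_const) auto
      also have "\<dots> \<le> avg (\<sigma> N) (\<lambda>x. C * \<bar>G x\<bar> powr p - c * \<bar>T x\<bar> powr p) z"
        using i up by (intro avg_mono cell_integrable_diff cell_integrable_cmult) auto
      also have "\<dots> = C * avg (\<sigma> N) (\<lambda>x. \<bar>G x\<bar> powr p) z - c * avg (\<sigma> N) (\<lambda>x. \<bar>T x\<bar> powr p) z"
        by (simp add: avg_diff avg_cmult cell_integrable_cmult i)
      finally have 1: "c * avg (\<sigma> N) (\<lambda>x. \<bar>T x\<bar> powr p) z \<le> C * avg (\<sigma> N) (\<lambda>x. \<bar>G x\<bar> powr p) z"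
        by simp
      have "avg (\<sigma> N) (\<lambda>_. 0) z \<le> avg (\<sigma> N) (\<lambda>x. \<bar>G x\<bar> powr p) z"
        by (intro avg_mono i cell_const_integrable[OF cell_const_const[of "\<sigma> 0"]]) auto
      then have "0 \<le> avg (\<sigma> N) (\<lambda>x. \<bar>G x\<bar> powr p) z" by simp
      with 1 have "c * avg (\<sigma> N) (\<lambda>x. \<bar>T x\<bar> powr p) z \<le> (C + 1) * avg (\<sigma> N) (\<lambda>x. \<bar>G x\<bar> powr p) z"
        by (simp add: algebra_simps)
      then show "avg (\<sigma> N) (\<lambda>x. \<bar>T x\<bar> powr p) z \<le> avg (\<sigma> N) (\<lambda>x. (C + 1) / c * \<bar>G x\<bar> powr p) z"
        unfolding avg_cmult using c by (simp add: field_simps)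
      show "cell_integrable (\<lambda>x. (C + 1) / c * \<bar>G x\<bar> powr p)"
        by (rule cell_integrable_cmult[OF i(2)])
    qed (use i c in auto)
  qed
qed

text \<open>If the averages at the levels \<open>i < r j\<close> fix \<open>D j\<close> and all later ones annihilate it, then the step of
  the martingale of \<open>\<Sum>\<^sub>j D j\<close> from level \<open>i\<close> to level \<open>i + 1\<close> is the sum of the \<open>D j\<close> with \<open>r j = i + 1\<close>.
  Multiplying \<open>D j\<close> by a sign that depends on \<open>r j\<close> only is thus a martingale transform.\<close>
lemma sign_change_bound:
  fixes p :: real
  assumes p: "1 < p"
  shows "\<exists>K. 0 < K \<and> (\<forall>(\<sigma> :: nat \<Rightarrow> 'a::euclidean_space \<Rightarrow> int) \<epsilon> D (J :: 'j set) r N.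
    (\<forall>i. \<forall>b\<in>Basis. \<sigma> i b \<le> \<sigma> (Suc i) b) \<longrightarrow> (\<forall>i. \<epsilon> i \<in> {1, -1}) \<longrightarrow> finite J \<longrightarrow>
    (\<forall>j\<in>J. cell_const (\<sigma> 0) (D j)) \<longrightarrow> (\<forall>j\<in>J. r j \<in> {1..N}) \<longrightarrow>
    (\<forall>j\<in>J. \<forall>i\<le>N. \<forall>x. avg (\<sigma> i) (D j) x = (if r j \<le> i then 0 else D j x)) \<longrightarrow>
    (\<integral>\<^sup>+x. ennreal (\<bar>\<Sum>j\<in>J. \<epsilon> (r j) * D j x\<bar> powr p) \<partial>lebesgue)
      \<le> (\<integral>\<^sup>+x. ennreal (K * \<bar>\<Sum>j\<in>J. D j x\<bar> powr p) \<partial>lebesgue))"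
proof -
  obtain K where K: "0 < K" and bound: "\<And>(\<sigma> :: nat \<Rightarrow> 'a \<Rightarrow> int) \<epsilon> G N.
    (\<forall>i. \<forall>b\<in>Basis. \<sigma> i b \<le> \<sigma> (Suc i) b) \<Longrightarrow> (\<forall>i. \<epsilon> i \<in> {1, -1}) \<Longrightarrow> cell_const (\<sigma> 0) G \<Longrightarrow>
    (\<integral>\<^sup>+x. ennreal (\<bar>\<Sum>i<N. \<epsilon> i * (avg (\<sigma> i) G x - avg (\<sigma> (Suc i)) G x)\<bar> powr p) \<partial>lebesgue)
      \<le> (\<integral>\<^sup>+x. ennreal (K * \<bar>G x\<bar> powr p) \<partial>lebesgue)"
    using martingale_transform_bound[OF p] by blast
  show ?thesis
  proof (rule exI[of _ K], intro conjI allI impI K)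
    fix \<sigma> :: "nat \<Rightarrow> 'a \<Rightarrow> int" and \<epsilon> :: "nat \<Rightarrow> real" and D :: "'j \<Rightarrow> 'a \<Rightarrow> real"
      and J :: "'j set" and r :: "'j \<Rightarrow> nat" and N :: nat
    assume mono: "\<forall>i. \<forall>b\<in>Basis. \<sigma> i b \<le> \<sigma> (Suc i) b" and eps: "\<forall>i. \<epsilon> i \<in> {1, -1}"
      and J: "finite J" and D: "\<forall>j\<in>J. cell_const (\<sigma> 0) (D j)" and r: "\<forall>j\<in>J. r j \<in> {1..N}"
      and av: "\<forall>j\<in>J. \<forall>i\<le>N. \<forall>x. avg (\<sigma> i) (D j) x = (if r j \<le> i then 0 else D j x)"
    define G where "G = (\<lambda>x. \<Sum>j\<in>J. D j x)"
    have Di: "cell_integrable (D j)" if "j \<in> J" for j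
      using D that cell_const_integrable by blast
    have G: "cell_const (\<sigma> 0) G" unfolding G_def by (intro cell_const_sum) (use D in blast)
    have aG: "avg (\<sigma> i) G x = (\<Sum>j\<in>J. if r j \<le> i then 0 else D j x)" if "i \<le> N" for i x
      unfolding G_def using av that by (simp add: avg_sum[OF J Di] cong: sum.cong)
    have "(\<Sum>i<N. \<epsilon> (Suc i) * (avg (\<sigma> i) G x - avg (\<sigma> (Suc i)) G x)) = (\<Sum>j\<in>J. \<epsilon> (r j) * D j x)" for x
    proof -
      have "(\<Sum>i<N. \<epsilon> (Suc i) * (avg (\<sigma> i) G x - avg (\<sigma> (Suc i)) G x))
          = (\<Sum>i<N. \<Sum>j\<in>J. if r j = Suc i then \<epsilon> (r j) * D j x else 0)"
        by (intro sum.cong refl)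
          (auto simp: aG sum_distrib_left sum_subtractf[symmetric] intro!: sum.cong)
      also have "\<dots> = (\<Sum>j\<in>J. \<Sum>i<N. if i = r j - 1 then \<epsilon> (r j) * D j x else 0)"
        by (subst sum.swap) (use r in \<open>force intro!: sum.cong\<close>)
      also have "\<dots> = (\<Sum>j\<in>J. \<epsilon> (r j) * D j x)"
        using r by (intro sum.cong refl) (auto simp: sum.delta)
      finally show ?thesis .
    qed
    \<comment> \<open>The step from level \<open>i\<close> to level \<open>i + 1\<close> carries the sign of index \<open>i + 1\<close>.\<close>
    then show "(\<integral>\<^sup>+x. ennreal (\<bar>\<Sum>j\<in>J. \<epsilon> (r j) * D j x\<bar> powr p) \<partial>lebesgue)
      \<le> (\<integral>\<^sup>+x. ennreal (K * \<bar>\<Sum>j\<in>J. D j x\<bar> powr p) \<partial>lebesgue)"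
      using bound[OF mono _ G, of "\<lambda>i. \<epsilon> (Suc i)" N] eps by (simp add: G_def)
  qed
qed

section \<open>Square functions over finite boxes of scales\<close>

text \<open>The \<open>p\<close>-th power of the \<open>L\<^sup>p\<close> norm.\<close>
definition pint :: "real \<Rightarrow> ('a::euclidean_space \<Rightarrow> real) \<Rightarrow> ennreal" where
  "pint p f = (\<integral>\<^sup>+x. ennreal (\<bar>f x\<bar> powr p) \<partial>lebesgue)"

text \<open>The difference of one parameter between the scales \<open>a - 1\<close> and \<open>a\<close> is the finer average minus the
  coarser one.\<close>
definition third_diff :: "(int \<Rightarrow> int \<Rightarrow> int \<Rightarrow> real) \<Rightarrow> int \<Rightarrow> int \<Rightarrow> int \<Rightarrow> real" where
  "third_diff g a b c =
     g (a - 1) (b - 1) (c - 1) - g a (b - 1) (c - 1) - (g (a - 1) b (c - 1) - g a b (c - 1))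
     - (g (a - 1) (b - 1) c - g a (b - 1) c - (g (a - 1) b c - g a b c))"

lemma sum_int_telescope:
  fixes g :: "int \<Rightarrow> real"
  assumes "m \<le> n"
  shows "(\<Sum>a\<in>{m<..n}. g (a - 1) - g a) = g m - g n"
  using assms
proof (induction n rule: int_ge_induct)
  case (step i)
  have "{m<..i + 1} = insert (i + 1) {m<..i}" using step by auto
  then show ?case using step by simp
qed simp

lemma sum_third_diff:
  assumes "m \<le> n"
  shows "(\<Sum>a\<in>{m<..n}. \<Sum>b\<in>{m<..n}. \<Sum>c\<in>{m<..n}. third_diff g a b c) =
    g m m m - g n m m - (g m n m - g n n m) - (g m m n - g n m n - (g m n n - g n n n))"
proof -
  have 1: "(\<Sum>c\<in>{m<..n}. third_diff g a b c) =
      g (a - 1) (b - 1) m - g a (b - 1) m - (g (a - 1) b m - g a b m)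
     - (g (a - 1) (b - 1) n - g a (b - 1) n - (g (a - 1) b n - g a b n))" for a b
    unfolding third_diff_def
    by (rule sum_int_telescope[OF assms, of "\<lambda>c. g (a - 1) (b - 1) c - g a (b - 1) c - (g (a - 1) b c - g a b c)"])
  have 2: "(\<Sum>b\<in>{m<..n}. \<Sum>c\<in>{m<..n}. third_diff g a b c) =
     g (a - 1) m m - g a m m - (g (a - 1) m n - g a m n) - (g (a - 1) n m - g a n m - (g (a - 1) n n - g a n n))" for a
    unfolding 1
    using sum_int_telescope[OF assms, of "\<lambda>b. g (a - 1) b m - g a b m - (g (a - 1) b n - g a b n)"]
    by (simp add: algebra_simps sum.distrib sum_subtractf)
  show ?thesis
    unfolding 2
    using sum_int_telescope[OF assms, of "\<lambda>a. g a m m - g a m n - (g a n m - g a n n)"]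
    by (simp add: algebra_simps sum.distrib sum_subtractf)
qed

lemma abs_sum_powr_le:
  fixes t :: "'i \<Rightarrow> real"
  assumes "finite I" "0 \<le> p"
  shows "\<bar>\<Sum>i\<in>I. t i\<bar> powr p \<le> real (card I) powr p * (\<Sum>i\<in>I. \<bar>t i\<bar> powr p)"
proof (cases "I = {}")
  case False
  define M where "M = Max ((\<lambda>i. \<bar>t i\<bar>) ` I)"
  have "M \<in> (\<lambda>i. \<bar>t i\<bar>) ` I" unfolding M_def using False assms by (intro Max_in) auto
  then obtain k where k: "k \<in> I" "M = \<bar>t k\<bar>" by auto
  have "\<bar>\<Sum>i\<in>I. t i\<bar> \<le> (\<Sum>i\<in>I. \<bar>t i\<bar>)" by (rule sum_abs)
  also have "\<dots> \<le> real (card I) * M"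
    using assms by (intro sum_bounded_above) (simp add: M_def)
  finally have "\<bar>\<Sum>i\<in>I. t i\<bar> powr p \<le> (real (card I) * M) powr p"
    using assms by (intro powr_mono2) auto
  also have "\<dots> = real (card I) powr p * \<bar>t k\<bar> powr p"
    by (simp add: k powr_mult)
  also have "\<dots> \<le> real (card I) powr p * (\<Sum>i\<in>I. \<bar>t i\<bar> powr p)"
    using k assms by (intro mult_left_mono member_le_sum) auto
  finally show ?thesis .
qed simp

lemma abs_le_one_plus_powr:
  fixes y :: real
  assumes "1 < p"
  shows "\<bar>y\<bar> \<le> 1 + \<bar>y\<bar> powr p"
proof (cases "\<bar>y\<bar> \<le> 1")
  case False
  then have "\<bar>y\<bar> powr 1 \<le> \<bar>y\<bar> powr p" using assms by (intro powr_mono) auto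
  then show ?thesis by simp
qed (simp add: add_increasing2)

lemma cell_integrable_Lp:
  assumes p: "1 < p" and f: "f \<in> borel_measurable lebesgue" and fin: "pint p f < \<infinity>"
  shows "cell_integrable (\<lambda>x. \<bar>f x\<bar> powr p)" "cell_integrable f"
proof -
  have i: "integrable lebesgue (\<lambda>x. \<bar>f x\<bar> powr p)"
    using f fin by (intro integrableI_bounded) (auto simp: pint_def)
  show fp: "cell_integrable (\<lambda>x. \<bar>f x\<bar> powr p)"
    unfolding cell_integrable_def set_integrable_def
    by (intro allI integrable_mult_indicator i) simp
  show "cell_integrable f"
    unfolding cell_integrable_def
  proof (intro allI)
    fix s x
    have 1: "set_integrable lebesgue (cell s x) (\<lambda>x. 1 + \<bar>f x\<bar> powr p)"
      by (intro cell_integrableD cell_integrable_add fp cell_const_integrable[OF cell_const_const])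
    show "set_integrable lebesgue (cell s x) f"
      by (rule set_integrable_bound[OF 1])
        (use f abs_le_one_plus_powr[OF p] in \<open>auto simp: set_borel_measurable_def\<close>)
  qed
qed

lemma pint_avg_le:
  assumes p: "1 < p" and f: "f \<in> borel_measurable lebesgue" "pint p f < \<infinity>"
  shows "pint p (avg s f) \<le> pint p f"
  unfolding pint_def
proof (rule nn_integral_le_if_avg_le[where s = s])
  have c: "cell_const s (\<lambda>x. \<bar>avg s f x\<bar> powr p)"
    by (rule cell_const_comp[OF cell_const_avg])
  then show "cell_integrable (\<lambda>x. \<bar>avg s f x\<bar> powr p)"
    by (rule cell_const_integrable)
  show "avg s (\<lambda>x. \<bar>avg s f x\<bar> powr p) x \<le> avg s (\<lambda>x. \<bar>f x\<bar> powr p) x" for x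
    using abs_avg_powr_le[OF p] cell_integrable_Lp[OF p f] by (simp add: avg_cell_const[OF c])
qed (use cell_integrable_Lp[OF p f] in auto)

lemma nn_integral_rad_avg:
  assumes "finite A" and [measurable]: "\<And>S. \<phi> S \<in> borel_measurable M" and "\<And>S x. 0 \<le> \<phi> S x"
  shows "(\<integral>\<^sup>+x. ennreal (rad_avg A (\<lambda>S. \<phi> S x)) \<partial>M)
    = ennreal (1 / 2 ^ card A) * (\<Sum>S\<in>Pow A. \<integral>\<^sup>+x. ennreal (\<phi> S x) \<partial>M)"
proof -
  have "(\<integral>\<^sup>+x. ennreal (rad_avg A (\<lambda>S. \<phi> S x)) \<partial>M)
      = (\<integral>\<^sup>+x. ennreal (1 / 2 ^ card A) * (\<Sum>S\<in>Pow A. ennreal (\<phi> S x)) \<partial>M)"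
    using assms by (intro nn_integral_cong)
      (simp add: rad_avg_def sum_ennreal sum_nonneg divide_ennreal_def flip: ennreal_mult'')
  also have "\<dots> = ennreal (1 / 2 ^ card A) * (\<Sum>S\<in>Pow A. \<integral>\<^sup>+x. ennreal (\<phi> S x) \<partial>M)"
    by (subst nn_integral_cmult) (auto simp: nn_integral_sum)
  finally show ?thesis .
qed

lemma ennreal_inverse_pow2_cancel: "ennreal (1 / 2 ^ k) * (of_nat (2 ^ k) * M) = M"
proof -
  have "ennreal (1 / 2 ^ k) * of_nat (2 ^ k) = ennreal (1 / 2 ^ k * real (2 ^ k))"
    unfolding ennreal_of_nat_eq_real_of_nat by (rule ennreal_mult'[symmetric]) simp
  also have "\<dots> = 1" by simp
  finally have "ennreal (1 / 2 ^ k) * of_nat (2 ^ k) = 1" .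
  then show ?thesis by (simp flip: mult.assoc)
qed

lemma nn_integral_rad_avg_bounds:
  assumes "finite A" "\<And>S. \<phi> S \<in> borel_measurable M" "\<And>S x. 0 \<le> \<phi> S x"
  shows "(\<And>S. (\<integral>\<^sup>+x. ennreal (\<phi> S x) \<partial>M) \<le> L) \<Longrightarrow> (\<integral>\<^sup>+x. ennreal (rad_avg A (\<lambda>S. \<phi> S x)) \<partial>M) \<le> L"
    "(\<And>S. L \<le> (\<integral>\<^sup>+x. ennreal (\<phi> S x) \<partial>M)) \<Longrightarrow> L \<le> (\<integral>\<^sup>+x. ennreal (rad_avg A (\<lambda>S. \<phi> S x)) \<partial>M)"
proof -
  have c: "(\<Sum>S\<in>Pow A. L) = of_nat (2 ^ card A) * L" using assms by (simp add: card_Pow)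
  show "(\<integral>\<^sup>+x. ennreal (rad_avg A (\<lambda>S. \<phi> S x)) \<partial>M) \<le> L"
    if "\<And>S. (\<integral>\<^sup>+x. ennreal (\<phi> S x) \<partial>M) \<le> L"
    using mult_left_mono[OF sum_mono[of "Pow A", OF that], of "ennreal (1 / 2 ^ card A)"]
    unfolding nn_integral_rad_avg[OF assms] c ennreal_inverse_pow2_cancel by simp
  show "L \<le> (\<integral>\<^sup>+x. ennreal (rad_avg A (\<lambda>S. \<phi> S x)) \<partial>M)"
    if "\<And>S. L \<le> (\<integral>\<^sup>+x. ennreal (\<phi> S x) \<partial>M)"
    using mult_left_mono[OF sum_mono[of "Pow A", OF that], of "ennreal (1 / 2 ^ card A)"]
    unfolding nn_integral_rad_avg[OF assms] c ennreal_inverse_pow2_cancel by simp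
qed

lemma rad_avg_nonneg: "(\<And>S. 0 \<le> \<phi> S) \<Longrightarrow> 0 \<le> rad_avg A \<phi>"
  by (simp add: rad_avg_def sum_nonneg)

lemma borel_measurable_rad_avg [measurable]:
  "(\<And>S. \<phi> S \<in> borel_measurable M) \<Longrightarrow> (\<lambda>x. rad_avg A (\<lambda>S. \<phi> S x)) \<in> borel_measurable M"
  by (simp add: rad_avg_def)

text \<open>Bounds that hold for every choice of signs pass to the mean over the signs.\<close>
lemma nn_integral_rad_avg3_bounds:
  assumes fin: "finite A" "finite B" "finite C"
    and meas: "\<And>w. \<phi> w \<in> borel_measurable M" and nonneg: "\<And>w x. 0 \<le> \<phi> w x"
  shows "(\<And>w. (\<integral>\<^sup>+x. ennreal (\<phi> w x) \<partial>M) \<le> L) \<Longrightarrow> (\<integral>\<^sup>+x. ennreal (rad_avg3 A B C (\<lambda>w. \<phi> w x)) \<partial>M) \<le> L"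
    "(\<And>w. L \<le> (\<integral>\<^sup>+x. ennreal (\<phi> w x) \<partial>M)) \<Longrightarrow> L \<le> (\<integral>\<^sup>+x. ennreal (rad_avg3 A B C (\<lambda>w. \<phi> w x)) \<partial>M)"
  unfolding rad_avg3_def
  by (intro nn_integral_rad_avg_bounds fin meas nonneg borel_measurable_rad_avg rad_avg_nonneg; assumption)+

lemma ennreal_cube_mult: "0 \<le> K \<Longrightarrow> ennreal K * (ennreal K * (ennreal K * z)) = ennreal (K ^ 3) * z"
  by (simp add: ennreal_mult power3_eq_cube mult.assoc)

lemma pint_diff_le:
  assumes p: "0 \<le> p" and [measurable]: "u \<in> borel_measurable lebesgue" "v \<in> borel_measurable lebesgue"
    and M: "pint p u \<le> M" "pint p v \<le> M"
  shows "pint p (\<lambda>x. u x - v x) \<le> ennreal (2 powr p * 2) * M"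
proof -
  have le: "\<bar>a - b\<bar> powr p \<le> 2 powr p * (\<bar>a\<bar> powr p + \<bar>b\<bar> powr p)" for a b :: real
    using abs_sum_powr_le[of "{True, False}" p "\<lambda>i. if i then a else - b"] p by simp
  have "pint p (\<lambda>x. u x - v x) \<le> (\<integral>\<^sup>+x. ennreal (2 powr p) * (ennreal (\<bar>u x\<bar> powr p) + ennreal (\<bar>v x\<bar> powr p)) \<partial>lebesgue)"
    unfolding pint_def
    by (intro nn_integral_mono) (simp add: le ennreal_leI flip: ennreal_mult ennreal_plus)
  also have "\<dots> = ennreal (2 powr p) * (pint p u + pint p v)"
    unfolding pint_def by (simp add: nn_integral_cmult nn_integral_add)
  also have "\<dots> \<le> ennreal (2 powr p) * (M + M)"
    by (intro mult_left_mono add_mono M) auto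
  also have "\<dots> = ennreal (2 powr p * 2) * M"
    by (simp add: ennreal_mult mult.assoc mult_2)
  finally show ?thesis .
qed

type_synonym 'a grid = "int \<Rightarrow> int \<Rightarrow> int \<Rightarrow> 'a \<Rightarrow> int"

definition delta :: "('a::euclidean_space grid) \<Rightarrow> ('a \<Rightarrow> real) \<Rightarrow> int \<Rightarrow> int \<Rightarrow> int \<Rightarrow> 'a \<Rightarrow> real" where
  "delta sh f a b c x = third_diff (\<lambda>a b c. avg (sh a b c) f x) a b c"

definition box_sum :: "('a::euclidean_space grid) \<Rightarrow> ('a \<Rightarrow> real) \<Rightarrow> int \<Rightarrow> int \<Rightarrow> 'a \<Rightarrow> real" where
  "box_sum sh f m n x = (\<Sum>a\<in>{m<..n}. \<Sum>b\<in>{m<..n}. \<Sum>c\<in>{m<..n}. delta sh f a b c x)"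

definition box_square :: "('a::euclidean_space grid) \<Rightarrow> ('a \<Rightarrow> real) \<Rightarrow> int \<Rightarrow> int \<Rightarrow> 'a \<Rightarrow> real" where
  "box_square sh f m n x = (\<Sum>a\<in>{m<..n}. \<Sum>b\<in>{m<..n}. \<Sum>c\<in>{m<..n}. (delta sh f a b c x)\<^sup>2)"

abbreviation scale_box :: "int \<Rightarrow> int \<Rightarrow> (int \<times> int \<times> int) set" where
  "scale_box m n \<equiv> {m<..n} \<times> {m<..n} \<times> {m<..n}"

abbreviation delta_at :: "'a::euclidean_space grid \<Rightarrow> ('a \<Rightarrow> real) \<Rightarrow> int \<times> int \<times> int \<Rightarrow> 'a \<Rightarrow> real" where
  "delta_at sh f j x \<equiv> (case j of (a, b, c) \<Rightarrow> delta sh f a b c x)"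

abbreviation square_pint :: "real \<Rightarrow> 'a::euclidean_space grid \<Rightarrow> ('a \<Rightarrow> real) \<Rightarrow> int \<Rightarrow> int \<Rightarrow> ennreal" where
  "square_pint p sh f m n \<equiv> (\<integral>\<^sup>+x. ennreal (box_square sh f m n x powr (p / 2)) \<partial>lebesgue)"

lemma avg_measurable [measurable]: "avg s f \<in> borel_measurable lebesgue"
  by (rule lebesgue_measurable_cell_const[OF cell_const_avg])

lemma delta_measurable [measurable]: "delta sh f a b c \<in> borel_measurable lebesgue"
  unfolding delta_def[abs_def] third_diff_def by measurable

text \<open>Three scales determine a shape. The first assumption holds when the side in each direction is a
  monotone function of one of the scales, and it lets averages compose by the maximum of the scales.
  By the \<open>coarse\<close> assumptions each scale bounds some side from below, so that blocks become
  large when any one scale grows. By the last one, blocks shrink to points when all scales decrease.\<close>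
locale tri_grid =
  fixes sh :: "'a::euclidean_space grid"
  assumes sh_max: "b \<in> Basis \<Longrightarrow> max (sh x y z b) (sh x' y' z' b) = sh (max x x') (max y y') (max z z') b"
    and coarse1: "\<exists>b\<in>Basis. \<forall>x y z. x \<le> sh x y z b"
    and coarse2: "\<exists>b\<in>Basis. \<forall>x y z. y \<le> sh x y z b"
    and coarse3: "\<exists>b\<in>Basis. \<forall>x y z. z \<le> sh x y z b"
    and fine: "\<exists>K. \<forall>n\<ge>0. \<forall>b\<in>Basis. sh (- n) (- n) (- n) b \<le> K - n"
begin

lemma sh_mono:
  assumes "b \<in> Basis" "x \<le> x'" "y \<le> y'" "z \<le> z'"
  shows "sh x y z b \<le> sh x' y' z' b"
  using sh_max[OF assms(1), of x y z x' y' z'] assms by (simp add: max_absorb2)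

lemma avg_sh_sh:
  assumes "cell_integrable f"
  shows "avg (sh i j k) (avg (sh a b c) f) x = avg (sh (max i a) (max j b) (max k c)) f x"
proof -
  have "avg (cmax (sh i j k) (sh a b c)) = avg (sh (max i a) (max j b) (max k c))"
    by (rule avg_shape_cong) (rule sh_max)
  then show ?thesis by (simp add: avg_avg[OF assms])
qed

lemma avg_sh_delta:
  assumes f: "cell_integrable f"
  shows "avg (sh i j k) (delta sh f a b c) x
    = third_diff (\<lambda>a b c. avg (sh (max i a) (max j b) (max k c)) f x) a b c"
proof -
  have i: "cell_integrable (avg s f)" for s by (rule cell_const_integrable[OF cell_const_avg])
  show ?thesis
    unfolding delta_def[abs_def] third_diff_def
    by (simp add: avg_diff i cell_integrable_diff avg_sh_sh[OF f])
qed

text \<open>Averaging in one parameter up to scale \<open>i\<close> annihilates the differences of scale at most \<open>i\<close> and fixes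
  the others, while the scale \<open>m\<close> in the other two parameters is too fine to have an effect.\<close>
lemma avg_sh_delta_one:
  assumes f: "cell_integrable f" and m: "m < a" "m < b" "m < c" "m \<le> i"
  shows "avg (sh i m m) (delta sh f a b c) x = (if a \<le> i then 0 else delta sh f a b c x)"
    and "avg (sh m i m) (delta sh f a b c) x = (if b \<le> i then 0 else delta sh f a b c x)"
    and "avg (sh m m i) (delta sh f a b c) x = (if c \<le> i then 0 else delta sh f a b c x)"
  unfolding avg_sh_delta[OF f] delta_def third_diff_def
  using m by (auto simp: max_def)

lemma cell_const_delta:
  assumes "m < a" "m < b" "m < c"
  shows "cell_const (sh m m m) (delta sh f a b c)"
proof -
  have c: "cell_const (sh m m m) (avg (sh a b c) f)" if "m \<le> a" "m \<le> b" "m \<le> c" for a b c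
    by (rule cell_const_coarser[OF cell_const_avg]) (rule sh_mono; use that in simp)
  show ?thesis
    unfolding delta_def[abs_def] third_diff_def
    by (intro cell_const_comp2[where h="(-)"] c) (use assms in auto)
qed

lemma box_sum_alt:
  assumes "m \<le> n"
  shows "box_sum sh f m n x =
    avg (sh m m m) f x - avg (sh n m m) f x - (avg (sh m n m) f x - avg (sh n n m) f x)
    - (avg (sh m m n) f x - avg (sh n m n) f x - (avg (sh m n n) f x - avg (sh n n n) f x))"
  unfolding box_sum_def delta_def by (rule sum_third_diff[OF assms])

text \<open>The sum telescopes to eight averages, each of norm at most that of \<open>f\<close>.\<close>
lemma pint_box_sum_le:
  assumes p: "1 < p" and f: "f \<in> borel_measurable lebesgue" "pint p f < \<infinity>" and mn: "m \<le> n"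
  shows "pint p (box_sum sh f m n) \<le> ennreal ((2 powr p * 2) ^ 3) * pint p f"
proof -
  have M: "pint p (avg s f) \<le> pint p f" for s by (rule pint_avg_le[OF p f])
  have "pint p (\<lambda>x. avg (sh m m m) f x - avg (sh n m m) f x - (avg (sh m n m) f x - avg (sh n n m) f x)
    - (avg (sh m m n) f x - avg (sh n m n) f x - (avg (sh m n n) f x - avg (sh n n n) f x)))
    \<le> ennreal (2 powr p * 2) * (ennreal (2 powr p * 2) * (ennreal (2 powr p * 2) * pint p f))"
    using p by (intro pint_diff_le M borel_measurable_diff avg_measurable) auto
  then show ?thesis
    unfolding box_sum_alt[OF mn, abs_def]
    by (subst (asm) ennreal_cube_mult) auto
qed

end

text \<open>\<open>\<pi>\<close> selects the parameter on whose scale the sign depends. The constant is chosen before the grid,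
  so it is the same for all grids.\<close>
lemma sign_change_box:
  assumes p: "1 < p"
  shows "\<exists>K. 0 < K \<and> (\<forall>(sh :: 'a::euclidean_space grid) f m n \<theta> S. tri_grid sh \<longrightarrow> cell_integrable f \<longrightarrow> m \<le> n \<longrightarrow> (\<forall>\<pi>\<in>{fst, fst \<circ> snd, snd \<circ> snd}.
      pint p (\<lambda>x. \<Sum>j\<in>scale_box m n. sgn_of S (\<pi> j) * (\<theta> j * delta_at sh f j x))
      \<le> ennreal K * pint p (\<lambda>x. \<Sum>j\<in>scale_box m n. \<theta> j * delta_at sh f j x)))"
proof -
  obtain K where K: "0 < K" and bound: "\<And>(\<sigma> :: nat \<Rightarrow> 'a \<Rightarrow> int) \<epsilon> D (J :: (int \<times> int \<times> int) set) r N.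
    (\<forall>i. \<forall>b\<in>Basis. \<sigma> i b \<le> \<sigma> (Suc i) b) \<Longrightarrow> (\<forall>i. \<epsilon> i \<in> {1, -1}) \<Longrightarrow> finite J \<Longrightarrow>
    (\<forall>j\<in>J. cell_const (\<sigma> 0) (D j)) \<Longrightarrow> (\<forall>j\<in>J. r j \<in> {1..N}) \<Longrightarrow>
    (\<forall>j\<in>J. \<forall>i\<le>N. \<forall>x. avg (\<sigma> i) (D j) x = (if r j \<le> i then 0 else D j x)) \<Longrightarrow>
    (\<integral>\<^sup>+x. ennreal (\<bar>\<Sum>j\<in>J. \<epsilon> (r j) * D j x\<bar> powr p) \<partial>lebesgue)
      \<le> (\<integral>\<^sup>+x. ennreal (K * \<bar>\<Sum>j\<in>J. D j x\<bar> powr p) \<partial>lebesgue)"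
    using sign_change_bound[OF p, where 'a='a and 'j="int \<times> int \<times> int"] by blast
  have main: "pint p (\<lambda>x. \<Sum>j\<in>J. sgn_of S (\<pi> j) * (\<theta> j * delta_at sh f j x))
      \<le> ennreal K * pint p (\<lambda>x. \<Sum>j\<in>J. \<theta> j * delta_at sh f j x)"
    if grid: "tri_grid sh" and f: "cell_integrable f" and mn: "m \<le> n" and J: "J = scale_box m n"
      and \<sigma>: "(\<pi>, \<sigma>) \<in> {(fst, \<lambda>i. sh i m m), (fst \<circ> snd, \<lambda>i. sh m i m), (snd \<circ> snd, \<lambda>i. sh m m i)}"
    for sh f m n \<theta> S J \<pi> and \<sigma> :: "int \<Rightarrow> 'a \<Rightarrow> int"
  proof -
    interpret tri_grid sh by (rule grid)
    define D where "D = (\<lambda>j x. \<theta> j * delta_at sh f j x)"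
    define r where "r = (\<lambda>j. nat (\<pi> j - m))"
    define N where "N = nat (n - m)"
    have \<pi>: "\<pi> j \<in> {m<..n}" if "j \<in> J" for j using \<sigma> that by (auto simp: J)
    have sm: "\<sigma> m = sh m m m" using \<sigma> by auto
    have D0: "cell_const (\<sigma> (m + int 0)) (D j)" if "j \<in> J" for j
    proof -
      obtain a b c where j: "j = (a, b, c)" by (cases j)
      have "cell_const (sh m m m) (\<lambda>x. \<theta> (a, b, c) * delta sh f a b c x)"
        by (rule cell_const_comp[OF cell_const_delta]) (use that in \<open>auto simp: J j\<close>)
      then show ?thesis by (simp add: D_def j sm)
    qed
    have avD: "avg (\<sigma> (m + int i)) (D j) x = (if r j \<le> i then 0 else D j x)" if "j \<in> J" for i j x
    proof -
      obtain a b c where j: "j = (a, b, c)" by (cases j)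
      have abc: "m < a" "m < b" "m < c" using that by (auto simp: J j)
      have "avg (\<sigma> (m + int i)) (delta sh f a b c) x = (if r j \<le> i then 0 else delta sh f a b c x)"
        using \<sigma> avg_sh_delta_one[OF f abc, of "m + int i" x] abc by (auto simp: j r_def nat_le_iff)
      then show ?thesis by (simp add: D_def j avg_cmult)
    qed
    have "(\<integral>\<^sup>+x. ennreal (\<bar>\<Sum>j\<in>J. sgn_of S (m + int (r j)) * D j x\<bar> powr p) \<partial>lebesgue)
      \<le> (\<integral>\<^sup>+x. ennreal (K * \<bar>\<Sum>j\<in>J. D j x\<bar> powr p) \<partial>lebesgue)"
    proof (rule bound[of "\<lambda>i. \<sigma> (m + int i)" "\<lambda>i. sgn_of S (m + int i)" J D r N])
      show "\<forall>i. \<forall>b\<in>Basis. \<sigma> (m + int i) b \<le> \<sigma> (m + int (Suc i)) b"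
        using \<sigma> by (auto intro!: sh_mono)
      show "\<forall>i. sgn_of S (m + int i) \<in> {1, -1}" by (simp add: sgn_of_def)
      show "finite J" by (simp add: J)
      show "\<forall>j\<in>J. r j \<in> {1..N}" using \<pi> by (fastforce simp: r_def N_def)
    qed (use D0 avD in blast)+
    also have "(\<integral>\<^sup>+x. ennreal (K * \<bar>\<Sum>j\<in>J. D j x\<bar> powr p) \<partial>lebesgue) = ennreal K * pint p (\<lambda>x. \<Sum>j\<in>J. D j x)"
    proof -
      have "cell_const (\<sigma> (m + int 0)) (\<lambda>x. \<Sum>j\<in>J. D j x)"
        by (intro cell_const_sum D0)
      then have [measurable]: "(\<lambda>x. \<Sum>j\<in>J. D j x) \<in> borel_measurable lebesgue"
        by (rule lebesgue_measurable_cell_const)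
      show ?thesis using K by (simp add: pint_def ennreal_mult' nn_integral_cmult)
    qed
    finally have "(\<integral>\<^sup>+x. ennreal (\<bar>\<Sum>j\<in>J. sgn_of S (m + int (r j)) * D j x\<bar> powr p) \<partial>lebesgue)
      \<le> ennreal K * pint p (\<lambda>x. \<Sum>j\<in>J. D j x)" .
    moreover have "(\<Sum>j\<in>J. sgn_of S (m + int (r j)) * D j x) = (\<Sum>j\<in>J. sgn_of S (\<pi> j) * D j x)" for x
    proof (rule sum.cong)
      fix j assume "j \<in> J"
      then have "m + int (r j) = \<pi> j" using \<pi>[of j] by (simp add: r_def)
      then show "sgn_of S (m + int (r j)) * D j x = sgn_of S (\<pi> j) * D j x" by simp
    qed simp
    ultimately show ?thesis by (simp add: pint_def D_def)
  qed
  show ?thesis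
    by (rule exI[of _ K]) (auto simp: K simp del: comp_apply intro: main)
qed

text \<open>Three sign changes lead from the plain sum to the chaos with any given signs, and repeating
  them leads back. So the plain sum is comparable to each chaos, hence to the mean over the signs
  of the \<open>p\<close>-th powers, which Khintchine's inequality evaluates pointwise.\<close>
theorem box_square_equivalence:
  assumes p: "1 < p"
  shows "\<exists>K. 0 < K \<and> (\<forall>(sh :: 'a::euclidean_space grid) f m n. tri_grid sh \<longrightarrow> cell_integrable f \<longrightarrow> m \<le> n \<longrightarrow>
    square_pint p sh f m n \<le> ennreal K * pint p (box_sum sh f m n) \<and>
    pint p (box_sum sh f m n) \<le> ennreal K * square_pint p sh f m n)"
proof -
  obtain K where K: "0 < K" and sc: "\<And>(sh :: 'a grid) f m n \<theta> S \<pi>. tri_grid sh \<Longrightarrow> cell_integrable f \<Longrightarrow> m \<le> n \<Longrightarrow>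
      \<pi> \<in> {fst, fst \<circ> snd, snd \<circ> snd} \<Longrightarrow>
      pint p (\<lambda>x. \<Sum>j\<in>scale_box m n. sgn_of S (\<pi> j) * (\<theta> j * delta_at sh f j x))
      \<le> ennreal K * pint p (\<lambda>x. \<Sum>j\<in>scale_box m n. \<theta> j * delta_at sh f j x)"
    using sign_change_box[OF p, where 'a='a] by blast
  obtain c D where cD: "0 < c" "0 < D" and kh: "\<And>(A :: int set) (B :: int set) (C :: int set) x.
      finite A \<Longrightarrow> finite B \<Longrightarrow> finite C \<Longrightarrow>
    c * (sum_squares A B C x) powr (p / 2) \<le> rad_avg3 A B C (\<lambda>w. \<bar>rad_chaos A B C x w\<bar> powr p) \<and>
    rad_avg3 A B C (\<lambda>w. \<bar>rad_chaos A B C x w\<bar> powr p) \<le> D * (sum_squares A B C x) powr (p / 2)"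
    using khintchine3[where p=p and 'a=int and 'b=int and 'c=int] p by auto
  define L where "L = max (K ^ 3 / c) (K ^ 3 * D)"
  have L: "K ^ 3 / c \<le> L" "K ^ 3 * D \<le> L" "0 < L" using K cD by (auto simp: L_def less_max_iff_disj)
  show ?thesis
  proof (rule exI[of _ L], intro conjI allI impI L(3))
    fix sh :: "'a grid" and f :: "'a \<Rightarrow> real" and m n :: int
    assume grid: "tri_grid sh" and f: "cell_integrable f" and mn: "m \<le> n"
    define A where "A = {m<..n}"
    have A: "finite A" by (simp add: A_def)
    define F where "F = (\<lambda>\<theta> x. \<Sum>j\<in>A \<times> A \<times> A. \<theta> j * delta_at sh f j x)"
    define W where "W = (\<lambda>w x. rad_chaos A A A (\<lambda>a b c. delta sh f a b c x) w)"
    define sq where "sq = (\<lambda>x. box_square sh f m n x powr (p / 2))"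
    have sq0: "0 \<le> sq x" for x by (simp add: sq_def)
    have sqm [measurable]: "sq \<in> borel_measurable lebesgue"
      unfolding sq_def box_square_def by measurable
    have Wm [measurable]: "W w \<in> borel_measurable lebesgue" for w
      unfolding W_def rad_chaos_def by (cases w) simp
    have sc': "pint p (F (\<lambda>j. sgn_of S (\<pi> j) * \<theta> j)) \<le> ennreal K * pint p (F \<theta>)"
      if "\<pi> \<in> {fst, fst \<circ> snd, snd \<circ> snd}" for \<theta> S \<pi>
      using sc[OF grid f mn that, of S \<theta>] by (simp add: F_def A_def mult.assoc)
    have K3: "ennreal K * (ennreal K * (ennreal K * z)) = ennreal (K ^ 3) * z" for z
      using K by (intro ennreal_cube_mult) simp
    have sc3: "pint p (F (\<lambda>j. sgn_of S (fst j) * (sgn_of T (fst (snd j)) * (sgn_of U (snd (snd j)) * \<theta> j))))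
        \<le> ennreal (K ^ 3) * pint p (F \<theta>)" for S T U \<theta>
    proof -
      have "pint p (F (\<lambda>j. sgn_of S (fst j) * (sgn_of T (fst (snd j)) * (sgn_of U (snd (snd j)) * \<theta> j))))
        \<le> ennreal K * pint p (F (\<lambda>j. sgn_of T (fst (snd j)) * (sgn_of U (snd (snd j)) * \<theta> j)))"
        by (rule sc') simp
      also have "\<dots> \<le> ennreal K * (ennreal K * pint p (F (\<lambda>j. sgn_of U (snd (snd j)) * \<theta> j)))"
        using sc'[of "fst \<circ> snd" T] by (intro mult_left_mono) auto
      also have "\<dots> \<le> ennreal K * (ennreal K * (ennreal K * pint p (F \<theta>)))"
        using sc'[of "snd \<circ> snd" U] by (intro mult_left_mono) auto
      finally show ?thesis unfolding K3 .
    qed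
    have F1: "F (\<lambda>_. 1) = box_sum sh f m n"
      by (simp add: F_def box_sum_def A_def sum.cartesian_product case_prod_beta fun_eq_iff)
    have FW: "F (\<lambda>j. sgn_of S (fst j) * (sgn_of T (fst (snd j)) * (sgn_of U (snd (snd j)) * 1))) = W (S, T, U)" for S T U
      by (simp add: F_def W_def rad_chaos_def sum.cartesian_product case_prod_beta fun_eq_iff mult.assoc)
    have up: "pint p (W w) \<le> ennreal (K ^ 3) * pint p (box_sum sh f m n)" for w
      using sc3[of "fst w" "fst (snd w)" "snd (snd w)" "\<lambda>_. 1"] unfolding FW F1 by simp
    have lo: "pint p (box_sum sh f m n) \<le> ennreal (K ^ 3) * pint p (W w)" for w
    proof -
      obtain S T U where w: "w = (S, T, U)" by (cases w)
      have "sgn_of S a * (sgn_of T b * (sgn_of U c * (sgn_of S a * (sgn_of T b * (sgn_of U c * 1))))) = 1" for a b c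
        by (simp add: sgn_of_def)
      then show ?thesis
        using sc3[of S T U "\<lambda>j. sgn_of S (fst j) * (sgn_of T (fst (snd j)) * (sgn_of U (snd (snd j)) * 1))"]
        unfolding FW w by (simp add: F1)
    qed
    have k1: "c * sq x \<le> rad_avg3 A A A (\<lambda>w. \<bar>W w x\<bar> powr p)"
      and k2: "rad_avg3 A A A (\<lambda>w. \<bar>W w x\<bar> powr p) \<le> D * sq x" for x
      using kh[OF A A A, of "\<lambda>a b c. delta sh f a b c x"] by (simp_all add: sq_def W_def box_square_def A_def)
    have "ennreal c * (\<integral>\<^sup>+x. ennreal (sq x) \<partial>lebesgue) = (\<integral>\<^sup>+x. ennreal (c * sq x) \<partial>lebesgue)"
      using cD sq0 by (simp add: ennreal_mult nn_integral_cmult)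
    also have "\<dots> \<le> (\<integral>\<^sup>+x. ennreal (rad_avg3 A A A (\<lambda>w. \<bar>W w x\<bar> powr p)) \<partial>lebesgue)"
      by (intro nn_integral_mono ennreal_leI k1)
    also have "\<dots> \<le> ennreal (K ^ 3) * pint p (box_sum sh f m n)"
      by (rule nn_integral_rad_avg3_bounds(1)[OF A A A]) (use up in \<open>simp_all add: pint_def\<close>)
    finally have 1: "ennreal c * (\<integral>\<^sup>+x. ennreal (sq x) \<partial>lebesgue) \<le> ennreal (K ^ 3) * pint p (box_sum sh f m n)" .
    have "(\<integral>\<^sup>+x. ennreal (sq x) \<partial>lebesgue) = ennreal (1 / c) * (ennreal c * (\<integral>\<^sup>+x. ennreal (sq x) \<partial>lebesgue))"
      using cD by (simp flip: mult.assoc ennreal_mult)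
    also have "\<dots> \<le> ennreal (1 / c) * (ennreal (K ^ 3) * pint p (box_sum sh f m n))"
      by (intro mult_left_mono 1) simp
    also have "\<dots> = ennreal (K ^ 3 / c) * pint p (box_sum sh f m n)"
      using cD K by (simp add: mult.commute flip: mult.assoc ennreal_mult)
    also have "\<dots> \<le> ennreal L * pint p (box_sum sh f m n)"
      by (intro mult_right_mono ennreal_leI L) simp
    finally show "square_pint p sh f m n \<le> ennreal L * pint p (box_sum sh f m n)"
      by (simp add: sq_def)
    have "pint p (box_sum sh f m n) \<le> (\<integral>\<^sup>+x. ennreal (rad_avg3 A A A (\<lambda>w. K ^ 3 * \<bar>W w x\<bar> powr p)) \<partial>lebesgue)"
      by (rule nn_integral_rad_avg3_bounds(2)[OF A A A])
        (use lo K in \<open>simp_all add: pint_def ennreal_mult nn_integral_cmult\<close>)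
    also have "\<dots> \<le> (\<integral>\<^sup>+x. ennreal (K ^ 3 * D * sq x) \<partial>lebesgue)"
      unfolding rad_avg3_def rad_avg_cmult using k2 K
      by (intro nn_integral_mono ennreal_leI) (simp add: rad_avg3_def mult.assoc)
    also have "\<dots> = ennreal (K ^ 3 * D) * (\<integral>\<^sup>+x. ennreal (sq x) \<partial>lebesgue)"
      using cD K sq0 by (simp add: ennreal_mult nn_integral_cmult)
    also have "\<dots> \<le> ennreal L * (\<integral>\<^sup>+x. ennreal (sq x) \<partial>lebesgue)"
      by (intro mult_right_mono ennreal_leI L) simp
    finally show "pint p (box_sum sh f m n) \<le> ennreal L * square_pint p sh f m n"
      by (simp add: sq_def)
  qed
qed

section \<open>Limits at coarse and fine scales\<close>

lemma nn_integral_limit_le: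
  assumes [measurable]: "\<And>n :: nat. g n \<in> borel_measurable M"
    and lim: "AE x in M. (\<lambda>n. g n x) \<longlonglongrightarrow> h x" and le: "\<And>n. (\<integral>\<^sup>+x. g n x \<partial>M) \<le> C"
  shows "(\<integral>\<^sup>+x. h x \<partial>M) \<le> C"
proof -
  have "(\<integral>\<^sup>+x. h x \<partial>M) \<le> (\<integral>\<^sup>+x. liminf (\<lambda>n. g n x) \<partial>M)"
    using lim by (intro nn_integral_mono_AE) (auto elim!: eventually_mono simp: lim_imp_Liminf)
  also have "\<dots> \<le> liminf (\<lambda>n. \<integral>\<^sup>+x. g n x \<partial>M)" by (rule nn_integral_liminf) simp
  also have "\<dots> \<le> liminf (\<lambda>n. C)" by (intro Liminf_mono always_eventually allI le)
  also have "\<dots> = C" by (simp add: Liminf_const)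
  finally show ?thesis .
qed

lemma cell_vol_lower:
  assumes b0: "b0 \<in> Basis" and le: "\<And>b. b \<in> Basis \<Longrightarrow> s0 b \<le> s b" and k: "k \<le> s b0"
  shows "2 powi k * (\<Prod>b\<in>Basis - {b0}. 2 powi s0 b) \<le> cell_vol s"
proof -
  have "2 powi k * (\<Prod>b\<in>Basis - {b0}. 2 powi s0 b) \<le> 2 powi s b0 * (\<Prod>b\<in>Basis - {b0}. (2::real) powi s b)"
    using le k by (intro mult_mono prod_mono) (auto intro!: power_int_increasing prod_nonneg)
  also have "\<dots> = cell_vol s"
    unfolding cell_vol_def using b0 by (simp add: prod.remove)
  finally show ?thesis .
qed

text \<open>By Jensen's inequality \<open>\<bar>avg (s n) f x\<bar>\<^sup>p\<close> is at most the integral of \<open>\<bar>f\<bar>\<^sup>p\<close> divided by the volume of the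
  cell. One side grows without bound, and the shape \<open>s0\<close> keeps the other sides from shrinking.\<close>
lemma avg_tendsto_0:
  assumes p: "1 < p" and f: "f \<in> borel_measurable lebesgue" "pint p f < \<infinity>"
    and b0: "b0 \<in> Basis" and le: "\<And>n b. b \<in> Basis \<Longrightarrow> s0 b \<le> s n b" and k: "\<And>n. m + int n \<le> s n b0"
  shows "(\<lambda>n. avg (s n) f x) \<longlonglongrightarrow> 0"
proof -
  define w where "w = (\<Prod>b\<in>Basis - {b0}. (2::real) powi s0 b)"
  have w: "0 < w" by (auto simp: w_def intro!: prod_pos)
  define P where "P = enn2real (pint p f)"
  have P: "pint p f = ennreal P" "0 \<le> P" using f by (auto simp: P_def)
  note i = cell_integrable_Lp[OF p f]
  have bound: "\<bar>avg (s n) f x\<bar> powr p \<le> P / (2 powi m * w) * (1/2) ^ n" for n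
  proof -
    have v: "2 powi (m + int n) * w \<le> cell_vol (s n)"
      unfolding w_def by (rule cell_vol_lower[of b0 s0 "s n"]) (use b0 le k in auto)
    have "ennreal (cell_vol (s n) * avg (s n) (\<lambda>x. \<bar>f x\<bar> powr p) x) \<le> ennreal P"
      unfolding P(1)[symmetric] pint_def set_nn_integral_cell[OF i(1) powr_ge_zero, symmetric]
      by (intro nn_integral_mono) (auto split: split_indicator)
    then have "cell_vol (s n) * avg (s n) (\<lambda>x. \<bar>f x\<bar> powr p) x \<le> P" using P by (simp add: ennreal_le_iff)
    then have "avg (s n) (\<lambda>x. \<bar>f x\<bar> powr p) x \<le> P / cell_vol (s n)"
      using cell_vol_pos[of "s n"] by (simp add: field_simps)
    also have "\<dots> \<le> P / (2 powi (m + int n) * w)"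
      using v P w by (intro divide_left_mono) (auto intro!: mult_pos_pos cell_vol_pos)
    also have "\<dots> = P / (2 powi m * w) * (1/2) ^ n"
      by (simp add: power_int_add power_one_over divide_simps)
    finally show ?thesis using abs_avg_powr_le[OF p i(2,1), of "s n" x] by linarith
  qed
  have "(\<lambda>n. P / (2 powi m * w) * (1/2) ^ n) \<longlonglongrightarrow> P / (2 powi m * w) * 0"
    by (intro tendsto_mult tendsto_const LIMSEQ_power_zero) simp
  then have "(\<lambda>n. \<bar>avg (s n) f x\<bar> powr p) \<longlonglongrightarrow> 0"
    using bound by (intro tendsto_sandwich[of "\<lambda>_. 0" "\<lambda>n. \<bar>avg (s n) f x\<bar> powr p" sequentially "\<lambda>n. P / (2 powi m * w) * (1/2) ^ n"]) auto
  then have "(\<lambda>n. (\<bar>avg (s n) f x\<bar> powr p) powr (1 / p)) \<longlonglongrightarrow> 0 powr (1 / p)"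
    using p by (intro tendsto_powr') auto
  then have "(\<lambda>n. \<bar>avg (s n) f x\<bar>) \<longlonglongrightarrow> 0"
    using p by (simp add: powr_powr)
  then show ?thesis by (simp add: tendsto_rabs_zero_iff)
qed

text \<open>The sides tend to zero, at least as fast as \<open>2\<^sup>-\<^sup>k\<close> and uniformly in the directions.\<close>
definition fine_seq :: "(nat \<Rightarrow> 'a::euclidean_space \<Rightarrow> int) \<Rightarrow> bool" where
  "fine_seq s \<longleftrightarrow> (\<exists>K. \<forall>k. \<forall>b\<in>Basis. s k b \<le> K - int k)"

lemma cell_diam:
  assumes "y \<in> cell s x" "b \<in> Basis"
  shows "\<bar>(y - x) \<bullet> b\<bar> \<le> 2 powi s b"
proof -
  define i where "i = cell_idx s x b"
  have "cell_idx s y b = i" "cell_idx s x b = i" using assms by (auto simp: cell_def i_def)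
  then show ?thesis
    unfolding cell_idx_eq_iff by (simp add: inner_diff_left algebra_simps abs_le_iff)
qed

lemma eventually_cell_subset:
  assumes s: "fine_seq s" and U: "open U" "x \<in> U"
  shows "eventually (\<lambda>k. cell (s k) x \<subseteq> U) sequentially"
proof -
  obtain K where K: "\<And>k b. b \<in> Basis \<Longrightarrow> s k b \<le> K - int k" using s by (auto simp: fine_seq_def)
  obtain e where e: "0 < e" "ball x e \<subseteq> U" using U by (auto simp: open_contains_ball)
  have "(\<lambda>k. real DIM('a) * (2 powi K * (1/2) ^ k)) \<longlonglongrightarrow> real DIM('a) * (2 powi K * 0)"
    by (intro tendsto_mult tendsto_const LIMSEQ_power_zero) simp
  then have "eventually (\<lambda>k. real DIM('a) * (2 powi K * (1/2) ^ k) < e) sequentially"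
    using e by (intro order_tendstoD(2)) auto
  then show ?thesis
  proof eventually_elim
    case (elim k)
    show ?case
    proof
      fix y assume y: "y \<in> cell (s k) x"
      have "norm (y - x) \<le> (\<Sum>b\<in>Basis. \<bar>(y - x) \<bullet> b\<bar>)" by (rule norm_le_l1)
      also have "\<dots> \<le> (\<Sum>b\<in>(Basis :: 'a set). 2 powi (K - int k))"
        by (intro sum_mono order_trans[OF cell_diam[OF y]] power_int_increasing K) auto
      also have "\<dots> = real DIM('a) * (2 powi K * (1/2) ^ k)"
        by (simp add: power_int_diff power_one_over divide_simps)
      also have "\<dots> < e" by (rule elim)
      finally show "y \<in> U" using e by (auto simp: dist_norm norm_minus_commute)
    qed
  qed
qed

lemma integrable_cell_integrable: "integrable lebesgue g \<Longrightarrow> cell_integrable g"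
  unfolding cell_integrable_def set_integrable_def
  by (intro allI integrable_mult_indicator) auto

lemma abs_avg_le:
  assumes "cell_integrable g" shows "\<bar>avg s g x\<bar> \<le> avg s (\<lambda>x. \<bar>g x\<bar>) x"
proof -
  have a: "cell_integrable (\<lambda>x. \<bar>g x\<bar>)"
    using assms by (auto simp: cell_integrable_def intro: set_integrable_abs)
  have "avg s g x \<le> avg s (\<lambda>x. \<bar>g x\<bar>) x" by (intro avg_mono assms a) simp
  moreover have "avg s (\<lambda>x. (-1) * g x) x \<le> avg s (\<lambda>x. \<bar>g x\<bar>) x"
    by (intro avg_mono cell_integrable_cmult assms a) simp
  ultimately show ?thesis unfolding avg_cmult by simp
qed

lemma nn_integral_avg:
  assumes g: "cell_integrable g" "\<And>x. 0 \<le> g x"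
  shows "(\<integral>\<^sup>+x. ennreal (avg s g x) \<partial>lebesgue) = (\<integral>\<^sup>+x. ennreal (g x) \<partial>lebesgue)"
proof -
  have a: "0 \<le> avg s g x" for x
    using avg_mono[of "\<lambda>_. 0" g s x] g cell_const_integrable[OF cell_const_const[of s 0]] by simp
  have i: "cell_integrable (avg s g)" by (rule cell_const_integrable[OF cell_const_avg])
  have e: "avg s (avg s g) x = avg s g x" for x by (rule avg_cell_const) simp
  show ?thesis
    by (intro antisym nn_integral_le_if_avg_le[where s = s] g a i) (simp_all add: e)
qed

lemma integrable_avg:
  assumes g: "integrable lebesgue g"
  shows "integrable lebesgue (avg s g)" "(\<integral>x. \<bar>avg s g x\<bar> \<partial>lebesgue) \<le> (\<integral>x. \<bar>g x\<bar> \<partial>lebesgue)"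
proof -
  have a: "cell_integrable (\<lambda>x. \<bar>g x\<bar>)" using g by (intro integrable_cell_integrable) simp
  have "(\<integral>\<^sup>+x. ennreal \<bar>avg s g x\<bar> \<partial>lebesgue) \<le> (\<integral>\<^sup>+x. ennreal (avg s (\<lambda>x. \<bar>g x\<bar>) x) \<partial>lebesgue)"
    by (intro nn_integral_mono ennreal_leI abs_avg_le integrable_cell_integrable g)
  also have "\<dots> = (\<integral>\<^sup>+x. ennreal \<bar>g x\<bar> \<partial>lebesgue)" by (rule nn_integral_avg[OF a]) simp
  also have "\<dots> = ennreal (\<integral>x. \<bar>g x\<bar> \<partial>lebesgue)" using g by (intro nn_integral_eq_integral) auto
  finally have le: "(\<integral>\<^sup>+x. ennreal \<bar>avg s g x\<bar> \<partial>lebesgue) \<le> ennreal (\<integral>x. \<bar>g x\<bar> \<partial>lebesgue)" .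
  have m: "avg s g \<in> borel_measurable lebesgue" by (rule lebesgue_measurable_cell_const[OF cell_const_avg])
  show i: "integrable lebesgue (avg s g)"
    using le m by (intro integrableI_bounded) (auto intro: le_less_trans)
  have "(\<integral>\<^sup>+x. ennreal \<bar>avg s g x\<bar> \<partial>lebesgue) = ennreal (\<integral>x. \<bar>avg s g x\<bar> \<partial>lebesgue)"
    using i by (intro nn_integral_eq_integral) auto
  with le show "(\<integral>x. \<bar>avg s g x\<bar> \<partial>lebesgue) \<le> (\<integral>x. \<bar>g x\<bar> \<partial>lebesgue)"
    by (simp add: ennreal_le_iff)
qed

lemma tendsto_0_if_approx:
  fixes u :: "nat \<Rightarrow> real"
  assumes "\<And>k. 0 \<le> u k" and ap: "\<And>e. 0 < e \<Longrightarrow> \<exists>v. v \<longlonglongrightarrow> 0 \<and> (\<forall>k. u k \<le> v k + e)"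
  shows "u \<longlonglongrightarrow> 0"
proof (rule order_tendstoI)
  fix e :: real assume "0 < e"
  then obtain v where v: "v \<longlonglongrightarrow> 0" "\<And>k. u k \<le> v k + e / 2" using ap[of "e/2"] by auto
  have "eventually (\<lambda>k. v k < e / 2) sequentially" using v \<open>0 < e\<close> by (intro order_tendstoD(2)) auto
  then show "eventually (\<lambda>k. u k < e) sequentially"
  proof eventually_elim
    case (elim k) then show ?case using v(2)[of k] by linarith
  qed
qed (use assms(1) in \<open>auto intro!: always_eventually less_le_trans[of _ 0]\<close>)

abbreviation L1_err :: "('a::euclidean_space \<Rightarrow> int) \<Rightarrow> ('a \<Rightarrow> real) \<Rightarrow> real" where
  "L1_err s g \<equiv> (\<integral>x. \<bar>avg s g x - g x\<bar> \<partial>lebesgue)"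

lemma L1_dist_avg_le:
  assumes g: "integrable lebesgue g" and h: "integrable lebesgue h"
  shows "L1_err s g \<le> L1_err s h + 2 * (\<integral>x. \<bar>g x - h x\<bar> \<partial>lebesgue)"
proof -
  note i = integrable_avg(1)[OF g] integrable_avg(1)[OF h]
  have d: "integrable lebesgue (\<lambda>x. g x - h x)" using g h by simp
  have e: "avg s (\<lambda>x. g x - h x) x = avg s g x - avg s h x" for x
    by (intro avg_diff integrable_cell_integrable g h)
  have "L1_err s g
    \<le> (\<integral>x. \<bar>avg s h x - h x\<bar> + (\<bar>avg s (\<lambda>x. g x - h x) x\<bar> + \<bar>g x - h x\<bar>) \<partial>lebesgue)"
  proof (rule integral_mono)
    fix x
    show "\<bar>avg s g x - g x\<bar> \<le> \<bar>avg s h x - h x\<bar> + (\<bar>avg s (\<lambda>x. g x - h x) x\<bar> + \<bar>g x - h x\<bar>)"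
      unfolding e by linarith
  qed (use g h i integrable_avg(1)[OF d] in auto)
  also have "\<dots> = L1_err s h + ((\<integral>x. \<bar>avg s (\<lambda>x. g x - h x) x\<bar> \<partial>lebesgue) + (\<integral>x. \<bar>g x - h x\<bar> \<partial>lebesgue))"
    using g h i integrable_avg(1)[OF d] by simp
  also have "\<dots> \<le> L1_err s h + ((\<integral>x. \<bar>g x - h x\<bar> \<partial>lebesgue) + (\<integral>x. \<bar>g x - h x\<bar> \<partial>lebesgue))"
    by (intro add_left_mono add_right_mono integrable_avg(2)[OF d])
  finally show ?thesis by simp
qed

text \<open>Averaging preserves the integral of the indicator, so the mass that leaves \<open>U\<close> equals the mass missing
  inside, and the distance is twice the latter. Inside an open set the averages are eventually equal
  to one at each point.\<close>
lemma L1_dist_avg_open: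
  fixes U :: "'a::euclidean_space set"
  assumes s: "fine_seq s" and U: "open U" "emeasure lebesgue U < \<infinity>"
  shows "(\<lambda>k. \<integral>x. \<bar>avg (s k) (indicat_real U) x - indicat_real U x\<bar> \<partial>lebesgue) \<longlonglongrightarrow> 0"
proof -
  let ?I = "indicat_real U"
  have Um [measurable]: "U \<in> sets lebesgue" using U by simp
  have I: "integrable lebesgue ?I" using U Um by (simp add: less_top[symmetric])
  note Ic = integrable_cell_integrable[OF I]
  have c: "cell_integrable (\<lambda>_ :: 'a. c)" for c :: real
    by (rule cell_const_integrable[of "\<lambda>_. 0", OF cell_const_const])
  have b: "0 \<le> avg s ?I x" "avg s ?I x \<le> 1" for s x
    using avg_mono[OF c Ic, of 0 s x] avg_mono[OF Ic c, of 1 s x] by (auto simp: indicator_def)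
  note ia = integrable_avg(1)[OF I]
  have eq: "(\<integral>x. avg s ?I x \<partial>lebesgue) = (\<integral>x. ?I x \<partial>lebesgue)" for s
  proof -
    have "ennreal (\<integral>x. avg s ?I x \<partial>lebesgue) = ennreal (\<integral>x. ?I x \<partial>lebesgue)"
      using nn_integral_avg[OF Ic, of s] I ia b by (subst (1 2) nn_integral_eq_integral[symmetric]) auto
    then show ?thesis using b by (subst (asm) ennreal_inj) (auto intro!: integral_nonneg)
  qed
  have iI: "integrable lebesgue (\<lambda>x. ?I x * (1 - avg s ?I x))" for s
  proof (rule Bochner_Integration.integrable_bound[OF I])
    show "(\<lambda>x. ?I x * (1 - avg s ?I x)) \<in> borel_measurable lebesgue"
      using ia by measurable
  qed (use b in \<open>auto simp: indicator_def\<close>)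
  have "L1_err s ?I = 2 * (\<integral>x. ?I x * (1 - avg s ?I x) \<partial>lebesgue)" for s
  proof -
    have "L1_err s ?I = (\<integral>x. 2 * (?I x * (1 - avg s ?I x)) + (avg s ?I x - ?I x) \<partial>lebesgue)"
      using b[of s] by (intro Bochner_Integration.integral_cong) (auto simp: indicator_def)
    also have "\<dots> = 2 * (\<integral>x. ?I x * (1 - avg s ?I x) \<partial>lebesgue)"
      using iI[of s] I ia by (simp add: eq)
    finally show ?thesis .
  qed
  moreover have "(\<lambda>k. \<integral>x. ?I x * (1 - avg (s k) ?I x) \<partial>lebesgue) \<longlonglongrightarrow> (\<integral>x. 0 \<partial>(lebesgue :: 'a measure))"
  proof (rule integral_dominated_convergence[where w = ?I])
    show "AE x in lebesgue. (\<lambda>k. ?I x * (1 - avg (s k) ?I x)) \<longlonglongrightarrow> 0"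
    proof (rule AE_I2)
      fix x
      show "(\<lambda>k. ?I x * (1 - avg (s k) ?I x)) \<longlonglongrightarrow> 0"
      proof (cases "x \<in> U")
        case True
        have "eventually (\<lambda>k. ?I x * (1 - avg (s k) ?I x) = 0) sequentially"
          using eventually_cell_subset[OF s U(1) True]
        proof eventually_elim
          case (elim k)
          have "avg (s k) ?I x = avg (s k) (\<lambda>_. 1) x"
            by (rule avg_cong) (use elim in auto)
          then show ?case by simp
        qed
        then show ?thesis by (rule tendsto_eventually)
      qed simp
    qed
  qed (use I iI b in \<open>auto simp: indicator_def\<close>)
  ultimately show ?thesis by (simp add: tendsto_mult_right_zero)
qed

text \<open>Averages are contractions of \<open>L\<^sup>1\<close>, so convergence on a dense set suffices, and indicators of measurable
  sets are approximated by those of open sets.\<close>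
theorem avg_tendsto_L1:
  fixes g :: "'a::euclidean_space \<Rightarrow> real"
  assumes s: "fine_seq s" and g: "integrable lebesgue g"
  shows "(\<lambda>k. L1_err (s k) g) \<longlonglongrightarrow> 0"
  using g
proof (induction rule: integrable_induct)
  case (base A c)
  have A: "A \<in> lmeasurable" using base by (auto simp: fmeasurable_def)
  let ?A = "indicat_real A"
  have IA: "integrable lebesgue ?A" using base by (simp add: less_top[symmetric])
  have "(\<lambda>k. L1_err (s k) ?A) \<longlonglongrightarrow> 0"
  proof (rule tendsto_0_if_approx)
    fix e :: real assume e: "0 < e"
    obtain U where U: "open U" "A \<subseteq> U" "U - A \<in> lmeasurable" "emeasure lebesgue (U - A) < ennreal (e / 2)"
      using sets_lebesgue_outer_open[of A "e / 2"] base e by auto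
    have "U = A \<union> (U - A)" using U(2) by auto
    then have Um: "U \<in> lmeasurable" using fmeasurable.Un[OF A U(3)] by simp
    have IU: "integrable lebesgue (indicat_real U)" 
      by (rule integrable_real_indicator) (use Um in \<open>auto simp: fmeasurable_def\<close>)
    have "(\<integral>x. \<bar>?A x - indicat_real U x\<bar> \<partial>lebesgue) = (\<integral>x. indicat_real (U - A) x \<partial>lebesgue)"
      using U(2) by (intro Bochner_Integration.integral_cong) (auto simp: indicator_def)
    also have "\<dots> = measure lebesgue (U - A)" by simp
    also have "\<dots> < e / 2"
      using U(4) e by (simp add: emeasure_eq_measure2[OF U(3)] ennreal_less_iff)
    finally have "2 * (\<integral>x. \<bar>?A x - indicat_real U x\<bar> \<partial>lebesgue) \<le> e" by simp
    then show "\<exists>v. v \<longlonglongrightarrow> 0 \<and> (\<forall>k. L1_err (s k) ?A \<le> v k + e)"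
      using L1_dist_avg_open[OF s U(1)] Um order_trans[OF L1_dist_avg_le[OF IA IU] add_left_mono]
      by (intro exI[of _ "\<lambda>k. \<integral>x. \<bar>avg (s k) (indicat_real U) x - indicat_real U x\<bar> \<partial>lebesgue"])
        (auto simp: fmeasurable_def)
  qed simp
  then have "(\<lambda>k. \<bar>c\<bar> * L1_err (s k) ?A) \<longlonglongrightarrow> 0"
    by (rule tendsto_mult_right_zero)
  moreover have "\<bar>c\<bar> * L1_err (s k) ?A
      = (\<integral>x. \<bar>avg (s k) (\<lambda>x. ?A x *\<^sub>R c) x - ?A x *\<^sub>R c\<bar> \<partial>lebesgue)" for k
  proof -
    have "\<bar>c\<bar> * L1_err (s k) ?A = (\<integral>x. \<bar>c\<bar> * \<bar>avg (s k) ?A x - ?A x\<bar> \<partial>lebesgue)"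
      by simp
    also have "\<dots> = (\<integral>x. \<bar>avg (s k) (\<lambda>x. c * ?A x) x - c * ?A x\<bar> \<partial>lebesgue)"
      unfolding avg_cmult abs_mult[symmetric] by (simp add: right_diff_distrib)
    finally show ?thesis by (simp add: mult.commute)
  qed
  ultimately show ?case by simp
next
  case (add f g)
  have i: "integrable lebesgue (\<lambda>x. \<bar>avg (s k) f x - f x\<bar>)" "integrable lebesgue (\<lambda>x. \<bar>avg (s k) g x - g x\<bar>)" for k
    by (intro integrable_abs Bochner_Integration.integrable_diff integrable_avg(1) add)+
  have "(\<lambda>k. L1_err (s k) f + L1_err (s k) g) \<longlonglongrightarrow> 0 + 0"
    by (intro tendsto_add add)
  then have lim0: "(\<lambda>k. L1_err (s k) f + L1_err (s k) g) \<longlonglongrightarrow> 0"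
    by simp
  have le: "(\<integral>x. \<bar>avg (s k) (\<lambda>x. f x + g x) x - (f x + g x)\<bar> \<partial>lebesgue)
    \<le> L1_err (s k) f + L1_err (s k) g" for k
  proof -
    have "(\<integral>x. \<bar>avg (s k) (\<lambda>x. f x + g x) x - (f x + g x)\<bar> \<partial>lebesgue)
      \<le> (\<integral>x. \<bar>avg (s k) f x - f x\<bar> + \<bar>avg (s k) g x - g x\<bar> \<partial>lebesgue)"
    proof (rule integral_mono)
      show "integrable lebesgue (\<lambda>x. \<bar>avg (s k) (\<lambda>x. f x + g x) x - (f x + g x)\<bar>)"
        by (intro integrable_abs Bochner_Integration.integrable_diff integrable_avg(1) Bochner_Integration.integrable_add add)
      fix x
      show "\<bar>avg (s k) (\<lambda>x. f x + g x) x - (f x + g x)\<bar> \<le> \<bar>avg (s k) f x - f x\<bar> + \<bar>avg (s k) g x - g x\<bar>"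
        using avg_add[OF integrable_cell_integrable[OF add(1)] integrable_cell_integrable[OF add(2)], of "s k" x]
        by linarith
    qed (use i[of k] in simp)
    then show ?thesis using i[of k] by simp
  qed
  show ?case
  proof (rule tendsto_0_if_approx)
    fix e :: real assume "0 < e"
    then have "\<forall>k. (\<integral>x. \<bar>avg (s k) (\<lambda>x. f x + g x) x - (f x + g x)\<bar> \<partial>lebesgue)
      \<le> L1_err (s k) f + L1_err (s k) g + e"
      using add_mono[OF le, of 0 e] by simp
    with lim0 show "\<exists>v. v \<longlonglongrightarrow> 0 \<and> (\<forall>k. (\<integral>x. \<bar>avg (s k) (\<lambda>x. f x + g x) x - (f x + g x)\<bar> \<partial>lebesgue) \<le> v k + e)"
      by (intro exI conjI)
  qed simp
next
  case (lim f t)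
  show ?case
  proof (rule tendsto_0_if_approx)
    fix e :: real assume e: "0 < e"
    have "(\<lambda>i. \<integral>x. \<bar>f x - t i x\<bar> \<partial>lebesgue) \<longlonglongrightarrow> (\<integral>x. 0 \<partial>(lebesgue :: 'a measure))"
    proof (rule integral_dominated_convergence[where w = "\<lambda>x. 3 * \<bar>f x\<bar>"])
      show "AE x in lebesgue. (\<lambda>i. \<bar>f x - t i x\<bar>) \<longlonglongrightarrow> 0"
      proof (rule AE_I2)
        fix x
        have "(\<lambda>i. \<bar>f x - t i x\<bar>) \<longlonglongrightarrow> \<bar>f x - f x\<bar>"
          using lim(2)[of x] by (intro tendsto_intros) auto
        then show "(\<lambda>i. \<bar>f x - t i x\<bar>) \<longlonglongrightarrow> 0" by simp
      qed
      show "AE x in lebesgue. norm \<bar>f x - t i x\<bar> \<le> 3 * \<bar>f x\<bar>" for i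
        using lim(3)[of _ i] by (intro AE_I2) (simp add: abs_real_def split: if_splits, smt (verit))
    qed (use lim in auto)
    then have "eventually (\<lambda>i. (\<integral>x. \<bar>f x - t i x\<bar> \<partial>lebesgue) < e / 2) sequentially"
      using e by (intro order_tendstoD(2)) auto
    then obtain i where i: "(\<integral>x. \<bar>f x - t i x\<bar> \<partial>lebesgue) < e / 2" by (auto simp: eventually_sequentially)
    show "\<exists>v. v \<longlonglongrightarrow> 0 \<and> (\<forall>k. L1_err (s k) f \<le> v k + e)"
    proof (intro exI[of _ "\<lambda>k. L1_err (s k) (t i)"] conjI allI lim)
      fix k
      show "L1_err (s k) f \<le> L1_err (s k) (t i) + e"
        using L1_dist_avg_le[OF lim(4) lim(1)[of i], of "s k"] i by linarith
    qed
  qed simp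
qed

text \<open>On a bounded union of unit cells \<open>f\<close> is integrable, so the averages converge to it in \<open>L\<^sup>1\<close>, and almost
  everywhere along a subsequence. Fatou's lemma bounds the integral over this union, and then over
  the space.\<close>
lemma pint_le_if_avg_le:
  fixes f :: "'a::euclidean_space \<Rightarrow> real"
  assumes p: "1 < p" and s: "fine_seq s" and f: "f \<in> borel_measurable lebesgue" "pint p f < \<infinity>"
    and M: "\<And>k. pint p (avg (s k) f) \<le> M"
  shows "pint p f \<le> M"
proof -
  note fm [measurable] = f(1)
  have am [measurable]: "avg s f \<in> borel_measurable lebesgue" for s
    by (rule lebesgue_measurable_cell_const[OF cell_const_avg])
  define z :: "'a \<Rightarrow> int" where "z = (\<lambda>_. 0)"
  \<comment> \<open>As a union of unit cells, \<open>B R\<close> contains the cells of its points at all fine levels.\<close>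
  define B where "B = (\<lambda>R :: nat. {x :: 'a. \<forall>b\<in>Basis. - int R \<le> cell_idx z x b \<and> cell_idx z x b < int R})"
  have Bz: "cell z x \<subseteq> B R" if "x \<in> B R" for x R
    using that by (auto simp: B_def cell_def)
  have Bc: "cell_const z (indicat_real (B R))" for R
    unfolding cell_const_def
  proof (intro allI impI)
    fix x y assume "cell z x = cell z y"
    then have "x \<in> cell z y" "y \<in> cell z x" by (auto simp: mem_cell_iff)
    then show "indicat_real (B R) x = indicat_real (B R) y"
      using Bz by (auto simp: indicator_def split: if_splits)
  qed
  have IBm [measurable]: "indicat_real (B R) \<in> borel_measurable lebesgue" for R
    by (rule lebesgue_measurable_cell_const[OF Bc])
  have Bm [measurable]: "B R \<in> sets lebesgue" for R
    using IBm[of R] by (simp add: borel_measurable_indicator_iff)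
  have Bfin: "emeasure lebesgue (B R) < \<infinity>" for R
  proof -
    define l where "l = (\<Sum>b\<in>Basis. (- real R) *\<^sub>R (b :: 'a))"
    define u where "u = (\<Sum>b\<in>Basis. (real R) *\<^sub>R (b :: 'a))"
    have "B R \<subseteq> cbox l u"
    proof
      fix x assume x: "x \<in> B R"
      have "l \<bullet> b \<le> x \<bullet> b \<and> x \<bullet> b \<le> u \<bullet> b" if b: "b \<in> Basis" for b
      proof -
        have "- int R \<le> \<lfloor>x \<bullet> b\<rfloor>" "\<lfloor>x \<bullet> b\<rfloor> < int R" using x b by (auto simp: B_def z_def cell_idx_def)
        moreover have "l \<bullet> b = - real R" "u \<bullet> b = real R"
          using b by (simp_all add: l_def u_def inner_sum_left_Basis sum_negf)
        ultimately show ?thesis by (simp add: le_floor_iff floor_less_iff)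
      qed
      then show "x \<in> cbox l u" by (simp add: mem_box)
    qed
    then have "emeasure lebesgue (B R) \<le> emeasure lebesgue (cbox l u)" by (intro emeasure_mono) auto
    also have "\<dots> < \<infinity>" by (simp add: emeasure_lborel_cbox_eq)
    finally show ?thesis .
  qed
  have ex: "\<exists>R0. \<forall>R\<ge>R0. x \<in> B R" for x
  proof -
    define R0 where "R0 = nat (\<Sum>b\<in>Basis. \<bar>cell_idx z x b\<bar>) + 1"
    have "\<bar>cell_idx z x b\<bar> < int R0" if "b \<in> Basis" for b
    proof -
      have "\<bar>cell_idx z x b\<bar> \<le> (\<Sum>b\<in>Basis. \<bar>cell_idx z x b\<bar>)" using that by (intro member_le_sum) auto
      then show ?thesis by (simp add: R0_def)
    qed
    then have "x \<in> B R" if "R0 \<le> R" for R using that by (fastforce simp: B_def)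
    then show ?thesis by blast
  qed
  have part: "(\<integral>\<^sup>+x. ennreal (indicat_real (B R) x * \<bar>f x\<bar> powr p) \<partial>lebesgue) \<le> M" for R
  proof -
    define g where "g = (\<lambda>x. indicat_real (B R) x * f x)"
    have fi: "integrable lebesgue (\<lambda>x. \<bar>f x\<bar> powr p)"
      using f by (intro integrableI_bounded) (auto simp: pint_def)
    have "integrable lebesgue (\<lambda>x. indicat_real (B R) x + \<bar>f x\<bar> powr p)"
      using Bfin[of R] by (intro Bochner_Integration.integrable_add fi) (simp add: less_top[symmetric])
    then have g: "integrable lebesgue g"
    proof (rule Bochner_Integration.integrable_bound)
      show "AE x in lebesgue. norm (g x) \<le> norm (indicat_real (B R) x + \<bar>f x\<bar> powr p)"
        using abs_le_one_plus_powr[OF p] by (intro AE_I2) (auto simp: g_def indicator_def)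
    qed (auto simp: g_def)
    have "(\<lambda>k. \<integral>x. norm (avg (s k) g x - g x) \<partial>lebesgue) \<longlonglongrightarrow> 0"
      using avg_tendsto_L1[OF s g] by simp
    then obtain r where r: "strict_mono r" "AE x in lebesgue. (\<lambda>k. avg (s (r k)) g x - g x) \<longlonglongrightarrow> 0"
      using tendsto_L1_AE_subseq[of lebesgue "\<lambda>k x. avg (s k) g x - g x"] g integrable_avg(1)[OF g] by auto
    obtain K where K: "\<And>k b. b \<in> Basis \<Longrightarrow> s k b \<le> K - int k" using s by (auto simp: fine_seq_def)
    have ag: "avg (s (r k)) g x = avg (s (r k)) f x" if "x \<in> B R" "nat K \<le> k" for k x
    proof (rule avg_cong)
      fix y assume y: "y \<in> cell (s (r k)) x"
      have "k \<le> r k" using r(1) by (rule seq_suble)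
      then have "K - int (r k) \<le> 0" using that by linarith
      then have "s (r k) b \<le> z b" if "b \<in> Basis" for b using K[OF that, of "r k"] by (simp add: z_def)
      then have "cell (s (r k)) x \<subseteq> cell z x" by (rule cell_mono)
      then have "y \<in> B R" using y Bz[OF that(1)] by auto
      then show "g y = f y" by (simp add: g_def)
    qed
    show ?thesis
    proof (rule nn_integral_limit_le[where g = "\<lambda>k x. ennreal (indicat_real (B R) x * \<bar>avg (s (r k)) f x\<bar> powr p)"])
      show "AE x in lebesgue. (\<lambda>k. ennreal (indicat_real (B R) x * \<bar>avg (s (r k)) f x\<bar> powr p))
          \<longlonglongrightarrow> ennreal (indicat_real (B R) x * \<bar>f x\<bar> powr p)"
        using r(2)
      proof eventually_elim
        case (elim x)
        show ?case
        proof (cases "x \<in> B R")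
          case True
          have "(\<lambda>k. avg (s (r k)) g x) \<longlonglongrightarrow> g x" using elim by (simp add: LIM_zero_iff)
          moreover have "g x = f x" using True by (simp add: g_def)
          moreover have "eventually (\<lambda>k. avg (s (r k)) g x = avg (s (r k)) f x) sequentially"
            unfolding eventually_sequentially using ag[OF True] by blast
          ultimately have "(\<lambda>k. avg (s (r k)) f x) \<longlonglongrightarrow> f x"
            using Lim_transform_eventually by fastforce
          then have "(\<lambda>k. \<bar>avg (s (r k)) f x\<bar> powr p) \<longlonglongrightarrow> \<bar>f x\<bar> powr p"
            using p by (intro tendsto_powr' tendsto_rabs tendsto_const) auto
          then show ?thesis using True by simp
        qed simp
      qed
      show "(\<integral>\<^sup>+x. ennreal (indicat_real (B R) x * \<bar>avg (s (r k)) f x\<bar> powr p) \<partial>lebesgue) \<le> M" for k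
        by (rule order_trans[OF _ M[of "r k"]]) (auto simp: pint_def indicator_def intro!: nn_integral_mono)
    qed simp
  qed
  show ?thesis
    unfolding pint_def
  proof (rule nn_integral_limit_le[where g = "\<lambda>R x. ennreal (indicat_real (B R) x * \<bar>f x\<bar> powr p)"])
    show "AE x in lebesgue. (\<lambda>R. ennreal (indicat_real (B R) x * \<bar>f x\<bar> powr p)) \<longlonglongrightarrow> ennreal (\<bar>f x\<bar> powr p)"
    proof (rule AE_I2)
      fix x
      obtain R0 where "\<And>R. R0 \<le> R \<Longrightarrow> x \<in> B R" using ex by blast
      then show "(\<lambda>R. ennreal (indicat_real (B R) x * \<bar>f x\<bar> powr p)) \<longlonglongrightarrow> ennreal (\<bar>f x\<bar> powr p)"
        by (intro tendsto_eventually) (auto simp: eventually_sequentially intro!: exI[of _ R0])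
    qed
  qed (use part in simp_all)
qed

context tri_grid
begin

text \<open>Of the eight averages only the one with all scales equal to \<open>m\<close> survives.\<close>
lemma box_sum_tendsto:
  assumes p: "1 < p" and f: "f \<in> borel_measurable lebesgue" "pint p f < \<infinity>"
  shows "(\<lambda>n. box_sum sh f m (m + int n) x) \<longlonglongrightarrow> avg (sh m m m) f x"
proof -
  have lim1: "(\<lambda>n. avg (sh (m + int n) (y n) (z n)) f x) \<longlonglongrightarrow> 0" if "\<And>n. m \<le> y n" "\<And>n. m \<le> z n" for y z
  proof -
    obtain b where b: "b \<in> Basis" "\<And>x y z. x \<le> sh x y z b" using coarse1 by blast
    show ?thesis
      by (rule avg_tendsto_0[OF p f b(1), of "sh m m m" _ m]) (use b that in \<open>auto intro: sh_mono\<close>)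
  qed
  have lim2: "(\<lambda>n. avg (sh (y n) (m + int n) (z n)) f x) \<longlonglongrightarrow> 0" if "\<And>n. m \<le> y n" "\<And>n. m \<le> z n" for y z
  proof -
    obtain b where b: "b \<in> Basis" "\<And>x y z. y \<le> sh x y z b" using coarse2 by blast
    show ?thesis
      by (rule avg_tendsto_0[OF p f b(1), of "sh m m m" _ m]) (use b that in \<open>auto intro: sh_mono\<close>)
  qed
  have lim3: "(\<lambda>n. avg (sh (y n) (z n) (m + int n)) f x) \<longlonglongrightarrow> 0" if "\<And>n. m \<le> y n" "\<And>n. m \<le> z n" for y z
  proof -
    obtain b where b: "b \<in> Basis" "\<And>x y z. z \<le> sh x y z b" using coarse3 by blast
    show ?thesis
      by (rule avg_tendsto_0[OF p f b(1), of "sh m m m" _ m]) (use b that in \<open>auto intro: sh_mono\<close>)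
  qed
  have "(\<lambda>n. box_sum sh f m (m + int n) x) \<longlonglongrightarrow> avg (sh m m m) f x - 0 - (0 - 0) - (0 - 0 - (0 - 0))"
    unfolding box_sum_alt[of m "m + int n" for n, simplified]
    by (intro tendsto_diff tendsto_const lim1 lim2 lim3) auto
  then show ?thesis by simp
qed

lemma pint_le_if_box_sum_le:
  assumes p: "1 < p" and f: "f \<in> borel_measurable lebesgue" "pint p f < \<infinity>"
    and M: "\<And>m n. m \<le> n \<Longrightarrow> pint p (box_sum sh f m n) \<le> M"
  shows "pint p f \<le> M"
proof (rule pint_le_if_avg_le[OF p _ f, of "\<lambda>k. sh (- int k) (- int k) (- int k)"])
  obtain K where "\<And>n b. 0 \<le> n \<Longrightarrow> b \<in> Basis \<Longrightarrow> sh (- n) (- n) (- n) b \<le> K - n" using fine by blast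
  then show "fine_seq (\<lambda>k. sh (- int k) (- int k) (- int k))"
    unfolding fine_seq_def by (intro exI[of _ K]) auto
  fix k
  have [measurable]: "box_sum sh f m n \<in> borel_measurable lebesgue" for m n
    unfolding box_sum_def[abs_def] by measurable
  show "pint p (avg (sh (- int k) (- int k) (- int k)) f) \<le> M"
    unfolding pint_def
  proof (rule nn_integral_limit_le[where g = "\<lambda>n x. ennreal (\<bar>box_sum sh f (- int k) (- int k + int n) x\<bar> powr p)"])
    show "AE x in lebesgue. (\<lambda>n. ennreal (\<bar>box_sum sh f (- int k) (- int k + int n) x\<bar> powr p))
      \<longlonglongrightarrow> ennreal (\<bar>avg (sh (- int k) (- int k) (- int k)) f x\<bar> powr p)"
      using p by (intro AE_I2 tendsto_ennrealI tendsto_powr' tendsto_rabs tendsto_const box_sum_tendsto[OF p f]) auto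
    show "(\<integral>\<^sup>+x. ennreal (\<bar>box_sum sh f (- int k) (- int k + int n) x\<bar> powr p) \<partial>lebesgue) \<le> M" for n
      using M[of "- int k" "- int k + int n"] by (simp add: pint_def)
  qed simp
qed

end

text \<open>The supremum of \<open>square_pint\<close> over the boxes is the \<open>p\<close>-th power of the norm of the full square
  function, so the second part is the lower bound for this norm.\<close>
theorem square_function_real:
  assumes p: "1 < p"
  shows "\<exists>K. 0 < K \<and> (\<forall>(sh :: 'a::euclidean_space grid) f. tri_grid sh \<longrightarrow> f \<in> borel_measurable lebesgue \<longrightarrow> pint p f < \<infinity> \<longrightarrow>
    (\<forall>m n. m \<le> n \<longrightarrow> square_pint p sh f m n \<le> ennreal K * pint p f) \<and>
    (\<forall>M. (\<forall>m n. m \<le> n \<longrightarrow> square_pint p sh f m n \<le> M) \<longrightarrow>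
      pint p f \<le> ennreal K * M))"
proof -
  obtain K where K: "0 < K" and eq: "\<And>(sh :: 'a grid) f m n. tri_grid sh \<Longrightarrow> cell_integrable f \<Longrightarrow> m \<le> n \<Longrightarrow>
    square_pint p sh f m n \<le> ennreal K * pint p (box_sum sh f m n) \<and>
    pint p (box_sum sh f m n) \<le> ennreal K * square_pint p sh f m n"
    using box_square_equivalence[OF p, where 'a='a] by blast
  define C where "C = (2 powr p * 2) ^ 3"
  have C: "0 < C" by (simp add: C_def)
  define L where "L = max (K * C) K"
  have L: "0 < L" "K * C \<le> L" "K \<le> L" using K by (auto simp: L_def less_max_iff_disj)
  show ?thesis
  proof (rule exI[of _ L], intro conjI allI impI L(1))
    fix sh :: "'a grid" and f :: "'a \<Rightarrow> real"
    assume grid: "tri_grid sh" and f: "f \<in> borel_measurable lebesgue" "pint p f < \<infinity>"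
    interpret tri_grid sh by (rule grid)
    note ci = cell_integrable_Lp(2)[OF p f]
    show "square_pint p sh f m n \<le> ennreal L * pint p f" if "m \<le> n" for m n
    proof -
      have "square_pint p sh f m n \<le> ennreal K * pint p (box_sum sh f m n)"
        using eq[OF grid ci that] by simp
      also have "\<dots> \<le> ennreal K * (ennreal C * pint p f)"
        unfolding C_def by (intro mult_left_mono pint_box_sum_le[OF p f that]) simp
      also have "\<dots> = ennreal (K * C) * pint p f"
        using K C by (simp add: ennreal_mult mult.assoc)
      also have "\<dots> \<le> ennreal L * pint p f"
        by (intro mult_right_mono ennreal_leI L) simp
      finally show ?thesis .
    qed
    show "pint p f \<le> ennreal L * M"
      if M: "\<forall>m n. m \<le> n \<longrightarrow> square_pint p sh f m n \<le> M" for M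
    proof (rule pint_le_if_box_sum_le[OF p f])
      fix m n :: int assume mn: "m \<le> n"
      have "pint p (box_sum sh f m n) \<le> ennreal K * square_pint p sh f m n"
        using eq[OF grid ci mn] by simp
      also have "\<dots> \<le> ennreal L * M"
        using M mn by (intro mult_mono ennreal_leI L) auto
      finally show "pint p (box_sum sh f m n) \<le> ennreal L * M" .
    qed
  qed
qed

section \<open>Powers of extended nonnegative reals\<close>

lemma enn_powr_ennreal: "0 \<le> r \<Longrightarrow> enn_powr (ennreal r) a = ennreal (r powr a)"
  by (simp add: enn_powr_def)

lemma enn_powr_top [simp]: "enn_powr \<infinity> a = \<infinity>" "enn_powr top a = top"
  by (simp_all add: enn_powr_def)

lemma enn_powr_powr: "enn_powr (enn_powr x a) b = enn_powr x (a * b)"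
  by (cases x) (simp_all add: enn_powr_ennreal powr_powr)

lemma enn_powr_one [simp]: "enn_powr x 1 = x"
  by (cases x) (simp_all add: enn_powr_ennreal)

lemma enn_powr_mono:
  assumes "x \<le> y" "0 \<le> a"
  shows "enn_powr x a \<le> enn_powr y a"
  using assms
proof (cases y)
  case (real s)
  then obtain r where "x = ennreal r" "0 \<le> r" using assms by (cases x) (auto simp: top_unique)
  then show ?thesis using assms real by (auto simp: enn_powr_ennreal ennreal_le_iff intro!: ennreal_leI powr_mono2)
qed simp

lemma enn_powr_le_iff_le:
  assumes a: "0 < a"
  shows "enn_powr x a \<le> y \<longleftrightarrow> x \<le> enn_powr y (1 / a)"
proof
  assume "enn_powr x a \<le> y"
  from enn_powr_mono[OF this, of "1 / a"] show "x \<le> enn_powr y (1 / a)" using a by (simp add: enn_powr_powr)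
next
  assume "x \<le> enn_powr y (1 / a)"
  from enn_powr_mono[OF this, of a] show "enn_powr x a \<le> y" using a by (simp add: enn_powr_powr)
qed

lemma enn_powr_SUP:
  assumes a: "0 < a"
  shows "enn_powr (SUP i\<in>I. x i) a = (SUP i\<in>I. enn_powr (x i) a)"
proof (rule antisym)
  have "x i \<le> enn_powr (SUP i\<in>I. enn_powr (x i) a) (1 / a)" if "i \<in> I" for i
    using that by (subst enn_powr_le_iff_le[OF a, symmetric]) (rule SUP_upper)
  then have "(SUP i\<in>I. x i) \<le> enn_powr (SUP i\<in>I. enn_powr (x i) a) (1 / a)" by (rule SUP_least)
  then show "enn_powr (SUP i\<in>I. x i) a \<le> (SUP i\<in>I. enn_powr (x i) a)"
    by (subst enn_powr_le_iff_le[OF a])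
  show "(SUP i\<in>I. enn_powr (x i) a) \<le> enn_powr (SUP i\<in>I. x i) a"
    using a by (intro SUP_least enn_powr_mono SUP_upper) auto
qed

lemma enn_powr_cmult:
  assumes "0 < K" "0 < a"
  shows "enn_powr (ennreal K * x) a = ennreal (K powr a) * enn_powr x a"
  using assms by (cases x) (simp_all add: enn_powr_ennreal powr_mult ennreal_mult_top flip: ennreal_mult)

section \<open>The blocks as cells\<close>

lemma cell_cong: "(\<And>b. b \<in> Basis \<Longrightarrow> s b = s' b) \<Longrightarrow> cell s x = cell s' x"
  by (auto simp: cell_def cell_idx_def)

lemma cell_Pair: "cell s (x, y) = cell (\<lambda>b. s (b, 0)) x \<times> cell (\<lambda>b. s (0, b)) y"
  by (auto simp: cell_def cell_idx_def Basis_prod_def ball_Un)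

lemma dyadic_cubes_iff: "Q \<in> dyadic_cubes j \<and> x \<in> Q \<longleftrightarrow> Q = cell (\<lambda>_. j) x"
proof
  assume "Q \<in> dyadic_cubes j \<and> x \<in> Q"
  then obtain m where Q: "Q = {x. \<forall>b\<in>Basis. of_int (m b) * 2 powi j \<le> x \<bullet> b \<and> x \<bullet> b < (of_int (m b) + 1) * 2 powi j}"
    and x: "x \<in> Q" by (auto simp: dyadic_cubes_def)
  have "cell_idx (\<lambda>_. j) x b = m b" if "b \<in> Basis" for b
    using x that unfolding cell_idx_eq_iff Q by auto
  then have "cell (\<lambda>_. j) x = {y. \<forall>b\<in>Basis. cell_idx (\<lambda>_. j) y b = m b}" by (auto simp: cell_def)
  also have "\<dots> = Q" unfolding cell_idx_eq_iff Q ..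
  finally show "Q = cell (\<lambda>_. j) x" ..
next
  assume Q: "Q = cell (\<lambda>_. j) x"
  then have "Q = {y. \<forall>b\<in>Basis. of_int (cell_idx (\<lambda>_. j) x b) * 2 powi j \<le> y \<bullet> b
      \<and> y \<bullet> b < (of_int (cell_idx (\<lambda>_. j) x b) + 1) * 2 powi j}"
    unfolding cell_def cell_idx_eq_iff by simp
  then have "Q \<in> dyadic_cubes j" unfolding dyadic_cubes_def by blast
  then show "Q \<in> dyadic_cubes j \<and> x \<in> Q" using Q by simp
qed

lemma parabolic_blocks_iff:
  "Q \<in> parabolic_blocks \<kappa> j \<and> (z, t) \<in> Q \<longleftrightarrow> Q = cell (\<lambda>_. j) z \<times> cell (\<lambda>_. 2 * j + \<kappa>) t"
proof
  assume "Q \<in> parabolic_blocks \<kappa> j \<and> (z, t) \<in> Q"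
  then obtain I J where "I \<in> dyadic_cubes j \<and> z \<in> I" "J \<in> dyadic_cubes (2 * j + \<kappa>) \<and> t \<in> J" "Q = I \<times> J"
    by (auto simp: parabolic_blocks_def)
  then show "Q = cell (\<lambda>_. j) z \<times> cell (\<lambda>_. 2 * j + \<kappa>) t" unfolding dyadic_cubes_iff by simp
next
  assume Q: "Q = cell (\<lambda>_. j) z \<times> cell (\<lambda>_. 2 * j + \<kappa>) t"
  have "cell (\<lambda>_. j) z \<in> dyadic_cubes j" "cell (\<lambda>_. 2 * j + \<kappa>) t \<in> dyadic_cubes (2 * j + \<kappa>)"
    using dyadic_cubes_iff by blast+
  then show "Q \<in> parabolic_blocks \<kappa> j \<and> (z, t) \<in> Q" unfolding Q parabolic_blocks_def by auto
qed

text \<open>A basis vector has exactly one nonzero component, which identifies its direction. The flag tells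
  whether \<open>t2\<close> is scaled with \<open>z2\<close>, as in the first family, or with \<open>z3\<close>, as in the second.\<close>
definition block_shape :: "bool \<Rightarrow> int \<Rightarrow> int \<Rightarrow> int \<Rightarrow> int \<Rightarrow> ('n1::finite, 'n2::finite, 'n3::finite) nspace \<Rightarrow> int" where
  "block_shape second \<kappa> j1 j2 j3 = (\<lambda>(z1, z2, z3, t1, t2).
     if z1 \<noteq> 0 then j1 else if z2 \<noteq> 0 then j2 else if z3 \<noteq> 0 then j3
     else if t1 \<noteq> 0 then 2 * j1 + \<kappa> else 2 * (if second then j2 else j3) + \<kappa>)"

lemma cell_block_shape:
  fixes z1 :: "complex ^ 'n1::finite" and z2 :: "complex ^ 'n2::finite" and z3 :: "complex ^ 'n3::finite"
  shows "cell (block_shape second \<kappa> j1 j2 j3) (z1, z2, z3, t1, t2) =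
    cell (\<lambda>_. j1) z1 \<times> cell (\<lambda>_. j2) z2 \<times> cell (\<lambda>_. j3) z3
    \<times> cell (\<lambda>_. 2 * j1 + \<kappa>) t1 \<times> cell (\<lambda>_. 2 * (if second then j2 else j3) + \<kappa>) t2"
  unfolding cell_Pair
  by (intro arg_cong2[where f="(\<times>)"] cell_cong; auto simp: block_shape_def nonzero_Basis)

lemma blocks1_the:
  fixes g :: "('n1::finite, 'n2::finite, 'n3::finite) nspace"
  shows "(THE Q. Q \<in> blocks1 \<kappa> (j1, j2, j3) \<and> g \<in> Q) = cell (block_shape True \<kappa> j1 j2 j3) g"
proof -
  obtain z1 z2 z3 t1 t2 where g: "g = (z1, z2, z3, t1, t2)" by (cases g) auto
  have "Q \<in> blocks1 \<kappa> (j1, j2, j3) \<and> g \<in> Q \<longleftrightarrow> Q = cell (block_shape True \<kappa> j1 j2 j3) g" for Q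
  proof
    assume "Q \<in> blocks1 \<kappa> (j1, j2, j3) \<and> g \<in> Q"
    then obtain Q1 Q2 I3 where Q: "Q = {(z1, z2, z3, t1, t2). (z1, t1) \<in> Q1 \<and> (z2, t2) \<in> Q2 \<and> z3 \<in> I3}"
      and "Q1 \<in> parabolic_blocks \<kappa> j1 \<and> (z1, t1) \<in> Q1" "Q2 \<in> parabolic_blocks \<kappa> j2 \<and> (z2, t2) \<in> Q2"
        "I3 \<in> dyadic_cubes j3 \<and> z3 \<in> I3"
      unfolding blocks1_def g by auto
    then show "Q = cell (block_shape True \<kappa> j1 j2 j3) g"
      unfolding parabolic_blocks_iff dyadic_cubes_iff g cell_block_shape by auto
  next
    assume Q: "Q = cell (block_shape True \<kappa> j1 j2 j3) g"
    have "cell (\<lambda>_. j1) z1 \<times> cell (\<lambda>_. 2 * j1 + \<kappa>) t1 \<in> parabolic_blocks \<kappa> j1"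
      "cell (\<lambda>_. j2) z2 \<times> cell (\<lambda>_. 2 * j2 + \<kappa>) t2 \<in> parabolic_blocks \<kappa> j2" "cell (\<lambda>_. j3) z3 \<in> dyadic_cubes j3"
      using parabolic_blocks_iff dyadic_cubes_iff by blast+
    moreover have "Q = {(w1, w2, w3, s1, s2). (w1, s1) \<in> cell (\<lambda>_. j1) z1 \<times> cell (\<lambda>_. 2 * j1 + \<kappa>) t1
        \<and> (w2, s2) \<in> cell (\<lambda>_. j2) z2 \<times> cell (\<lambda>_. 2 * j2 + \<kappa>) t2 \<and> w3 \<in> cell (\<lambda>_. j3) z3}"
      unfolding Q g cell_block_shape by auto
    ultimately have "Q \<in> blocks1 \<kappa> (j1, j2, j3)" unfolding blocks1_def prod.case by blast
    then show "Q \<in> blocks1 \<kappa> (j1, j2, j3) \<and> g \<in> Q" by (simp add: Q)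
  qed
  then show ?thesis by simp
qed

lemma blocks2_the:
  fixes g :: "('n1::finite, 'n2::finite, 'n3::finite) nspace"
  shows "(THE Q. Q \<in> blocks2 \<kappa> (j1, j2, j3) \<and> g \<in> Q) = cell (block_shape False \<kappa> j1 j2 j3) g"
proof -
  obtain z1 z2 z3 t1 t2 where g: "g = (z1, z2, z3, t1, t2)" by (cases g) auto
  have "Q \<in> blocks2 \<kappa> (j1, j2, j3) \<and> g \<in> Q \<longleftrightarrow> Q = cell (block_shape False \<kappa> j1 j2 j3) g" for Q
  proof
    assume "Q \<in> blocks2 \<kappa> (j1, j2, j3) \<and> g \<in> Q"
    then obtain Q1 I2 Q3 where Q: "Q = {(z1, z2, z3, t1, t2). (z1, t1) \<in> Q1 \<and> z2 \<in> I2 \<and> (z3, t2) \<in> Q3}"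
      and "Q1 \<in> parabolic_blocks \<kappa> j1 \<and> (z1, t1) \<in> Q1" "Q3 \<in> parabolic_blocks \<kappa> j3 \<and> (z3, t2) \<in> Q3"
        "I2 \<in> dyadic_cubes j2 \<and> z2 \<in> I2"
      unfolding blocks2_def g by auto
    then show "Q = cell (block_shape False \<kappa> j1 j2 j3) g"
      unfolding parabolic_blocks_iff dyadic_cubes_iff g cell_block_shape by auto
  next
    assume Q: "Q = cell (block_shape False \<kappa> j1 j2 j3) g"
    have "cell (\<lambda>_. j1) z1 \<times> cell (\<lambda>_. 2 * j1 + \<kappa>) t1 \<in> parabolic_blocks \<kappa> j1"
      "cell (\<lambda>_. j3) z3 \<times> cell (\<lambda>_. 2 * j3 + \<kappa>) t2 \<in> parabolic_blocks \<kappa> j3" "cell (\<lambda>_. j2) z2 \<in> dyadic_cubes j2"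
      using parabolic_blocks_iff dyadic_cubes_iff by blast+
    moreover have "Q = {(w1, w2, w3, s1, s2). (w1, s1) \<in> cell (\<lambda>_. j1) z1 \<times> cell (\<lambda>_. 2 * j1 + \<kappa>) t1
        \<and> w2 \<in> cell (\<lambda>_. j2) z2 \<and> (w3, s2) \<in> cell (\<lambda>_. j3) z3 \<times> cell (\<lambda>_. 2 * j3 + \<kappa>) t2}"
      unfolding Q g cell_block_shape by auto
    ultimately have "Q \<in> blocks2 \<kappa> (j1, j2, j3)" unfolding blocks2_def prod.case by blast
    then show "Q \<in> blocks2 \<kappa> (j1, j2, j3) \<and> g \<in> Q" by (simp add: Q)
  qed
  then show ?thesis by simp
qed

lemma Pair_in_Basis: "b \<in> Basis \<Longrightarrow> (b, 0) \<in> Basis" "b \<in> Basis \<Longrightarrow> (0, b) \<in> Basis"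
  by (auto simp: Basis_prod_def)

lemma nspace_Basis:
  "\<exists>b\<in>(Basis :: ('n1::finite, 'n2::finite, 'n3::finite) nspace set). fst b \<noteq> 0"
  "\<exists>b\<in>(Basis :: ('n1::finite, 'n2::finite, 'n3::finite) nspace set). fst b = 0 \<and> fst (snd b) \<noteq> 0"
  "\<exists>b\<in>(Basis :: ('n1::finite, 'n2::finite, 'n3::finite) nspace set). fst b = 0 \<and> fst (snd b) = 0 \<and> fst (snd (snd b)) \<noteq> 0"
proof -
  obtain e1 :: "complex ^ 'n1" where e1: "e1 \<in> Basis" using nonempty_Basis by blast
  obtain e2 :: "complex ^ 'n2" where e2: "e2 \<in> Basis" using nonempty_Basis by blast
  obtain e3 :: "complex ^ 'n3" where e3: "e3 \<in> Basis" using nonempty_Basis by blast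
  note e = e1 e2 e3
  show "\<exists>b\<in>(Basis :: ('n1::finite, 'n2::finite, 'n3::finite) nspace set). fst b \<noteq> 0"
    using e by (intro bexI[of _ "(e1, 0)"]) (auto simp: Pair_in_Basis nonzero_Basis)
  show "\<exists>b\<in>(Basis :: ('n1::finite, 'n2::finite, 'n3::finite) nspace set). fst b = 0 \<and> fst (snd b) \<noteq> 0"
    using e by (intro bexI[of _ "(0, e2, 0)"]) (auto simp: Pair_in_Basis nonzero_Basis)
  show "\<exists>b\<in>(Basis :: ('n1::finite, 'n2::finite, 'n3::finite) nspace set). fst b = 0 \<and> fst (snd b) = 0 \<and> fst (snd (snd b)) \<noteq> 0"
    using e by (intro bexI[of _ "(0, 0, e3, 0)"]) (auto simp: Pair_in_Basis nonzero_Basis)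
qed

lemma tri_grid_block_shape:
  "tri_grid (block_shape second \<kappa> :: _ \<Rightarrow> _ \<Rightarrow> _ \<Rightarrow> ('n1::finite, 'n2::finite, 'n3::finite) nspace \<Rightarrow> int)"
proof
  let ?B = "Basis :: ('n1, 'n2, 'n3) nspace set"
  show "\<exists>K. \<forall>n\<ge>0. \<forall>b\<in>?B. block_shape second \<kappa> (- n) (- n) (- n) b \<le> K - n"
    by (intro exI[of _ "\<bar>\<kappa>\<bar>"]) (auto simp: block_shape_def)
  show "\<exists>b\<in>?B. \<forall>x y z. x \<le> block_shape second \<kappa> x y z b"
    using nspace_Basis(1) by (rule bexE) (auto simp: block_shape_def split: prod.splits)
  show "\<exists>b\<in>?B. \<forall>x y z. y \<le> block_shape second \<kappa> x y z b"
    using nspace_Basis(2) by (rule bexE) (auto simp: block_shape_def split: prod.splits)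
  show "\<exists>b\<in>?B. \<forall>x y z. z \<le> block_shape second \<kappa> x y z b"
    using nspace_Basis(3) by (rule bexE) (auto simp: block_shape_def split: prod.splits)
qed (auto simp: block_shape_def)

section \<open>The square function of a complex function\<close>

definition block_square :: "(int \<times> int \<times> int \<Rightarrow> 'a::euclidean_space set set) \<Rightarrow> ('a \<Rightarrow> complex) \<Rightarrow> 'a \<Rightarrow> ennreal" where
  "block_square \<Q> f g = enn_powr (\<Sum>\<^sub>\<infinity>j. ennreal ((cmod (block_diff \<Q> j f g))\<^sup>2)) (1 / 2)"

lemma block_avg_eq:
  assumes Q: "(THE Q. Q \<in> \<Q> j \<and> g \<in> Q) = cell s g"
    and f: "cell_integrable (\<lambda>x. Re (f x))" "cell_integrable (\<lambda>x. Im (f x))"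
  shows "block_avg \<Q> j f g = Complex (avg s (\<lambda>x. Re (f x)) g) (avg s (\<lambda>x. Im (f x)) g)"
proof -
  let ?I = "\<lambda>x. indicat_real (cell s g) x"
  have i: "integrable lebesgue (\<lambda>x. ?I x * Re (f x))" "integrable lebesgue (\<lambda>x. ?I x * Im (f x))"
    using f[THEN cell_integrableD, of s g] by (simp_all add: set_integrable_def)
  have "integrable lebesgue (\<lambda>x. complex_of_real (?I x * Re (f x)) + \<i> * complex_of_real (?I x * Im (f x)))"
    using i by (intro Bochner_Integration.integrable_add integrable_mult_right integrable_of_real)
  moreover have eq: "complex_of_real (?I x * Re (f x)) + \<i> * complex_of_real (?I x * Im (f x)) = ?I x *\<^sub>R f x" for x
    by (simp add: complex_eq_iff)
  ultimately have I: "integrable lebesgue (\<lambda>x. ?I x *\<^sub>R f x)" by simp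
  have "Re (LINT x:cell s g|lebesgue. f x) = (LINT x:cell s g|lebesgue. Re (f x))"
    "Im (LINT x:cell s g|lebesgue. f x) = (LINT x:cell s g|lebesgue. Im (f x))"
    unfolding set_lebesgue_integral_def using integral_Re[OF I] integral_Im[OF I] by simp_all
  then show ?thesis
    unfolding block_avg_def Q Let_def measure_cell avg_def by (simp add: complex_eq_iff divide_inverse)
qed

lemma block_diff_eq:
  assumes Q: "\<And>a b c g. (THE Q. Q \<in> \<Q> (a, b, c) \<and> g \<in> Q) = cell (sh a b c) g"
    and f: "cell_integrable (\<lambda>x. Re (f x))" "cell_integrable (\<lambda>x. Im (f x))"
  shows "block_diff \<Q> (a, b, c) f g = Complex (delta sh (\<lambda>x. Re (f x)) a b c g) (delta sh (\<lambda>x. Im (f x)) a b c g)"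
proof -
  have "block_avg \<Q> (a, b, c) f g = Complex (avg (sh a b c) (\<lambda>x. Re (f x)) g) (avg (sh a b c) (\<lambda>x. Im (f x)) g)" for a b c
    by (rule block_avg_eq) (rule Q f)+
  then show ?thesis
    unfolding block_diff_def delta_def third_diff_def
    by (simp add: complex_eq_iff flip: sum.cartesian_product)
qed

lemma sum_le_SUP_boxes:
  fixes F :: "(int \<times> int \<times> int) set"
  assumes "finite F"
  obtains n :: nat where "F \<subseteq> {- int n<..int n} \<times> {- int n<..int n} \<times> {- int n<..int n}"
proof -
  define n where "n = nat (\<Sum>(a, b, c)\<in>F. \<bar>a\<bar> + \<bar>b\<bar> + \<bar>c\<bar>) + 1"
  have "\<bar>a\<bar> + \<bar>b\<bar> + \<bar>c\<bar> < int n" if "(a, b, c) \<in> F" for a b c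
    using member_le_sum[of "(a, b, c)" F "\<lambda>(a, b, c). \<bar>a\<bar> + \<bar>b\<bar> + \<bar>c\<bar>"] that assms
    by (auto simp: n_def split: prod.splits)
  then have "F \<subseteq> {- int n<..int n} \<times> {- int n<..int n} \<times> {- int n<..int n}"
    by fastforce
  then show thesis by (rule that)
qed

lemma infsum_eq_SUP_boxes:
  fixes u :: "int \<times> int \<times> int \<Rightarrow> ennreal"
  shows "(\<Sum>\<^sub>\<infinity>j. u j) = (SUP n :: nat. \<Sum>a\<in>{- int n<..int n}. \<Sum>b\<in>{- int n<..int n}. \<Sum>c\<in>{- int n<..int n}. u (a, b, c))"
proof -
  let ?J = "\<lambda>n :: nat. {- int n<..int n} \<times> {- int n<..int n} \<times> {- int n<..int n}"
  have "(\<Sum>\<^sub>\<infinity>j. u j) = (SUP F\<in>{F. finite F \<and> F \<subseteq> UNIV}. sum u F)"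
    by (rule nonneg_infsum_complete) simp
  also have "\<dots> = (SUP n. sum u (?J n))"
  proof (rule antisym)
    show "(SUP F\<in>{F. finite F \<and> F \<subseteq> UNIV}. sum u F) \<le> (SUP n. sum u (?J n))"
    proof (rule SUP_least)
      fix F :: "(int \<times> int \<times> int) set" assume "F \<in> {F. finite F \<and> F \<subseteq> UNIV}"
      then obtain n where "F \<subseteq> ?J n" using sum_le_SUP_boxes by blast
      then have "sum u F \<le> sum u (?J n)" by (intro sum_mono2) auto
      also have "\<dots> \<le> (SUP n. sum u (?J n))" by (rule SUP_upper) simp
      finally show "sum u F \<le> (SUP n. sum u (?J n))" .
    qed
    show "(SUP n. sum u (?J n)) \<le> (SUP F\<in>{F. finite F \<and> F \<subseteq> UNIV}. sum u F)"
      by (intro SUP_least SUP_upper) simp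
  qed
  finally show ?thesis by (simp add: sum.cartesian_product)
qed

lemma Lp_norm_le_if_nn_integral_le:
  assumes "0 < p" "0 < K" and le: "(\<integral>\<^sup>+x. enn_powr (F x) p \<partial>lebesgue) \<le> ennreal K * (\<integral>\<^sup>+x. enn_powr (G x) p \<partial>lebesgue)"
  shows "Lp_norm p F \<le> ennreal (K powr (1 / p)) * Lp_norm p G"
  unfolding Lp_norm_def using enn_powr_mono[OF le, of "1 / p"] assms by (simp add: enn_powr_cmult)

lemma box_square_nonneg: "0 \<le> box_square sh f m n x"
  by (auto simp: box_square_def intro!: sum_nonneg)

lemma box_square_mono:
  assumes "m' \<le> m" "n \<le> n'"
  shows "box_square sh f m n x \<le> box_square sh f m' n' x"
proof -
  have "box_square sh f m n x = (\<Sum>(a, b, c)\<in>scale_box m n. (delta sh f a b c x)\<^sup>2)" for m n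
    by (simp add: box_square_def sum.cartesian_product)
  then show ?thesis using assms by (auto intro!: sum_mono2)
qed

lemma box_square_measurable [measurable]: "box_square sh f m n \<in> borel_measurable lebesgue"
  unfolding box_square_def[abs_def] by measurable

text \<open>The square of the square function is the increasing limit of the sums \<open>S n\<close> over the boxes
  \<open>(-n, n]\<^sup>3\<close> of scales, and \<open>S n\<close> splits into the contributions of the real and the imaginary part.\<close>
theorem block_square_equivalence:
  fixes p :: real
  assumes p: "1 < p"
  shows "\<exists>K. 1 \<le> K \<and> (\<forall>(sh :: 'a::euclidean_space grid) \<Q> f. tri_grid sh \<longrightarrow>
    (\<forall>a b c g. (THE Q. Q \<in> \<Q> (a, b, c) \<and> g \<in> Q) = cell (sh a b c) g) \<longrightarrow> f \<in> Lp_space p \<longrightarrow>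
    block_square \<Q> f \<in> borel_measurable lebesgue \<and>
    Lp_norm p (block_square \<Q> f) \<le> ennreal K * Lp_norm p (\<lambda>x. ennreal (cmod (f x))) \<and>
    Lp_norm p (\<lambda>x. ennreal (cmod (f x))) \<le> ennreal K * Lp_norm p (block_square \<Q> f))"
proof -
  obtain K where K: "0 < K" and real: "\<And>(sh :: 'a grid) f. tri_grid sh \<Longrightarrow>
    f \<in> borel_measurable lebesgue \<Longrightarrow> pint p f < \<infinity> \<Longrightarrow>
    (\<forall>m n. m \<le> n \<longrightarrow> square_pint p sh f m n \<le> ennreal K * pint p f) \<and>
    (\<forall>M. (\<forall>m n. m \<le> n \<longrightarrow> square_pint p sh f m n \<le> M) \<longrightarrow>
      pint p f \<le> ennreal K * M)"
    using square_function_real[OF p, where 'a='a] by blast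
  define L where "L = max 1 (2 powr p * (2 * K))"
  have L: "1 \<le> L" "2 powr p * (2 * K) \<le> L" by (auto simp: L_def)
  have two: "(u + v) powr q \<le> 2 powr p * (u powr q + v powr q)" if "0 \<le> u" "0 \<le> v" "0 \<le> q" "q \<le> p" for u v q :: real
  proof -
    have "(u + v) powr q \<le> 2 powr q * (u powr q + v powr q)"
      using abs_sum_powr_le[of "{True, False}" q "\<lambda>i. if i then u else v"] that by simp
    also have "\<dots> \<le> 2 powr p * (u powr q + v powr q)"
      using that by (intro mult_right_mono powr_mono) auto
    finally show ?thesis .
  qed
  show ?thesis
  proof (rule exI[of _ "L powr (1 / p)"], rule conjI, use L p in \<open>simp add: ge_one_powr_ge_zero\<close>, intro allI impI)
    fix sh :: "'a grid" and \<Q> and f :: "'a \<Rightarrow> complex"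
    assume grid: "tri_grid sh" and Q: "\<forall>a b c g. (THE Q. Q \<in> \<Q> (a, b, c) \<and> g \<in> Q) = cell (sh a b c) g"
      and f: "f \<in> Lp_space p"
    define N where "N = (\<integral>\<^sup>+x. ennreal (cmod (f x) powr p) \<partial>lebesgue)"
    have fm [measurable]: "f \<in> borel_measurable lebesgue" using f by (simp add: Lp_space_def)
    have N: "(\<integral>\<^sup>+x. enn_powr (ennreal (cmod (f x))) p \<partial>lebesgue) = N"
      by (simp add: N_def enn_powr_ennreal)
    have "N < \<infinity>"
      using f N by (cases N) (auto simp: Lp_space_def Lp_norm_def)
    define fR where "fR = (\<lambda>x. Re (f x))"
    define fI where "fI = (\<lambda>x. Im (f x))"
    have [measurable]: "fR \<in> borel_measurable lebesgue" "fI \<in> borel_measurable lebesgue"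
      unfolding fR_def fI_def by measurable
    have RN: "pint p fR \<le> N" "pint p fI \<le> N"
      unfolding pint_def N_def fR_def fI_def using p
      by (auto intro!: nn_integral_mono ennreal_leI powr_mono2 abs_Re_le_cmod abs_Im_le_cmod)
    have Rfin: "fR \<in> borel_measurable lebesgue" "pint p fR < \<infinity>"
      and Ifin: "fI \<in> borel_measurable lebesgue" "pint p fI < \<infinity>"
      using RN \<open>N < \<infinity>\<close> by auto
    note ci = cell_integrable_Lp(2)[OF p Rfin] cell_integrable_Lp(2)[OF p Ifin]
    define S where "S = (\<lambda>n x. box_square sh fR (- int n) (int n) x + box_square sh fI (- int n) (int n) x)"
    have S0: "0 \<le> S n x" for n x by (auto simp: S_def intro!: add_nonneg_nonneg box_square_nonneg)
    have Sm [measurable]: "S n \<in> borel_measurable lebesgue" for n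
      unfolding S_def by measurable
    have Sinc: "S n x \<le> S n' x" if "n \<le> n'" for n n' x
      using that by (auto simp: S_def intro!: add_mono box_square_mono)
    have inf: "(\<Sum>\<^sub>\<infinity>j. ennreal ((cmod (block_diff \<Q> j f x))\<^sup>2)) = (SUP n. ennreal (S n x))" for x
    proof -
      have "ennreal ((cmod (block_diff \<Q> (a, b, c) f x))\<^sup>2) = ennreal ((delta sh fR a b c x)\<^sup>2 + (delta sh fI a b c x)\<^sup>2)" for a b c
      proof -
        have "block_diff \<Q> (a, b, c) f x = Complex (delta sh fR a b c x) (delta sh fI a b c x)"
          unfolding fR_def fI_def
          by (rule block_diff_eq) (use Q ci in \<open>auto simp: fR_def fI_def\<close>)
        then show ?thesis by (simp add: cmod_power2)
      qed
      then show ?thesis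
        unfolding infsum_eq_SUP_boxes
        by (simp add: sum_ennreal sum_nonneg S_def box_square_def sum.distrib)
    qed
    have SQ: "enn_powr (block_square \<Q> f x) q = (SUP n. ennreal (S n x powr (q / 2)))" if "0 < q" for x q
      using that S0 by (simp add: block_square_def inf enn_powr_powr enn_powr_SUP enn_powr_ennreal powr_powr)
    have "block_square \<Q> f x = (SUP n. ennreal (S n x powr (1 / 2)))" for x
      using SQ[of 1 x] by simp
    then have m: "block_square \<Q> f \<in> borel_measurable lebesgue"
      by (subst measurable_cong[where g = "\<lambda>x. SUP n. ennreal (S n x powr (1 / 2))"]) auto
    define T where "T = (\<integral>\<^sup>+x. enn_powr (block_square \<Q> f x) p \<partial>lebesgue)"
    have T: "T = (SUP n. \<integral>\<^sup>+x. ennreal (S n x powr (p / 2)) \<partial>lebesgue)"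
      unfolding T_def SQ[OF less_trans[OF zero_less_one p]]
    proof (rule nn_integral_monotone_convergence_SUP)
      show "incseq (\<lambda>n x. ennreal (S n x powr (p / 2)))"
        using p S0 Sinc by (auto simp: incseq_def le_fun_def intro!: ennreal_leI powr_mono2)
    qed simp
    have K2: "ennreal (2 powr p) * (ennreal K * M + ennreal K * M) \<le> ennreal L * M" for M
    proof -
      have "ennreal (2 * K) = ennreal K + ennreal K"
        using K by (subst ennreal_plus[symmetric]) auto
      then have "ennreal K * M + ennreal K * M = ennreal (2 * K) * M" by (simp only: distrib_right)
      moreover have "ennreal (2 powr p * (2 * K)) = ennreal (2 powr p) * ennreal (2 * K)"
        using K by (intro ennreal_mult) auto
      ultimately have "ennreal (2 powr p) * (ennreal K * M + ennreal K * M) = ennreal (2 powr p * (2 * K)) * M"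
        by (simp only: mult.assoc)
      also have "\<dots> \<le> ennreal L * M" by (intro mult_right_mono ennreal_leI L) simp
      finally show ?thesis .
    qed
    have up: "T \<le> ennreal L * N"
      unfolding T
    proof (rule SUP_least)
      fix n
      have "(\<integral>\<^sup>+x. ennreal (S n x powr (p / 2)) \<partial>lebesgue)
        \<le> (\<integral>\<^sup>+x. ennreal (2 powr p) * (ennreal (box_square sh fR (- int n) (int n) x powr (p / 2))
            + ennreal (box_square sh fI (- int n) (int n) x powr (p / 2))) \<partial>lebesgue)"
        using p two[of _ _ "p / 2"]
        by (intro nn_integral_mono) (simp add: S_def box_square_nonneg ennreal_leI flip: ennreal_mult ennreal_plus)
      also have "\<dots> = ennreal (2 powr p) * (square_pint p sh fR (- int n) (int n)
            + square_pint p sh fI (- int n) (int n))"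
        by (simp add: nn_integral_cmult nn_integral_add)
      also have "\<dots> \<le> ennreal (2 powr p) * (ennreal K * pint p fR + ennreal K * pint p fI)"
        using real[OF grid Rfin] real[OF grid Ifin] by (intro mult_left_mono add_mono) auto
      also have "\<dots> \<le> ennreal (2 powr p) * (ennreal K * N + ennreal K * N)"
        by (intro mult_left_mono add_mono RN) auto
      also have "\<dots> \<le> ennreal L * N" by (rule K2)
      finally show "(\<integral>\<^sup>+x. ennreal (S n x powr (p / 2)) \<partial>lebesgue) \<le> ennreal L * N" .
    qed
    have box: "square_pint p sh h m n \<le> T" if "h \<in> {fR, fI}" for h m n
    proof -
      define k where "k = nat (max \<bar>m\<bar> \<bar>n\<bar>)"
      have "box_square sh h m n x \<le> box_square sh h (- int k) (int k) x" for x
        by (rule box_square_mono) (auto simp: k_def)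
      also have "box_square sh h (- int k) (int k) x \<le> S k x" for x
        using that box_square_nonneg by (auto simp: S_def)
      finally have "square_pint p sh h m n \<le> (\<integral>\<^sup>+x. ennreal (S k x powr (p / 2)) \<partial>lebesgue)"
        using p by (intro nn_integral_mono ennreal_leI powr_mono2 box_square_nonneg) auto
      also have "\<dots> \<le> T" unfolding T by (rule SUP_upper) simp
      finally show ?thesis .
    qed
    have "N \<le> (\<integral>\<^sup>+x. ennreal (2 powr p) * (ennreal (\<bar>fR x\<bar> powr p) + ennreal (\<bar>fI x\<bar> powr p)) \<partial>lebesgue)"
      unfolding N_def
    proof (rule nn_integral_mono)
      fix x
      have "cmod (f x) powr p \<le> (\<bar>fR x\<bar> + \<bar>fI x\<bar>) powr p"
        using p cmod_le[of "f x"] by (intro powr_mono2) (auto simp: fR_def fI_def)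
      also have "\<dots> \<le> 2 powr p * (\<bar>fR x\<bar> powr p + \<bar>fI x\<bar> powr p)"
        using p by (intro two) auto
      finally show "ennreal (cmod (f x) powr p) \<le> ennreal (2 powr p) * (ennreal (\<bar>fR x\<bar> powr p) + ennreal (\<bar>fI x\<bar> powr p))"
        by (simp add: ennreal_leI flip: ennreal_mult ennreal_plus)
    qed
    also have "\<dots> = ennreal (2 powr p) * (pint p fR + pint p fI)"
      unfolding pint_def by (simp add: nn_integral_cmult nn_integral_add)
    also have "\<dots> \<le> ennreal (2 powr p) * (ennreal K * T + ennreal K * T)"
      using real[OF grid Rfin] real[OF grid Ifin] box by (intro mult_left_mono add_mono) auto
    also have "\<dots> \<le> ennreal L * T" by (rule K2)
    finally have lo: "N \<le> ennreal L * T" .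
    have "Lp_norm p (block_square \<Q> f) \<le> ennreal (L powr (1 / p)) * Lp_norm p (\<lambda>x. ennreal (cmod (f x)))"
      "Lp_norm p (\<lambda>x. ennreal (cmod (f x))) \<le> ennreal (L powr (1 / p)) * Lp_norm p (block_square \<Q> f)"
      using p L up lo unfolding N[symmetric] T_def by (intro Lp_norm_le_if_nn_integral_le; simp)+
    with m show "block_square \<Q> f \<in> borel_measurable lebesgue \<and>
      Lp_norm p (block_square \<Q> f) \<le> ennreal (L powr (1 / p)) * Lp_norm p (\<lambda>x. ennreal (cmod (f x))) \<and>
      Lp_norm p (\<lambda>x. ennreal (cmod (f x))) \<le> ennreal (L powr (1 / p)) * Lp_norm p (block_square \<Q> f)"
      by blast
  qed
qed

section \<open>Invariance of Lebesgue measure under the shear\<close>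

definition shear :: "real \<Rightarrow> real \<times> real \<Rightarrow> real \<times> real" where
  "shear c = (\<lambda>(t1, t2). (t1 + c * t2, t2))"

lemma shear_measurable [measurable]: "shear c \<in> borel \<rightarrow>\<^sub>M borel"
  unfolding shear_def case_prod_beta
  by (intro borel_measurable_continuous_onI continuous_intros)

text \<open>For fixed \<open>t2\<close> the shear is a translation in \<open>t1\<close>.\<close>
lemma distr_shear_lborel: "distr lborel lborel (shear c) = lborel"
proof (rule measure_eqI)
  fix A :: "(real \<times> real) set" assume "A \<in> sets (distr lborel lborel (shear c))"
  then have A: "A \<in> sets borel" by simp
  have shift: "(\<integral>\<^sup>+t. h (t + u) \<partial>lborel) = (\<integral>\<^sup>+t. h t \<partial>lborel)"
    if h: "h \<in> borel_measurable borel" for h :: "real \<Rightarrow> ennreal" and u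
  proof -
    have "(\<integral>\<^sup>+t. h t \<partial>lborel) = (\<integral>\<^sup>+t. h t \<partial>distr lborel borel ((+) u))"
      by (simp only: lborel_distr_plus)
    also have "\<dots> = (\<integral>\<^sup>+t. h (u + t) \<partial>lborel)" by (rule nn_integral_distr) (simp_all add: h)
    finally show ?thesis by (simp add: add.commute)
  qed
  have I: "(indicator A :: _ \<Rightarrow> ennreal) \<in> borel_measurable borel" using A by simp
  have sec: "(\<lambda>t1. indicator A (t1, t2) :: ennreal) \<in> borel_measurable borel" for t2
    by (rule measurable_compose[OF _ I]) (intro borel_measurable_continuous_onI continuous_intros)
  have IP: "(indicator A :: _ \<Rightarrow> ennreal) \<in> borel_measurable (lborel \<Otimes>\<^sub>M lborel)"
    unfolding lborel_prod using I by simp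
  have IS: "(\<lambda>x. indicator A (shear c x) :: ennreal) \<in> borel_measurable (lborel \<Otimes>\<^sub>M lborel)"
    unfolding lborel_prod using measurable_compose[OF shear_measurable I] by simp
  have "emeasure (distr lborel lborel (shear c)) A = (\<integral>\<^sup>+x. indicator A x \<partial>distr lborel lborel (shear c))"
    using A by simp
  also have "\<dots> = (\<integral>\<^sup>+x. indicator A (shear c x) \<partial>lborel)"
    by (rule nn_integral_distr) (use I in simp_all)
  also have "\<dots> = (\<integral>\<^sup>+x. indicator A (shear c x) \<partial>(lborel \<Otimes>\<^sub>M lborel))" by (simp only: lborel_prod)
  also have "\<dots> = (\<integral>\<^sup>+t2. \<integral>\<^sup>+t1. indicator A (shear c (t1, t2)) \<partial>lborel \<partial>lborel)"
    using lborel_pair.nn_integral_snd[of "\<lambda>x. indicator A (shear c x)"] IS by simp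
  also have "\<dots> = (\<integral>\<^sup>+t2. \<integral>\<^sup>+t1. indicator A (t1, t2) \<partial>lborel \<partial>lborel)"
    unfolding shear_def prod.case by (intro nn_integral_cong shift[OF sec])
  also have "\<dots> = (\<integral>\<^sup>+x. indicator A x \<partial>(lborel \<Otimes>\<^sub>M lborel))"
    using lborel_pair.nn_integral_snd[of "indicator A"] IP by simp
  also have "\<dots> = emeasure lborel A" unfolding lborel_prod using A by simp
  finally show "emeasure (distr lborel lborel (shear c)) A = emeasure lborel A" .
qed simp

definition on_snd :: "('b \<Rightarrow> 'b) \<Rightarrow> 'a \<times> 'b \<Rightarrow> 'a \<times> 'b" where
  "on_snd h = (\<lambda>(x, y). (x, h y))"

lemma on_snd_measurable:
  fixes h :: "'b::euclidean_space \<Rightarrow> 'b"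
  assumes [measurable]: "h \<in> borel \<rightarrow>\<^sub>M borel"
  shows "(on_snd h :: 'a::euclidean_space \<times> 'b \<Rightarrow> _) \<in> borel \<rightarrow>\<^sub>M borel"
proof -
  have "(on_snd h :: 'a \<times> 'b \<Rightarrow> _) \<in> borel \<Otimes>\<^sub>M borel \<rightarrow>\<^sub>M borel \<Otimes>\<^sub>M borel"
    unfolding on_snd_def by measurable
  then show ?thesis by (simp add: borel_prod)
qed

lemma distr_lborel_on_snd:
  fixes h :: "'b::euclidean_space \<Rightarrow> 'b"
  assumes m: "h \<in> borel \<rightarrow>\<^sub>M borel" and h: "distr lborel lborel h = lborel"
  shows "distr lborel lborel (on_snd h) = (lborel :: ('a::euclidean_space \<times> 'b) measure)"
proof -
  have "distr lborel lborel (\<lambda>x. x) \<Otimes>\<^sub>M distr lborel lborel h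
      = distr (lborel \<Otimes>\<^sub>M lborel :: ('a \<times> 'b) measure) (lborel \<Otimes>\<^sub>M lborel) (\<lambda>(x, y). (x, h y))"
    by (rule pair_measure_distr) (simp_all add: h m sigma_finite_lborel)
  moreover have "distr lborel lborel (\<lambda>x. x) = (lborel :: 'a measure)" by (rule distr_id)
  ultimately show ?thesis by (simp add: h lborel_prod on_snd_def)
qed

definition nshear :: "real \<Rightarrow> ('n1::finite, 'n2::finite, 'n3::finite) nspace \<Rightarrow> ('n1, 'n2, 'n3) nspace" where
  "nshear c = on_snd (on_snd (on_snd (shear c)))"

lemma nshear_apply: "nshear c (z1, z2, z3, t1, t2) = (z1, z2, z3, t1 + c * t2, t2)"
  by (simp add: nshear_def on_snd_def shear_def)

lemma nshear_lebesgue: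
  fixes c :: real
  defines "T \<equiv> (nshear c :: ('n1::finite, 'n2::finite, 'n3::finite) nspace \<Rightarrow> _)"
  shows "T \<in> lebesgue \<rightarrow>\<^sub>M lebesgue" "distr lebesgue lebesgue T = lebesgue"
proof -
  have T: "T \<in> borel \<rightarrow>\<^sub>M borel"
    unfolding T_def nshear_def by (intro on_snd_measurable shear_measurable)
  have "distr lborel lborel T = lborel"
    unfolding T_def nshear_def
    by (intro distr_lborel_on_snd on_snd_measurable shear_measurable distr_shear_lborel)
  moreover have "T \<in> lborel \<rightarrow>\<^sub>M lborel" using T by simp
  ultimately have d: "distr lebesgue lborel T = lborel" by (simp add: distr_completion)
  have Tl: "T \<in> lebesgue \<rightarrow>\<^sub>M lborel"
    using T by (simp add: measurable_completion)
  show "T \<in> lebesgue \<rightarrow>\<^sub>M lebesgue"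
    by (rule completion.measurable_completion2[OF Tl]) (simp add: d)
  show "distr lebesgue lebesgue T = lebesgue"
    using completion.completion_distr_eq[OF Tl] by (simp add: d)
qed

lemma Theta_eq_nshear: "Theta = nshear (-1)"
  by (auto simp: Theta_def nshear_apply)

lemma nshear_inverse: "nshear c (nshear (- c) g) = g"
  by (cases g) (simp add: nshear_apply)

lemma inv_Theta_eq_nshear: "inv Theta = nshear 1"
  unfolding Theta_eq_nshear
  by (rule inv_equality) (use nshear_inverse[of 1] nshear_inverse[of "-1"] in simp_all)

lemma Lp_norm_Theta:
  assumes [measurable]: "F \<in> borel_measurable lebesgue" and p: "0 < p"
  shows "Lp_norm p (F \<circ> Theta) = Lp_norm p (F :: ('n1::finite, 'n2::finite, 'n3::finite) nspace \<Rightarrow> ennreal)"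
proof -
  have m: "(\<lambda>x. enn_powr (F x) p) \<in> borel_measurable lebesgue"
    unfolding enn_powr_def by measurable
  have "(\<integral>\<^sup>+x. enn_powr (F x) p \<partial>lebesgue) = (\<integral>\<^sup>+x. enn_powr (F x) p \<partial>distr lebesgue lebesgue Theta)"
    by (simp only: Theta_eq_nshear nshear_lebesgue(2))
  also have "\<dots> = (\<integral>\<^sup>+x. enn_powr (F (Theta x)) p \<partial>lebesgue)"
    unfolding Theta_eq_nshear by (rule nn_integral_distr[OF nshear_lebesgue(1)]) (simp add: m)
  finally show ?thesis by (simp add: Lp_norm_def)
qed

section \<open>Norm equivalence\<close>

theorem theorem6p6:
  fixes p :: real
  assumes "1 < p"
  shows "\<exists>c C :: real. 0 < c \<and> c \<le> C \<and>
    (\<forall>\<kappa> :: int. \<kappa> \<ge> 10 \<longrightarrow> (\<forall>k \<in> {1, 2, 3 :: nat}.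
      \<forall>f :: ('n1::finite, 'n2::finite, 'n3::finite) nspace \<Rightarrow> complex. f \<in> Lp_space p \<longrightarrow>
        ennreal c * Lp_norm p (\<lambda>g. ennreal (cmod (f g))) \<le> Lp_norm p (square_fun \<kappa> k f) \<and>
        Lp_norm p (square_fun \<kappa> k f) \<le> ennreal C * Lp_norm p (\<lambda>g. ennreal (cmod (f g)))))"
proof -
  obtain K where K: "1 \<le> K" and main: "\<And>(sh :: int \<Rightarrow> int \<Rightarrow> int \<Rightarrow> ('n1, 'n2, 'n3) nspace \<Rightarrow> int) \<Q> f. tri_grid sh \<Longrightarrow>
    (\<forall>a b c g. (THE Q. Q \<in> \<Q> (a, b, c) \<and> g \<in> Q) = cell (sh a b c) g) \<Longrightarrow> f \<in> Lp_space p \<Longrightarrow>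
    block_square \<Q> f \<in> borel_measurable lebesgue \<and>
    Lp_norm p (block_square \<Q> f) \<le> ennreal K * Lp_norm p (\<lambda>x. ennreal (cmod (f x))) \<and>
    Lp_norm p (\<lambda>x. ennreal (cmod (f x))) \<le> ennreal K * Lp_norm p (block_square \<Q> f)"
    using block_square_equivalence[OF assms, where 'a="('n1, 'n2, 'n3) nspace"] by blast
  define equiv where "equiv = (\<lambda>(X :: ennreal) Y. Y \<le> ennreal K * X \<and> X \<le> ennreal K * Y)"
  have eq: "equiv (Lp_norm p (\<lambda>g. ennreal (cmod (f g)))) (Lp_norm p (square_fun \<kappa> k f))"
    if k: "k \<in> {1, 2, 3}" and f: "f \<in> Lp_space p"
    for \<kappa> k and f :: "('n1, 'n2, 'n3) nspace \<Rightarrow> complex"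
  proof -
    have sq1: "square_fun \<kappa> 1 f = block_square (blocks1 \<kappa>) f"
      and sq2: "square_fun \<kappa> 2 f = block_square (blocks2 \<kappa>) f"
      and sq3: "square_fun \<kappa> 3 f = block_square (blocks2 \<kappa>) (U3_star f) \<circ> Theta"
      by (simp_all add: square_fun_def[abs_def] block_square_def[abs_def] mart_diff_def U3_def fun_eq_iff)
    have p: "0 < p" using assms by simp
    have fm: "f \<in> borel_measurable lebesgue" using f by (simp add: Lp_space_def)
    have "inv Theta (Theta g) = g" for g :: "('n1, 'n2, 'n3) nspace"
      unfolding inv_Theta_eq_nshear unfolding Theta_eq_nshear by (rule nshear_inverse)
    then have s: "U3_star f (Theta g) = f g" for g by (simp add: U3_star_def)
    have sm [measurable]: "U3_star f \<in> borel_measurable lebesgue"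
      unfolding U3_star_def inv_Theta_eq_nshear comp_def
      by (rule measurable_compose[OF nshear_lebesgue(1) fm])
    have sn: "Lp_norm p (\<lambda>x. ennreal (cmod (U3_star f x))) = Lp_norm p (\<lambda>x. ennreal (cmod (f x)))"
      using Lp_norm_Theta[of "\<lambda>x. ennreal (cmod (U3_star f x))", OF _ p] by (simp add: comp_def s)
    have sL: "U3_star f \<in> Lp_space p"
      using f sn sm by (simp add: Lp_space_def)
    note m1 = main[OF tri_grid_block_shape _ f, of "blocks1 \<kappa>" True \<kappa>] and m2 = main[OF tri_grid_block_shape _ f, of "blocks2 \<kappa>" False \<kappa>]
      and m3 = main[OF tri_grid_block_shape _ sL, of "blocks2 \<kappa>" False \<kappa>]
    have b: "\<forall>a b c g. (THE Q. Q \<in> blocks1 \<kappa> (a, b, c) \<and> g \<in> Q) = cell (block_shape True \<kappa> a b c) g"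
      "\<forall>a b c g. (THE Q. Q \<in> blocks2 \<kappa> (a, b, c) \<and> g \<in> Q) = cell (block_shape False \<kappa> a b c) (g :: ('n1, 'n2, 'n3) nspace)"
      using blocks1_the blocks2_the by blast+
    consider "k = 1" | "k = 2" | "k = 3" using k by auto
    then show ?thesis
    proof cases
      case 1
      then show ?thesis unfolding equiv_def using m1[OF b(1)] sq1 by simp
    next
      case 2
      then show ?thesis unfolding equiv_def using m2[OF b(2)] sq2 by simp
    next
      case 3
      have "Lp_norm p (square_fun \<kappa> 3 f) = Lp_norm p (block_square (blocks2 \<kappa>) (U3_star f))"
        unfolding sq3 using m3[OF b(2)] by (intro Lp_norm_Theta p) blast
      then show ?thesis unfolding equiv_def 3 using m3[OF b(2)] by (simp add: sn)
    qed
  qed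
  have inv: "ennreal (1 / K) * X \<le> Y" if "X \<le> ennreal K * Y" for X Y
  proof -
    have "ennreal (1 / K) * X \<le> ennreal (1 / K) * (ennreal K * Y)" using that by (rule mult_left_mono) simp
    also have "\<dots> = Y" using K by (simp flip: mult.assoc ennreal_mult)
    finally show ?thesis .
  qed
  have "0 < 1 / K" "1 / K \<le> K"
    using K by (auto simp: divide_le_eq intro: order_trans[OF _ mult_mono[of 1 K 1 K]])
  then show ?thesis
    by (rule_tac exI[of _ "1 / K"], rule_tac exI[of _ K], intro conjI allI impI ballI)
      (use eq inv in \<open>unfold equiv_def, blast+\<close>)
qed

end
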